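(* Let $\Bbbk$ be a field of characteristic zero, let $n$ be a positive integer, let $S=\Bbbk[x_1,\dots,x_n]=\bigoplus_{d\ge 0}S_d$ be the standard graded polynomial ring, and let $R=S^{(2)}=\bigoplus_{d\ge 0}S_{2d}$ be its second Veronese subalgebra, regarded as a standard graded $\Bbbk$-algebra with $R_d=S_{2d}$. Then the Koszul homology algebra $H(R)=\bigoplus_{i,j}H_i(R)_j$ is generated, as a $\Bbbk$-algebra, by its lowest linear strand $\bigoplus_i H_i(R)_{i+1}$.
   Context: For a standard graded $\Bbbk$-algebra $R$, let $K(R)=R\otimes_\Bbbk\bigwedge^*R_1$ denote the Koszul complex of $R$ with respect to a minimal system of generators (a $\Bbbk$-basis) of $R_1$; its differential is the $R$-linear derivation sending $1\otimes v\mapsto v\in R$ for $v\in R_1$. It is a differential graded algebra, so its homology $H(R)=\bigoplus_i H_i(R)$ is a graded-commutative $\Bbbk$-algebra. It is bigraded: $H_i(R)_j$ is the part of homological degree $i$ and internal degree $j$, where the internal degree is induced by the grading of $R$ and by giving each exterior generator $v\in R_1$ internal degree $1$. Thus $\dim_\Bbbk H_i(R)_j=\dim_\Bbbk \operatorname{Tor}_i^{A}(R,\Bbbk)_j$ with $A=\operatorname{Sym}_\Bbbk(R_1)$. *)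

theory Defs
  imports
    "HOL-Library.Poly_Mapping"
    "HOL-Algebra.QuotRing"
    "HOL-Algebra.Generated_Rings"
    "HOL-Algebra.Generated_Groups"
begin

section \<open>Polynomials and Veronese subalgebras\<close>

text \<open>
  Polynomials are finitely supported maps from monomials to coefficients, and monomials are
  finitely supported exponent vectors. The polynomial ring in \<open>x\<^sub>1, \<dots>, x\<^sub>n\<close> consists of
  the polynomials that only involve the variable indices \<open>0, \<dots>, n - 1\<close>.
\<close>

type_synonym 'k mpoly = "(nat \<Rightarrow>\<^sub>0 nat) \<Rightarrow>\<^sub>0 'k"

definition const_poly :: "'k::field \<Rightarrow> 'k mpoly" where
  "const_poly c = Poly_Mapping.single 0 c"

definition scale_poly :: "'k::field \<Rightarrow> 'k mpoly \<Rightarrow> 'k mpoly" where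
  "scale_poly c p = const_poly c * p"

global_interpretation poly_vs: vector_space "scale_poly :: 'k::field \<Rightarrow> 'k mpoly \<Rightarrow> 'k mpoly"
proof
  show "scale_poly 1 x = x" for x :: "'k mpoly"
    by (simp add: scale_poly_def const_poly_def)
qed (simp_all add: scale_poly_def const_poly_def single_add mult_single algebra_simps
       flip: mult.assoc)

definition is_basis_of :: "'k::field mpoly list \<Rightarrow> 'k mpoly set \<Rightarrow> bool" where
  "is_basis_of fs V \<longleftrightarrow>
     distinct fs \<and> poly_vs.independent (set fs) \<and> poly_vs.span (set fs) = V"

definition monom_degree :: "(nat \<Rightarrow>\<^sub>0 nat) \<Rightarrow> nat" where
  "monom_degree m = (\<Sum>i\<in>Poly_Mapping.keys m. Poly_Mapping.lookup m i)"

definition homog_poly :: "nat \<Rightarrow> nat \<Rightarrow> 'k::field mpoly set" where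
  "homog_poly n d =
     {p. \<forall>m\<in>Poly_Mapping.keys p. Poly_Mapping.keys m \<subseteq> {..<n} \<and> monom_degree m = d}"

text \<open>
  A graded algebra is given by the family \<open>A\<close> of its graded components inside an ambient
  commutative ring. The \<open>c\<close>-th Veronese subalgebra has components \<open>A (c * d)\<close>, which
  become its components of degree \<open>d\<close>.
\<close>

definition veronese :: "nat \<Rightarrow> (nat \<Rightarrow> 'r set) \<Rightarrow> nat \<Rightarrow> 'r set" where
  "veronese c A d = A (c * d)"

definition graded_total :: "(nat \<Rightarrow> 'r::comm_ring_1 set) \<Rightarrow> 'r set" where
  "graded_total A = {\<Sum>d\<in>D. a d | D a. finite D \<and> (\<forall>d\<in>D. a d \<in> A d)}"


section \<open>The Koszul complex and its homology algebra\<close>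

text \<open>
  Let \<open>fs\<close> be a basis of the degree one component of a graded algebra \<open>R\<close> with components
  \<open>A\<close>. The exterior algebra on that component has the basis
  \<open>e\<^sub>I = e\<^sub>i\<^sub>1 \<and> \<dots> \<and> e\<^sub>i\<^sub>p\<close> for \<open>I = {i\<^sub>1 < \<dots> < i\<^sub>p} \<subseteq> {..<length fs}\<close>,
  where \<open>e\<^sub>i\<close> is the exterior generator corresponding to \<open>fs ! i\<close>. An element
  \<open>\<Sum> z\<^sub>I e\<^sub>I\<close> of the Koszul complex is encoded by its coefficient function \<open>I \<mapsto> z\<^sub>I\<close>.
\<close>

text \<open>
  \<open>e\<^sub>I \<and> e\<^sub>J = wedge_sign I J \<cdot> e\<^bsub>I \<union> J\<^esub>\<close> for disjoint \<open>I\<close> and \<open>J\<close>: the exponent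
  is the number of transpositions needed to sort the product.
\<close>

definition wedge_sign :: "nat set \<Rightarrow> nat set \<Rightarrow> 'r::comm_ring_1" where
  "wedge_sign I J = (- 1) ^ card {(i, j). i \<in> I \<and> j \<in> J \<and> j < i}"

definition koszul_algebra ::
    "(nat \<Rightarrow> 'r::comm_ring_1 set) \<Rightarrow> 'r list \<Rightarrow> (nat set \<Rightarrow> 'r) ring" where
  "koszul_algebra A fs =
     \<lparr>carrier = {z. \<forall>I. z I \<in> graded_total A \<and> (\<not> I \<subseteq> {..<length fs} \<longrightarrow> z I = 0)},
      mult = (\<lambda>z w K. \<Sum>I\<in>Pow K. wedge_sign I (K - I) * z I * w (K - I)),
      one = (\<lambda>I. if I = {} then 1 else 0),
      zero = (\<lambda>I. 0),
      add = (\<lambda>z w I. z I + w I)\<rparr>"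

text \<open>
  The coefficient form of
  \<open>d e\<^sub>I = \<Sum>\<^sub>k (- 1)\<^sup>k\<^sup>-\<^sup>1 f\<^sub>i\<^sub>k e\<^bsub>I - {i\<^sub>k}\<^esub>\<close> for \<open>I = {i\<^sub>1 < \<dots> < i\<^sub>p}\<close>.
\<close>

definition koszul_diff :: "'r::comm_ring_1 list \<Rightarrow> (nat set \<Rightarrow> 'r) \<Rightarrow> (nat set \<Rightarrow> 'r)" where
  "koszul_diff fs z =
     (\<lambda>K. \<Sum>i\<in>{..<length fs} - K. (- 1) ^ card {j \<in> K. j < i} * (fs ! i) * z (insert i K))"

definition koszul_cycles ::
    "(nat \<Rightarrow> 'r::comm_ring_1 set) \<Rightarrow> 'r list \<Rightarrow> (nat set \<Rightarrow> 'r) ring" where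
  "koszul_cycles A fs =
     (koszul_algebra A fs)
       \<lparr>carrier := {z \<in> carrier (koszul_algebra A fs). koszul_diff fs z = (\<lambda>I. 0)}\<rparr>"

definition koszul_boundaries ::
    "(nat \<Rightarrow> 'r::comm_ring_1 set) \<Rightarrow> 'r list \<Rightarrow> (nat set \<Rightarrow> 'r) set" where
  "koszul_boundaries A fs = koszul_diff fs ` carrier (koszul_algebra A fs)"

definition koszul_homology ::
    "(nat \<Rightarrow> 'r::comm_ring_1 set) \<Rightarrow> 'r list \<Rightarrow> (nat set \<Rightarrow> 'r) set ring" where
  "koszul_homology A fs = koszul_cycles A fs Quot koszul_boundaries A fs"

definition homology_class ::
    "(nat \<Rightarrow> 'r::comm_ring_1 set) \<Rightarrow> 'r list \<Rightarrow> (nat set \<Rightarrow> 'r) \<Rightarrow> (nat set \<Rightarrow> 'r) set" where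
  "homology_class A fs z = koszul_boundaries A fs +>\<^bsub>koszul_cycles A fs\<^esub> z"

text \<open>
  Since every exterior generator has internal degree one, \<open>r e\<^sub>I\<close> with \<open>r \<in> A d\<close> has
  homological degree \<open>card I\<close> and internal degree \<open>d + card I\<close>.
\<close>

definition koszul_bidegree ::
    "(nat \<Rightarrow> 'r::comm_ring_1 set) \<Rightarrow> 'r list \<Rightarrow> nat \<Rightarrow> nat \<Rightarrow> (nat set \<Rightarrow> 'r) set" where
  "koszul_bidegree A fs i j =
     {z \<in> carrier (koszul_algebra A fs).
        \<forall>I. z I \<noteq> 0 \<longrightarrow> card I = i \<and> (\<exists>d. j = d + card I \<and> z I \<in> A d)}"

definition homology_bidegree ::
    "(nat \<Rightarrow> 'r::comm_ring_1 set) \<Rightarrow> 'r list \<Rightarrow> nat \<Rightarrow> nat \<Rightarrow> (nat set \<Rightarrow> 'r) set set" where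
  "homology_bidegree A fs i j =
     homology_class A fs ` (carrier (koszul_cycles A fs) \<inter> koszul_bidegree A fs i j)"

text \<open>The sum \<open>\<Oplus>\<^sub>i H\<^sub>i(R)\<^bsub>i + 1\<^esub>\<close> inside the additive group of the homology algebra.\<close>

definition linear_strand ::
    "(nat \<Rightarrow> 'r::comm_ring_1 set) \<Rightarrow> 'r list \<Rightarrow> (nat set \<Rightarrow> 'r) set set" where
  "linear_strand A fs =
     generate (add_monoid (koszul_homology A fs)) (\<Union>i. homology_bidegree A fs i (i + 1))"

text \<open>
  The \<open>k\<close>-subalgebra generated by \<open>X\<close> is the subring generated by \<open>X\<close> and the image
  of the ground field.
\<close>

definition homology_scalar ::
    "(nat \<Rightarrow> 'k::field mpoly set) \<Rightarrow> 'k mpoly list \<Rightarrow> 'k \<Rightarrow> (nat set \<Rightarrow> 'k mpoly) set" where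
  "homology_scalar A fs c = homology_class A fs (\<lambda>I. if I = {} then const_poly c else 0)"

definition generated_subalgebra ::
    "(nat \<Rightarrow> 'k::field mpoly set) \<Rightarrow> 'k mpoly list \<Rightarrow>
     (nat set \<Rightarrow> 'k mpoly) set set \<Rightarrow> (nat set \<Rightarrow> 'k mpoly) set set" where
  "generated_subalgebra A fs X =
     generate_ring (koszul_homology A fs) (range (homology_scalar A fs) \<union> X)"

end

(*
  Let C be the Koszul complex of S on all quadratic monomials, with exterior generators e_ij; the
  Koszul complex K(R) is its part of even degree in x. The Lie algebra gl_n acts on C by derivations
  E_ij that commute with the differential d. For the operator s = 1/2 sum e_ij D_i D_j one finds
    2 (ds + sd) = sum E_ij E_ji - n sum E_ii.
  Let P be the set of sums of a boundary and an element of the subalgebra generated by the linear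
  cycles and the scalars; it is stable under all E_ij. A cycle z of weight mu lies in P by induction,
  where larger values of sum mu_i^2 come first: if mu_i >= mu_j, then E_ij z has larger value, hence
  is in P, and the identity above shows that f(mu) z is in P for an explicit integer f(mu), by which
  one can divide in characteristic zero unless it vanishes.

  It remains to treat the weights with f(mu) = 0. The complex C is quasi-isomorphic to its quotient
  by all x_i^2 and e_ii, whose monomials of weight mu are the symmetric 0/1-matrices with row sums mu
  (x_i gives the diagonal entry, e_ij the off-diagonal ones). Counting shows that f(mu) = 0 forces the
  rows to be nested, so that every e_ij that occurs has an end point i with x_i in the monomial. Such
  a monomial is, up to sign, the image of a product of the cycles d(e_aa e_aj e_ak ...) / x_a.
*)

theory Submission
  imports Defs "HOL-Library.Function_Algebras" "HOL-Library.Nat_Bijection"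
begin

section \<open>Exterior multiplication and contraction\<close>

text \<open>All arguments are about chains; homology classes enter only at the end. The integer
  f(mu) arises as follows. In the sum of all E_ij E_ji the diagonal terms act on weight mu by
  mu_i^2. If i \<noteq> j and mu_i \<ge> mu_j, the relation [E_ij, E_ji] = E_ii - E_jj turns E_ij
  E_ji z into E_ji E_ij z + (mu_i - mu_j) z, whose first term is in P because E_ij z is; if mu_i <
  mu_j, then E_ij E_ji z is itself in P. So f(mu) is the sum of all mu_i^2 and all positive parts of
  mu_i - mu_j, minus n times the sum of the mu_i. If mu consists of the row sums of a symmetric
  0/1-matrix with rows N_i, the numbers card (N_i - N_j) add up to n sum mu_i - sum mu_i^2. Hence
  f(mu) \<le> 0, with equality only for nested rows. The induction ends because sum mu_i^2 is at
  most (sum mu_i)^2, and sum mu_i is fixed. The cycles d(...)/x_a have degree one in x, hence lie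
  outside K(R); an inactive monomial of even degree has an even number of x_a, so they can be used
  in pairs. The theorem allows any basis of R_1, while the argument needs monomials; a change of
  basis of the exterior algebra bridges this.\<close>

definition ext_sign :: "nat \<Rightarrow> nat set \<Rightarrow> 'r::comm_ring_1" where
  "ext_sign k K = (- 1) ^ card {j \<in> K. j < k}"

text \<open>Multiplication by a single generator and contraction against it are handled as
  operators: their relations are simpler than the signs of general products.\<close>

definition wedge :: "nat \<Rightarrow> (nat set \<Rightarrow> 'r::comm_ring_1) \<Rightarrow> nat set \<Rightarrow> 'r" where
  "wedge k z K = (if k \<in> K then ext_sign k K * z (K - {k}) else 0)"

definition contract :: "nat \<Rightarrow> (nat set \<Rightarrow> 'r::comm_ring_1) \<Rightarrow> nat set \<Rightarrow> 'r" where
  "contract k z K = (if k \<in> K then 0 else ext_sign k K * z (insert k K))"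

definition scal :: "'r::comm_ring_1 \<Rightarrow> (nat set \<Rightarrow> 'r) \<Rightarrow> nat set \<Rightarrow> 'r" where
  "scal p z K = p * z K"

text \<open>The multiplication of \<open>koszul_algebra\<close>, taken out of the record because it
  involves neither \<open>A\<close> nor \<open>fs\<close>.\<close>

definition kmult :: "(nat set \<Rightarrow> 'r::comm_ring_1) \<Rightarrow> (nat set \<Rightarrow> 'r) \<Rightarrow> nat set \<Rightarrow> 'r" where
  "kmult z w K = (\<Sum>I\<in>Pow K. wedge_sign I (K - I) * z I * w (K - I))"

definition ext_basis :: "nat set \<Rightarrow> nat set \<Rightarrow> 'r::comm_ring_1" where
  "ext_basis I K = (if K = I then 1 else 0)"

text \<open>The parity automorphism; it holds the Koszul sign that appears when an odd operator
  moves past a factor.\<close>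

definition invol :: "(nat set \<Rightarrow> 'r::comm_ring_1) \<Rightarrow> nat set \<Rightarrow> 'r" where
  "invol z K = (- 1) ^ card K * z K"

lemma ext_sign_sq [simp]: "ext_sign k K * ext_sign k K = 1"
  by (simp add: ext_sign_def flip: power_add mult_2)

lemma ext_sign_sq_left [simp]: "ext_sign k K * (ext_sign k K * x) = x"
  by (metis ext_sign_sq mult.assoc mult_1)

lemma ext_sign_insert_same [simp]: "ext_sign k (insert k K) = ext_sign k K"
  by (simp add: ext_sign_def) (metis order_less_irrefl insert_iff)

lemma ext_sign_remove_same [simp]: "ext_sign k (K - {k}) = ext_sign k K"
  by (metis ext_sign_insert_same insert_Diff_single)

lemma ext_sign_insert:
  assumes "l \<notin> K" "l \<noteq> k"
  shows "ext_sign k (insert l K) = (if l < k then - ext_sign k K else ext_sign k K)"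
proof -
  have "{j \<in> insert l K. j < k} = (if l < k then insert l {j \<in> K. j < k} else {j \<in> K. j < k})"
    by auto
  then show ?thesis using assms by (simp add: ext_sign_def)
qed

lemma ext_sign_remove:
  assumes "l \<in> K" "l \<noteq> k"
  shows "ext_sign k (K - {l}) = (if l < k then - ext_sign k K else ext_sign k K)"
  using ext_sign_insert[of l "K - {l}" k, where 'a='a] assms by (auto simp: insert_absorb)

lemma ext_sign_union:
  assumes "I \<inter> J = {}"
  shows "ext_sign k (I \<union> J) = ext_sign k I * ext_sign k J"
proof -
  have "{j \<in> I \<union> J. j < k} = {j \<in> I. j < k} \<union> {j \<in> J. j < k}" by auto
  moreover have "card \<dots> = card {j \<in> I. j < k} + card {j \<in> J. j < k}"
    by (rule card_Un_disjoint) (use assms in auto)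
  ultimately show ?thesis by (simp add: ext_sign_def power_add)
qed

lemma wedge_anticommute: "wedge k (wedge l z) = - wedge l (wedge k z)"
proof
  fix K
  have *: "K - {k} - {l} = K - {l} - {k}" by auto
  show "wedge k (wedge l z) K = (- wedge l (wedge k z)) K"
    by (cases k l rule: linorder_cases) (auto simp: wedge_def ext_sign_remove *)
qed

lemma contract_anticommute: "contract k (contract l z) = - contract l (contract k z)"
proof
  fix K
  have *: "insert k (insert l K) = insert l (insert k K)" by auto
  show "contract k (contract l z) K = (- contract l (contract k z)) K"
    by (cases k l rule: linorder_cases) (auto simp: contract_def ext_sign_insert *)
qed

text \<open>The Clifford relation. With the two anticommutation laws above it contains all signs
  that enter the Laplacian identity.\<close>

lemma contract_wedge: "contract k (wedge l z) = (if k = l then z else 0) - wedge l (contract k z)"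
proof
  fix K
  have *: "insert k K - {l} = insert k (K - {l})" if "k \<noteq> l" using that by auto
  show "contract k (wedge l z) K = ((if k = l then z else 0) - wedge l (contract k z)) K"
    by (cases k l rule: linorder_cases)
      (auto simp: contract_def wedge_def ext_sign_insert ext_sign_remove * insert_absorb)
qed

lemma wedge_add [simp]: "wedge k (z + w) = wedge k z + wedge k w"
  by (auto simp: wedge_def algebra_simps)

lemma contract_add [simp]: "contract k (z + w) = contract k z + contract k w"
  by (auto simp: contract_def algebra_simps)

lemma scal_add [simp]: "scal p (z + w) = scal p z + scal p w"
  by (auto simp: scal_def algebra_simps)

lemma scal_add_left: "scal (p + q) z = scal p z + scal q z"
  by (auto simp: scal_def algebra_simps)

lemma scal_scal [simp]: "scal p (scal q z) = scal (p * q) z"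
  by (auto simp: scal_def algebra_simps)

lemma scal_one [simp]: "scal 1 z = z"
  by (auto simp: scal_def)

lemma scal_zero [simp]: "scal 0 z = 0" "scal p 0 = 0"
  by (auto simp: scal_def)

lemma wedge_scal [simp]: "wedge k (scal p z) = scal p (wedge k z)"
  by (auto simp: wedge_def scal_def)

lemma contract_scal [simp]: "contract k (scal p z) = scal p (contract k z)"
  by (auto simp: contract_def scal_def)

lemma wedge_zero [simp]: "wedge k 0 = 0"
  by (auto simp: wedge_def)

lemma contract_zero [simp]: "contract k 0 = 0"
  by (auto simp: contract_def)

lemma sum_fun_apply: "(\<Sum>i\<in>A. f i) x = (\<Sum>i\<in>A. f i x)"
  by (induction A rule: infinite_finite_induct) auto

lemma additive_sum:
  fixes f :: "'a::ab_group_add \<Rightarrow> 'b::ab_group_add"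
  assumes "\<And>x y. f (x + y) = f x + f y"
  shows "f (\<Sum>i\<in>A. g i) = (\<Sum>i\<in>A. f (g i))"
proof -
  have "f 0 = 0" using assms[of 0 0] by simp
  then show ?thesis by (induction A rule: infinite_finite_induct) (auto simp: assms)
qed

lemma additive_minus:
  fixes f :: "'a::ab_group_add \<Rightarrow> 'b::ab_group_add"
  assumes "\<And>x y. f (x + y) = f x + f y"
  shows "f (- x) = - f x"
  using assms[of x "- x"] assms[of 0 0] by (simp add: eq_neg_iff_add_eq_0 add.commute)

lemma scal_minus [simp]: "scal p (- z) = - scal p z"
  by (rule additive_minus[of "scal p"]) simp

lemma wedge_sum: "wedge k (\<Sum>i\<in>A. g i) = (\<Sum>i\<in>A. wedge k (g i))"
  by (rule additive_sum[of "wedge k"]) simp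

lemma contract_sum: "contract k (\<Sum>i\<in>A. g i) = (\<Sum>i\<in>A. contract k (g i))"
  by (rule additive_sum[of "contract k"]) simp

lemma scal_sum: "scal p (\<Sum>i\<in>A. g i) = (\<Sum>i\<in>A. scal p (g i))"
  by (rule additive_sum[of "scal p"]) simp

section \<open>The product\<close>

lemma kmult_infinite: "infinite K \<Longrightarrow> kmult z w K = 0"
  by (simp add: kmult_def finite_Pow_iff)

lemma kmult_add_left: "kmult (z + z') w = kmult z w + kmult z' w"
  by (rule ext) (simp add: kmult_def algebra_simps sum.distrib)

lemma kmult_add_right: "kmult z (w + w') = kmult z w + kmult z w'"
  by (rule ext) (simp add: kmult_def algebra_simps sum.distrib)

lemma kmult_scal_left: "kmult (scal p z) w = scal p (kmult z w)"
  by (rule ext) (simp add: kmult_def scal_def sum_distrib_left mult_ac)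

lemma kmult_scal_right: "kmult z (scal p w) = scal p (kmult z w)"
  by (rule ext) (simp add: kmult_def scal_def sum_distrib_left mult_ac)

lemma invol_scal: "invol (scal p z) = scal p (invol z)"
  by (auto simp: invol_def scal_def)

lemma finite_inversions:
  "finite (I::nat set) \<Longrightarrow> finite {(i, j). i \<in> I \<and> j \<in> J \<and> j < i}"
  by (rule finite_subset[of _ "Sigma I (\<lambda>i. {..<i})"]) auto

lemma wedge_sign_empty [simp]: "wedge_sign {} J = 1" "wedge_sign I {} = 1"
  by (auto simp: wedge_sign_def)

lemma wedge_sign_insert_left:
  assumes "finite I" "k \<notin> I"
  shows "wedge_sign (insert k I) J = ext_sign k J * wedge_sign I J"
proof -
  have "{(i, j). i \<in> insert k I \<and> j \<in> J \<and> j < i} =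
    Pair k ` {j \<in> J. j < k} \<union> {(i, j). i \<in> I \<and> j \<in> J \<and> j < i}"
    by auto
  moreover have "card \<dots> = card (Pair k ` {j \<in> J. j < k}) + card {(i, j). i \<in> I \<and> j \<in> J \<and> j < i}"
    by (rule card_Un_disjoint) (use assms finite_inversions in auto)
  moreover have "card (Pair k ` {j \<in> J. j < k}) = card {j \<in> J. j < k}"
    by (rule card_image) (auto simp: inj_on_def)
  ultimately show ?thesis by (simp add: wedge_sign_def ext_sign_def power_add)
qed

text \<open>As \<open>k\<close> is not in \<open>I\<close>, its elements above and below
  \<open>k\<close> add up to \<open>card I\<close>, and a sign depends only on parity.\<close>

lemma minus_one_power_card_greater:
  assumes "finite I" "k \<notin> I"
  shows "(- 1) ^ card {i \<in> I. k < i} = (- 1) ^ card I * (ext_sign k I :: 'r::comm_ring_1)"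
proof -
  have "I = {i \<in> I. k < i} \<union> {i \<in> I. i < k}"
    using assms by (auto, metis linorder_neqE_nat)
  moreover have "card \<dots> = card {i \<in> I. k < i} + card {i \<in> I. i < k}"
    by (rule card_Un_disjoint) (use assms in auto)
  ultimately have "card I = card {i \<in> I. k < i} + card {i \<in> I. i < k}" by simp
  then have "(- 1) ^ card I * (ext_sign k I :: 'r) = (- 1) ^ card {i \<in> I. k < i} *
    (ext_sign k I * ext_sign k I)"
    by (simp only: ext_sign_def power_add mult.assoc)
  then show ?thesis by simp
qed

lemma wedge_sign_insert_right:
  assumes "finite I" "k \<notin> I" "k \<notin> J"
  shows "wedge_sign I (insert k J) = (- 1) ^ card I * ext_sign k I * wedge_sign I J"
proof -
  have "{(i, j). i \<in> I \<and> j \<in> insert k J \<and> j < i} =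
    (\<lambda>i. (i, k)) ` {i \<in> I. k < i} \<union> {(i, j). i \<in> I \<and> j \<in> J \<and> j < i}"
    by auto
  moreover have "card \<dots> = card ((\<lambda>i. (i, k)) ` {i \<in> I. k < i}) +
    card {(i, j). i \<in> I \<and> j \<in> J \<and> j < i}"
    by (rule card_Un_disjoint) (use assms finite_inversions in auto)
  moreover have "card ((\<lambda>i. (i, k)) ` {i \<in> I. k < i}) = card {i \<in> I. k < i}"
    by (rule card_image) (auto simp: inj_on_def)
  ultimately show ?thesis
    using minus_one_power_card_greater[OF assms(1,2), where 'r='a]
    by (simp add: wedge_sign_def power_add)
qed

lemma sum_Pow_insert:
  fixes f :: "'a set \<Rightarrow> 'b::comm_monoid_add"
  assumes "finite K" "k \<notin> K"
  shows "sum f (Pow (insert k K)) = (\<Sum>I\<in>Pow K. f I + f (insert k I))"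
proof -
  have "sum f (Pow (insert k K)) = sum f (Pow K) + sum f (insert k ` Pow K)"
    unfolding Pow_insert by (rule sum.union_disjoint) (use assms in auto)
  also have "sum f (insert k ` Pow K) = (\<Sum>I\<in>Pow K. f (insert k I))"
    by (rule sum.reindex[unfolded comp_def]) (use assms in \<open>auto simp: inj_on_def\<close>)
  finally show ?thesis by (simp add: sum.distrib)
qed

text \<open>The subsets of \<open>insert k K\<close> come in pairs \<open>I\<close>,
  \<open>insert k I\<close>. In this form the product can be compared term by term with operators at
  position \<open>k\<close>.\<close>

lemma kmult_insert:
  assumes "finite K" "k \<notin> K"
  shows "kmult z w (insert k K) = (\<Sum>I\<in>Pow K. wedge_sign I (K - I) *
    ((- 1) ^ card I * ext_sign k I * z I * w (insert k (K - I)) +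
     ext_sign k (K - I) * z (insert k I) * w (K - I)))"
proof -
  have "wedge_sign I (insert k K - I) * z I * w (insert k K - I) +
      wedge_sign (insert k I) (insert k K - insert k I) * z (insert k I) * w (insert k K - insert k I)
      = wedge_sign I (K - I) *
    ((- 1) ^ card I * ext_sign k I * z I * w (insert k (K - I)) +
     ext_sign k (K - I) * z (insert k I) * w (K - I))" if "I \<in> Pow K" for I
  proof -
    have I: "finite I" "k \<notin> I" "insert k K - I = insert k (K - I)" "insert k K - insert k I = K - I"
      using that assms by (auto intro: finite_subset)
    then show ?thesis using assms
      by (simp add: wedge_sign_insert_left wedge_sign_insert_right algebra_simps)
  qed
  then show ?thesis unfolding kmult_def sum_Pow_insert[OF assms] by (intro sum.cong) auto
qed

lemma ext_sign_split: "I \<subseteq> K \<Longrightarrow> ext_sign k K = ext_sign k I * ext_sign k (K - I)"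
  by (metis Diff_disjoint Un_Diff_cancel Un_absorb1 ext_sign_union)

text \<open>Contraction is an antiderivation. At a set that contains \<open>k\<close> the two terms
  on the right cancel; at any other finite set the sign of \<open>k\<close> splits over
  \<open>I\<close> and \<open>K - I\<close>.\<close>

lemma contract_kmult: "contract k (kmult z w) = kmult (contract k z) w + kmult (invol z) (contract k w)"
proof
  fix K :: "nat set"
  show "contract k (kmult z w) K = (kmult (contract k z) w + kmult (invol z) (contract k w)) K"
  proof (cases "finite K")
    case fin: True
    show ?thesis
    proof (cases "k \<in> K")
      case True
      define L where "L = K - {k}"
      have L: "finite L" "k \<notin> L" "K = insert k L" using fin True by (auto simp: L_def)
      have "kmult (contract k z) w (insert k L) + kmult (invol z) (contract k w) (insert k L) = 0"
        unfolding kmult_insert[OF L(1,2)] sum.distrib[symmetric]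
      proof (rule sum.neutral, rule ballI)
        fix I assume "I \<in> Pow L"
        then have "finite I" "k \<notin> I" "k \<notin> L - I" using L by (auto intro: finite_subset)
        then show "wedge_sign I (L - I) * ((- 1) ^ card I * ext_sign k I * contract k z I * w (insert k (L - I)) +
            ext_sign k (L - I) * contract k z (insert k I) * w (L - I)) +
          wedge_sign I (L - I) * ((- 1) ^ card I * ext_sign k I * invol z I * contract k w (insert k (L - I)) +
            ext_sign k (L - I) * invol z (insert k I) * contract k w (L - I)) = 0"
          by (simp add: contract_def invol_def algebra_simps)
      qed
      then show ?thesis using L by (simp add: contract_def)
    next
      case False
      have "contract k (kmult z w) K = ext_sign k K * kmult z w (insert k K)"
        using False by (simp add: contract_def)
      also have "\<dots> = (\<Sum>I\<in>Pow K. wedge_sign I (K - I) * contract k z I * w (K - I) +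
          wedge_sign I (K - I) * invol z I * contract k w (K - I))"
        unfolding kmult_insert[OF fin False] sum_distrib_left
      proof (rule sum.cong)
        fix I assume I: "I \<in> Pow K"
        then have *: "finite I" "k \<notin> I" "k \<notin> K - I" "ext_sign k K = ext_sign k I * (ext_sign k (K - I) :: 'a)"
          using fin False by (auto intro: finite_subset ext_sign_split)
        have **: "ext_sign k I * (ext_sign k I * (x::'a)) = x" "ext_sign k I * (y * (ext_sign k I * (x::'a))) = y * x" for x y I
          by (simp_all add: mult.left_commute)
        show "ext_sign k K * (wedge_sign I (K - I) * ((- 1) ^ card I * ext_sign k I * z I * w (insert k (K - I)) +
            ext_sign k (K - I) * z (insert k I) * w (K - I))) =
          wedge_sign I (K - I) * contract k z I * w (K - I) +
          wedge_sign I (K - I) * invol z I * contract k w (K - I)"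
          unfolding contract_def invol_def *(4) using *(2,3)
          by (simp add: algebra_simps **)
      qed simp
      finally show ?thesis by (simp add: kmult_def sum.distrib)
    qed
  qed (simp add: kmult_infinite contract_def)
qed

lemma kmult_wedge_left: "kmult (wedge k z) w = wedge k (kmult z w)"
proof
  fix K :: "nat set"
  show "kmult (wedge k z) w K = wedge k (kmult z w) K"
  proof (cases "finite K \<and> k \<in> K")
    case True
    define L where "L = K - {k}"
    have L: "finite L" "k \<notin> L" "K = insert k L" using True by (auto simp: L_def)
    have "kmult (wedge k z) w (insert k L) = (\<Sum>I\<in>Pow L. ext_sign k L * (wedge_sign I (L - I) * z I * w (L - I)))"
      unfolding kmult_insert[OF L(1,2)]
    proof (rule sum.cong)
      fix I assume "I \<in> Pow L"
      then have "k \<notin> I" "k \<notin> L - I" "ext_sign k L = ext_sign k I * (ext_sign k (L - I) :: 'a)"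
        using L by (auto intro: ext_sign_split)
      then show "wedge_sign I (L - I) * ((- 1) ^ card I * ext_sign k I * wedge k z I * w (insert k (L - I)) +
            ext_sign k (L - I) * wedge k z (insert k I) * w (L - I)) =
          ext_sign k L * (wedge_sign I (L - I) * z I * w (L - I))"
        by (simp add: wedge_def algebra_simps)
    qed simp
    then show ?thesis using L by (simp add: wedge_def kmult_def sum_distrib_left)
  next
    case False
    then show ?thesis
      by (auto simp: kmult_infinite wedge_def kmult_def intro!: sum.neutral)
  qed
qed

lemma kmult_wedge_right: "kmult z (wedge k w) = wedge k (kmult (invol z) w)"
proof
  fix K :: "nat set"
  show "kmult z (wedge k w) K = wedge k (kmult (invol z) w) K"
  proof (cases "finite K \<and> k \<in> K")
    case True
    define L where "L = K - {k}"
    have L: "finite L" "k \<notin> L" "K = insert k L" using True by (auto simp: L_def)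
    have "kmult z (wedge k w) (insert k L) = (\<Sum>I\<in>Pow L. ext_sign k L * (wedge_sign I (L - I) * invol z I * w (L - I)))"
      unfolding kmult_insert[OF L(1,2)]
    proof (rule sum.cong)
      fix I assume "I \<in> Pow L"
      then have "k \<notin> I" "k \<notin> L - I" "ext_sign k L = ext_sign k I * (ext_sign k (L - I) :: 'a)"
        using L by (auto intro: ext_sign_split)
      then show "wedge_sign I (L - I) * ((- 1) ^ card I * ext_sign k I * z I * wedge k w (insert k (L - I)) +
            ext_sign k (L - I) * z (insert k I) * wedge k w (L - I)) =
          ext_sign k L * (wedge_sign I (L - I) * invol z I * w (L - I))"
        by (simp add: wedge_def invol_def algebra_simps)
    qed simp
    then show ?thesis using L by (simp add: wedge_def kmult_def sum_distrib_left)
  next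
    case False
    then show ?thesis
      by (auto simp: kmult_infinite wedge_def kmult_def intro!: sum.neutral)
  qed
qed

lemma invol_invol [simp]: "invol (invol z) = z"
  by (rule ext) (simp add: invol_def flip: mult.assoc power_add mult_2)

lemma kmult_one_left:
  assumes "\<And>K. infinite K \<Longrightarrow> z K = 0"
  shows "kmult (ext_basis {}) z = z"
proof
  fix K :: "nat set"
  show "kmult (ext_basis {}) z K = z K"
  proof (cases "finite K")
    case True
    have "kmult (ext_basis {}) z K = (\<Sum>I\<in>Pow K. if I = {} then z K else 0)"
      unfolding kmult_def by (intro sum.cong) (auto simp: ext_basis_def)
    then show ?thesis using True by simp
  qed (simp add: kmult_infinite assms)
qed

lemma kmult_one_right:
  assumes "\<And>K. infinite K \<Longrightarrow> z K = 0"
  shows "kmult z (ext_basis {}) = z"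
proof
  fix K :: "nat set"
  show "kmult z (ext_basis {}) K = z K"
  proof (cases "finite K")
    case True
    have "kmult z (ext_basis {}) K = (\<Sum>I\<in>Pow K. if I = K then z K else 0)"
      unfolding kmult_def by (intro sum.cong) (auto simp: ext_basis_def)
    then show ?thesis using True by simp
  qed (simp add: kmult_infinite assms)
qed

lemma kmult_ext_basis:
  assumes "finite I" "finite J" "I \<inter> J = {}"
  shows "kmult (ext_basis I) (ext_basis J) = scal (wedge_sign I J) (ext_basis (I \<union> J))"
proof
  fix K :: "nat set"
  show "kmult (ext_basis I) (ext_basis J) K = scal (wedge_sign I J) (ext_basis (I \<union> J)) K"
  proof (cases "finite K")
    case True
    have "kmult (ext_basis I) (ext_basis J) K = (\<Sum>L\<in>Pow K. if L = I then
        (wedge_sign I J * (if K = I \<union> J then 1 else 0)) else 0)"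
      unfolding kmult_def using assms by (intro sum.cong) (auto simp: ext_basis_def)
    also have "\<dots> = wedge_sign I J * (if K = I \<union> J then 1 else 0)" using True by auto
    finally show ?thesis by (simp add: scal_def ext_basis_def)
  qed (use assms in \<open>auto simp: kmult_infinite scal_def ext_basis_def\<close>)
qed

lemma wedge_ext_basis:
  "k \<notin> I \<Longrightarrow> wedge k (ext_basis I) = scal (ext_sign k I) (ext_basis (insert k I))"
  by (auto simp: wedge_def scal_def ext_basis_def)

section \<open>Elements over finitely many exterior generators, and induction on them\<close>

definition ext_supported :: "nat \<Rightarrow> (nat set \<Rightarrow> 'r::comm_ring_1) \<Rightarrow> bool" where
  "ext_supported N z \<longleftrightarrow> (\<forall>I. \<not> I \<subseteq> {..<N} \<longrightarrow> z I = 0)"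

text \<open>As simp rules, these rewrite the eta-expanded terms that the induction rules below produce.\<close>

declare plus_fun_apply [simp del] zero_fun_apply [simp del] uminus_apply [simp del] minus_apply [simp del]

lemmas fun_apply = plus_fun_apply zero_fun_apply uminus_apply minus_apply sum_fun_apply

lemma ext_supported_infinite: "ext_supported N z \<Longrightarrow> infinite K \<Longrightarrow> z K = 0"
  unfolding ext_supported_def using finite_subset by blast

lemma ext_supported_expand:
  assumes "ext_supported N z"
  shows "z = (\<Sum>I\<in>Pow {..<N}. scal (z I) (ext_basis I))"
proof
  fix K
  have "(\<Sum>I\<in>Pow {..<N}. scal (z I) (ext_basis I)) K = (\<Sum>I\<in>Pow {..<N}. if I = K then z K else 0)"
    unfolding sum_fun_apply by (intro sum.cong) (auto simp: scal_def ext_basis_def)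
  then show "z K = (\<Sum>I\<in>Pow {..<N}. scal (z I) (ext_basis I)) K"
    using assms by (auto simp: ext_supported_def)
qed

text \<open>Over the coefficient ring the exterior algebra is spanned by iterated wedges applied to
  1. Associativity, multiplicativity and compatibility with differentials thus reduce to one
  \<open>wedge\<close> step.\<close>

lemma ext_supported_induct [consumes 1, case_names one wedge add scal]:
  assumes "ext_supported N z"
    and one: "P (ext_basis {})"
    and wedge: "\<And>k z. k < N \<Longrightarrow> P z \<Longrightarrow> P (wedge k z)"
    and add: "\<And>z w. P z \<Longrightarrow> P w \<Longrightarrow> P (z + w)"
    and scal: "\<And>p z. P z \<Longrightarrow> P (scal p z)"
  shows "P z"
proof -
  have basis: "P (ext_basis I)" if "finite I" "I \<subseteq> {..<N}" for I
    using that
  proof (induction I rule: finite_induct)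
    case (insert k I)
    have "scal (ext_sign k I) (wedge k (ext_basis I)) = (ext_basis (insert k I) :: nat set \<Rightarrow> 'a)"
      using insert by (simp add: wedge_ext_basis)
    then show ?case using insert by (metis wedge scal insert_subset lessThan_iff)
  qed (rule one)
  have "P (\<Sum>I\<in>A. scal (z I) (ext_basis I))" if "finite A" "A \<subseteq> Pow {..<N}" for A
    using that
  proof (induction A rule: finite_induct)
    case empty
    show ?case using scal[OF one, of 0] by simp
  next
    case (insert I A)
    then show ?case by (auto intro!: add scal basis intro: finite_subset)
  qed
  then show ?thesis by (subst ext_supported_expand[OF assms(1)]) simp
qed

lemma kmult_assoc:
  assumes "ext_supported N u"
  shows "kmult (kmult u v) w = kmult u (kmult v w)"
  using assms
proof (induction u rule: ext_supported_induct)
  case one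
  have "kmult (kmult (ext_basis {}) v) w K = kmult v w K" for K
  proof -
    \<comment> \<open>Here \<open>v\<close> may be nonzero at infinite sets, where products vanish;
      so the unit law is used at finite sets only.\<close>
    have "kmult (ext_basis {}) v I = v I" if "finite I" for I
    proof -
      have "kmult (ext_basis {}) v I = (\<Sum>J\<in>Pow I. if J = {} then v I else 0)"
        unfolding kmult_def by (intro sum.cong) (auto simp: ext_basis_def)
      then show ?thesis using that by simp
    qed
    then have "kmult (ext_basis {}) v I = v I" if "finite K" "I \<subseteq> K" for I
      using that finite_subset by blast
    then show ?thesis
      unfolding kmult_def[of _ w]
      by (cases "finite K") (auto simp: finite_Pow_iff intro!: sum.cong)
  qed
  then show ?case by (subst kmult_one_left) (auto simp: kmult_infinite)
qed (simp_all add: kmult_wedge_left kmult_add_left kmult_scal_left)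

section \<open>A Laplacian identity\<close>

lemma sum_if_const:
  "(\<Sum>l\<in>A. if P then f l else 0) = (if P then (\<Sum>l\<in>A. f l) else (0::'a::comm_monoid_add))"
  by simp

text \<open>One rule for each pattern of Kronecker deltas that normal ordering produces in
  \<open>koszul_dual_term\<close>.\<close>

lemma sum4_delta:
  fixes f :: "nat \<Rightarrow> nat \<Rightarrow> nat \<Rightarrow> nat \<Rightarrow> 'a::comm_monoid_add"
  shows "(\<Sum>i<n. \<Sum>j<n. \<Sum>k<n. \<Sum>l<n. if k = i then if l = j then f i j k l else 0 else 0) =
      (\<Sum>i<n. \<Sum>j<n. f i j i j)"
    and "(\<Sum>i<n. \<Sum>j<n. \<Sum>k<n. \<Sum>l<n. if l = i then if k = j then f i j k l else 0 else 0) =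
      (\<Sum>i<n. \<Sum>j<n. f i j j i)"
    and "(\<Sum>i<n. \<Sum>j<n. \<Sum>k<n. \<Sum>l<n. if l = j then if k = i then f i j k l else 0 else 0) =
      (\<Sum>i<n. \<Sum>j<n. f i j i j)"
    and "(\<Sum>i<n. \<Sum>j<n. \<Sum>k<n. \<Sum>l<n. if l = i then f i j k l else 0) =
      (\<Sum>i<n. \<Sum>j<n. \<Sum>k<n. f i j k i)"
    and "(\<Sum>i<n. \<Sum>j<n. \<Sum>k<n. \<Sum>l<n. if l = j then f i j k l else 0) =
      (\<Sum>i<n. \<Sum>j<n. \<Sum>k<n. f i j k j)"
    and "(\<Sum>i<n. \<Sum>j<n. \<Sum>k<n. \<Sum>l<n. if k = i then f i j k l else 0) =
      (\<Sum>i<n. \<Sum>j<n. \<Sum>l<n. f i j i l)"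
    and "(\<Sum>i<n. \<Sum>j<n. \<Sum>k<n. \<Sum>l<n. if k = j then f i j k l else 0) =
      (\<Sum>i<n. \<Sum>j<n. \<Sum>l<n. f i j j l)"
  by (auto simp: sum.delta sum_if_const intro!: sum.cong)

text \<open>
  \<open>e i j\<close> stands for multiplication by the exterior generator of \<open>x\<^sub>i x\<^sub>j\<close>, and \<open>c i j\<close> for the
  contraction against it when \<open>i \<noteq> j\<close>, but for twice that contraction when \<open>i = j\<close>. With this
  normalisation the relation \<open>c_e\<close> is uniform and \<open>koszul2\<close> below is twice the Koszul differential.
\<close>

locale weyl_clifford =
  fixes n :: nat
    and x D :: "nat \<Rightarrow> 'a::{ring, monoid_mult}"
    and e c :: "nat \<Rightarrow> nat \<Rightarrow> 'a"
  assumes x_comm: "x i * x j = x j * x i"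
    and D_comm: "D i * D j = D j * D i"
    and D_x: "D i * x j = x j * D i + (if i = j then 1 else 0)"
    and e_anti: "e i j * e k l = - (e k l * e i j)"
    and c_anti: "c i j * c k l = - (c k l * c i j)"
    and c_e: "c i j * e k l =
      (if i = k \<and> j = l then 1 else 0) + (if i = l \<and> j = k then 1 else 0) - e k l * c i j"
    and e_sym: "e i j = e j i"
    and c_sym: "c i j = c j i"
    and x_e: "e i j * x k = x k * e i j"
    and x_c: "c i j * x k = x k * c i j"
    and D_e: "e i j * D k = D k * e i j"
    and D_c: "c i j * D k = D k * c i j"
begin

definition gl :: "nat \<Rightarrow> nat \<Rightarrow> 'a" where
  "gl i j = x i * D j + (\<Sum>k<n. e i k * c j k)"

definition koszul2 :: 'a where
  "koszul2 = (\<Sum>i<n. \<Sum>j<n. x i * x j * c i j)"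

definition dual_koszul2 :: 'a where
  "dual_koszul2 = (\<Sum>k<n. \<Sum>l<n. e k l * (D k * D l))"

text \<open>The mixed term of the normal form: a vector field times a wedge and a
  contraction.\<close>

definition cross :: 'a where
  "cross = (\<Sum>i<n. \<Sum>j<n. \<Sum>k<n. x i * D j * (e j k * c i k))"

lemma D_x_left: "D i * (x j * a) = x j * (D i * a) + (if i = j then a else 0)"
  by (simp add: D_x distrib_right flip: mult.assoc)

lemma D_D_x_x:
  "D k * D l * (x i * x j) = x i * x j * (D k * D l) + ((if l = i then x j * D k else 0)
    + (if l = j then x i * D k else 0) + (if k = i then x j * D l else 0) + (if k = j then x i * D l else 0)
    + (if l = i then if k = j then 1 else 0 else 0) + (if l = j then if k = i then 1 else 0 else 0))"
  by (simp add: D_x_left D_x distrib_left distrib_right mult.assoc)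

lemma c_x_left: "c i j * (x k * a) = x k * (c i j * a)"
  by (metis x_c mult.assoc)

lemma c_D_left: "c i j * (D k * a) = D k * (c i j * a)"
  by (metis D_c mult.assoc)

lemma e_x_left: "e i j * (x k * a) = x k * (e i j * a)"
  by (metis x_e mult.assoc)

lemma e_D_left: "e i j * (D k * a) = D k * (e i j * a)"
  by (metis D_e mult.assoc)

lemma x_comm_left: "x i * (x j * a) = x j * (x i * a)"
  by (metis x_comm mult.assoc)

text \<open>Normal ordering. Moving \<open>c\<close> past \<open>e\<close> leaves two delta terms,
  moving both derivatives past \<open>x i * x j\<close> leaves six, and the fully ordered terms
  cancel because of the minus sign in \<open>c_e\<close>.\<close>

lemma koszul_dual_term:
  "x i * x j * c i j * (e k l * (D k * D l)) + e k l * (D k * D l) * (x i * x j * c i j) =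
   (if k = i then if l = j then x i * x j * (D k * D l) else 0 else 0) +
   (if l = i then if k = j then x i * x j * (D k * D l) else 0 else 0) +
   (if l = i then x j * D k * (e k l * c i j) else 0) +
   (if l = j then x i * D k * (e k l * c i j) else 0) +
   (if k = i then x j * D l * (e k l * c i j) else 0) +
   (if k = j then x i * D l * (e k l * c i j) else 0) +
   (if l = i then if k = j then e k l * c i j else 0 else 0) +
   (if l = j then if k = i then e k l * c i j else 0 else 0)"
proof -
  have 1: "x i * x j * c i j * (e k l * (D k * D l)) = x i * x j * (c i j * e k l) * (D k * D l)"
    by (simp add: mult.assoc)
  have 2: "e k l * (D k * D l) * (x i * x j * c i j) = e k l * (D k * D l * (x i * x j)) * c i j"
    by (simp add: mult.assoc)
  have 3: "x i * x j * (c i j * e k l) * (D k * D l) =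
    (if k = i then if l = j then x i * x j * (D k * D l) else 0 else 0) +
    (if l = i then if k = j then x i * x j * (D k * D l) else 0 else 0) -
    x i * x j * (D k * D l) * (e k l * c i j)"
    by (auto simp: c_e distrib_left distrib_right left_diff_distrib right_diff_distrib mult.assoc
        c_D_left D_c e_D_left D_e)
  have 4: "e k l * (x i * x j * (D k * D l)) * c i j = x i * x j * (D k * D l) * (e k l * c i j)"
    by (simp add: mult.assoc e_x_left e_D_left)
  have 5: "e k l * (if P then a else 0) * b = (if P then e k l * a * b else 0)" for P a b
    by simp
  show ?thesis
    unfolding 1 2 3 D_D_x_x distrib_left distrib_right 4 5
    by (simp add: mult.assoc e_x_left e_D_left)
qed

lemma sum_rot: "(\<Sum>i<n. \<Sum>j<n. \<Sum>k<n. f i j k) = (\<Sum>k<n. \<Sum>i<n. \<Sum>j<n. (f i j k :: 'a))"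
proof -
  have "(\<Sum>i<n. \<Sum>j<n. \<Sum>k<n. f i j k) = (\<Sum>i<n. \<Sum>k<n. \<Sum>j<n. f i j k)"
    by (intro sum.cong refl sum.swap)
  also have "\<dots> = (\<Sum>k<n. \<Sum>i<n. \<Sum>j<n. f i j k)"
    by (rule sum.swap)
  finally show ?thesis .
qed

lemma koszul_dual:
  "koszul2 * dual_koszul2 + dual_koszul2 * koszul2 =
   (\<Sum>i<n. \<Sum>j<n. x i * x j * (D i * D j)) + (\<Sum>i<n. \<Sum>j<n. x i * x j * (D i * D j)) +
   (cross + cross + cross + cross) +
   ((\<Sum>i<n. \<Sum>j<n. e i j * c i j) + (\<Sum>i<n. \<Sum>j<n. e i j * c i j))"
proof -
  have A: "koszul2 * dual_koszul2 =
    (\<Sum>i<n. \<Sum>j<n. \<Sum>k<n. \<Sum>l<n. x i * x j * c i j * (e k l * (D k * D l)))"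
    unfolding koszul2_def dual_koszul2_def by (simp only: sum_distrib_right, simp only: sum_distrib_left)
  have "dual_koszul2 * koszul2 =
    (\<Sum>k<n. \<Sum>l<n. \<Sum>i<n. \<Sum>j<n. e k l * (D k * D l) * (x i * x j * c i j))"
    unfolding koszul2_def dual_koszul2_def by (simp only: sum_distrib_right, simp only: sum_distrib_left)
  also have "\<dots> = (\<Sum>k<n. \<Sum>i<n. \<Sum>j<n. \<Sum>l<n. e k l * (D k * D l) * (x i * x j * c i j))"
    by (intro sum.cong refl sum_rot[symmetric])
  also have "\<dots> = (\<Sum>i<n. \<Sum>j<n. \<Sum>k<n. \<Sum>l<n. e k l * (D k * D l) * (x i * x j * c i j))"
    by (rule sum_rot[symmetric])
  finally have B: "dual_koszul2 * koszul2 = \<dots>" .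
  \<comment> \<open>The four first-order sums all equal \<open>cross\<close>, by renaming indices
    and the symmetry of \<open>e\<close> and \<open>c\<close>.\<close>
  have c1: "(\<Sum>i<n. \<Sum>j<n. \<Sum>k<n. x j * D k * (e k i * c i j)) = cross"
    unfolding cross_def sum_rot[of "\<lambda>i j k. x i * D j * (e j k * c i k)"]
    by (intro sum.cong refl) (simp only: c_sym)
  have c2: "(\<Sum>i<n. \<Sum>j<n. \<Sum>k<n. x i * D k * (e k j * c i j)) = cross"
    unfolding cross_def by (intro sum.cong refl sum.swap)
  have c3: "(\<Sum>i<n. \<Sum>j<n. \<Sum>k<n. x j * D k * (e i k * c i j)) = cross"
    unfolding c1[symmetric] by (intro sum.cong refl) (simp only: e_sym)
  have c4: "(\<Sum>i<n. \<Sum>j<n. \<Sum>k<n. x i * D k * (e j k * c i j)) = cross"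
    unfolding c2[symmetric] by (intro sum.cong refl) (simp only: e_sym)
  have c5: "(\<Sum>i<n. \<Sum>j<n. e j i * c i j) = (\<Sum>i<n. \<Sum>j<n. e i j * c i j)"
    "(\<Sum>i<n. \<Sum>j<n. x i * x j * (D j * D i)) = (\<Sum>i<n. \<Sum>j<n. x i * x j * (D i * D j))"
    by (intro sum.cong refl, simp only: e_sym, intro sum.cong refl, simp only: D_comm)
  have "koszul2 * dual_koszul2 + dual_koszul2 * koszul2 =
    (\<Sum>i<n. \<Sum>j<n. \<Sum>k<n. \<Sum>l<n. x i * x j * c i j * (e k l * (D k * D l)) +
      e k l * (D k * D l) * (x i * x j * c i j))"
    unfolding A B by (simp only: sum.distrib)
  also have "\<dots> = (\<Sum>i<n. \<Sum>j<n. x i * x j * (D i * D j)) + (\<Sum>i<n. \<Sum>j<n. x i * x j * (D j * D i)) +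
     cross + cross + cross + cross +
    (\<Sum>i<n. \<Sum>j<n. e j i * c i j) + (\<Sum>i<n. \<Sum>j<n. e i j * c i j)"
    unfolding koszul_dual_term
    by (simp only: sum.distrib sum4_delta c1 c2 c3 c4)
  finally show ?thesis unfolding c5 by (simp only: add.assoc)
qed

text \<open>
  Renaming indices with the symmetry of \<open>e\<close> and \<open>c\<close> turns the quartic term into its negative. Only
  its double is shown to vanish, because the ring may have 2-torsion.
\<close>

lemma quartic:
  fixes Q
  defines "Q \<equiv> (\<Sum>i<n. \<Sum>j<n. \<Sum>k<n. \<Sum>l<n. e i k * (e j l * (c j k * c i l)))"
  shows "Q + Q = 0"
proof -
  have s: "(\<Sum>i<n. \<Sum>j<n. \<Sum>k<n. f i j k) = (\<Sum>k<n. \<Sum>j<n. \<Sum>i<n. (f i j k :: 'a))" for f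
    by (subst sum_rot) (intro sum.cong refl sum.swap)
  have "Q = (\<Sum>k<n. \<Sum>j<n. \<Sum>i<n. \<Sum>l<n. e i k * (e j l * (c j k * c i l)))"
    unfolding Q_def by (rule s)
  also have "\<dots> = (\<Sum>i<n. \<Sum>j<n. \<Sum>k<n. \<Sum>l<n. e i k * (e j l * (c i j * c k l)))"
    by (intro sum.cong refl) (simp only: e_sym c_sym)
  finally have 1: "Q = \<dots>" .
  note 1
  also have "(\<Sum>i<n. \<Sum>j<n. \<Sum>k<n. \<Sum>l<n. e i k * (e j l * (c i j * c k l))) =
      (\<Sum>j<n. \<Sum>i<n. \<Sum>l<n. \<Sum>k<n. e i k * (e j l * (c i j * c k l)))"
    by (subst sum.swap) (intro sum.cong refl sum.swap)
  also have "\<dots> = (\<Sum>i<n. \<Sum>j<n. \<Sum>k<n. \<Sum>l<n. - (e i k * (e j l * (c i j * c k l))))"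
  proof (intro sum.cong refl)
    fix i j k l
    have "e j l * (e i k * (c j i * c l k)) = e j l * e i k * (c i j * c k l)"
      by (simp add: mult.assoc c_sym)
    also have "\<dots> = - (e i k * (e j l * (c i j * c k l)))"
      by (subst e_anti) (simp add: mult.assoc)
    finally show "e j l * (e i k * (c j i * c l k)) = - (e i k * (e j l * (c i j * c k l)))" .
  qed
  also have "\<dots> = - Q" by (simp only: 1 sum_negf)
  finally have "Q = - Q" .
  then show ?thesis by (metis add.right_inverse)
qed

text \<open>One exchange, of \<open>c j k\<close> with \<open>e j l\<close>, brings the product into
  normal order; its two deltas yield the two quadratic terms.\<close>

lemma quadratic_product:
  assumes "i < n" "j < n"
  shows "(\<Sum>k<n. e i k * c j k) * (\<Sum>l<n. e j l * c i l) =
    (\<Sum>k<n. e i k * c i k) + e i j * c i j - (\<Sum>k<n. \<Sum>l<n. e i k * (e j l * (c j k * c i l)))"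
proof -
  have "(\<Sum>k<n. e i k * c j k) * (\<Sum>l<n. e j l * c i l) =
    (\<Sum>k<n. \<Sum>l<n. e i k * (c j k * e j l) * c i l)"
    by (simp add: sum_distrib_left sum_distrib_right mult.assoc) (rule sum.swap)
  also have "\<dots> = (\<Sum>k<n. \<Sum>l<n. (if l = k then e i k * c i l else 0) +
    (if k = j then if l = j then e i k * c i l else 0 else 0) - e i k * (e j l * (c j k * c i l)))"
    by (intro sum.cong refl)
      (auto simp: c_e distrib_left distrib_right left_diff_distrib right_diff_distrib mult.assoc)
  also have "\<dots> = (\<Sum>k<n. e i k * c i k) + e i j * c i j -
      (\<Sum>k<n. \<Sum>l<n. e i k * (e j l * (c j k * c i l)))"
    using assms by (simp add: sum.distrib sum_subtractf sum_if_const)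
  finally show ?thesis .
qed

text \<open>Reordering produces \<open>n\<close> copies of the Euler operator of the variables and
  \<open>n\<close> copies of the sum of all \<open>e i k * c i k\<close>; this is exactly
  \<open>n\<close> times the trace, which is subtracted.\<close>

lemma casimir:
  "(\<Sum>i<n. \<Sum>j<n. gl i j * gl j i) - (\<Sum>j<n. \<Sum>i<n. gl i i) =
   (\<Sum>i<n. \<Sum>j<n. x i * x j * (D i * D j)) + (cross + cross) + (\<Sum>i<n. \<Sum>j<n. e i j * c i j) -
   (\<Sum>i<n. \<Sum>j<n. \<Sum>k<n. \<Sum>l<n. e i k * (e j l * (c j k * c i l)))"
proof -
  have t: "gl i j * gl j i = x i * x j * (D i * D j) + x i * D i +
     (\<Sum>k<n. x i * D j * (e j k * c i k)) + (\<Sum>k<n. x j * D i * (e i k * c j k)) +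
     ((\<Sum>k<n. e i k * c i k) + e i j * c i j - (\<Sum>k<n. \<Sum>l<n. e i k * (e j l * (c j k * c i l))))"
    if "i < n" "j < n" for i j
  proof -
    have a: "x i * D j * (x j * D i) = x i * x j * (D i * D j) + x i * D i"
      by (simp add: mult.assoc D_x_left D_comm distrib_left)
    have b: "x i * D j * (\<Sum>k<n. e j k * c i k) = (\<Sum>k<n. x i * D j * (e j k * c i k))"
      by (simp only: sum_distrib_left)
    have c: "(\<Sum>k<n. e i k * c j k) * (x j * D i) = (\<Sum>k<n. x j * D i * (e i k * c j k))"
      by (simp add: sum_distrib_right mult.assoc c_x_left D_c e_x_left e_D_left)
    show ?thesis
      unfolding gl_def distrib_left distrib_right a b c quadratic_product[OF that] by (simp only: add.assoc add.left_commute)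
  qed
  have "(\<Sum>i<n. \<Sum>j<n. \<Sum>k<n. x j * D i * (e i k * c j k)) = cross"
    unfolding cross_def by (rule sum.swap)
  moreover have "(\<Sum>i<n. \<Sum>j<n. gl i j * gl j i) = (\<Sum>i<n. \<Sum>j<n. x i * x j * (D i * D j) + x i * D i +
     (\<Sum>k<n. x i * D j * (e j k * c i k)) + (\<Sum>k<n. x j * D i * (e i k * c j k)) +
     ((\<Sum>k<n. e i k * c i k) + e i j * c i j - (\<Sum>k<n. \<Sum>l<n. e i k * (e j l * (c j k * c i l)))))"
    by (intro sum.cong refl t) auto
  moreover have "(\<Sum>j<n. \<Sum>i<n. gl i i) = (\<Sum>i<n. \<Sum>j<n. x i * D i) + (\<Sum>i<n. \<Sum>j<n. \<Sum>k<n. e i k * c i k)"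
    unfolding gl_def sum.distrib[symmetric] by (rule sum.swap)
  ultimately show ?thesis
    by (simp add: sum.distrib sum_subtractf cross_def)
qed

text \<open>The left side is twice the normal form in \<open>casimir\<close> without its quartic
  term, and the double of that term vanishes. In the overview's notation \<open>koszul2\<close> is
  2d and \<open>dual_koszul2\<close> is 2s. The sum over the idle index \<open>j\<close> is the
  factor n.\<close>

theorem laplacian:
  defines "T \<equiv> (\<Sum>i<n. \<Sum>j<n. gl i j * gl j i) - (\<Sum>j<n. \<Sum>i<n. gl i i)"
  shows "koszul2 * dual_koszul2 + dual_koszul2 * koszul2 = T + T"
  unfolding T_def casimir koszul_dual using quartic
  by (simp add: algebra_simps)

lemma gl_commutator:
  assumes "i < n" "j < n"
  shows "gl i j * gl j i = gl j i * gl i j + gl i i - gl j j"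
proof -
  have Fx: "(\<Sum>k<n. e i k * c j k) * (x a * D b) = x a * D b * (\<Sum>k<n. e i k * c j k)" for i j a b
    by (simp add: sum_distrib_left sum_distrib_right mult.assoc c_x_left D_c e_x_left e_D_left)
  note FF = quadratic_product[OF assms] quadratic_product[OF assms(2,1)]
  have q: "(\<Sum>k<n. \<Sum>l<n. e j k * (e i l * (c i k * c j l))) = (\<Sum>k<n. \<Sum>l<n. e i k * (e j l * (c j k * c i l)))"
  proof (subst sum.swap, intro sum.cong refl)
    fix k l
    have "e j l * (e i k * (c i l * c j k)) = (e j l * e i k) * (c i l * c j k)"
      by (simp add: mult.assoc)
    also have "\<dots> = (e i k * e j l) * (c j k * c i l)"
      by (subst e_anti, subst c_anti) simp
    finally show "e j l * (e i k * (c i l * c j k)) = e i k * (e j l * (c j k * c i l))"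
      by (simp add: mult.assoc)
  qed
  have xx: "x a * D b * (x b * D a) = x a * x b * (D a * D b) + x a * D a" for a b
    by (simp add: mult.assoc D_x_left D_comm distrib_left)
  have e: "e j i * c j i = e i j * c i j"
    by (simp add: e_sym c_sym)
  show ?thesis
    unfolding gl_def distrib_left distrib_right Fx FF q xx e
    by (simp add: algebra_simps x_comm D_comm)
qed

text \<open>The vector field and the exterior part of \<open>gl i j\<close> both fail to commute
  with the differential, by the same two sums with opposite signs.\<close>

lemma gl_koszul2:
  assumes "i < n" "j < n"
  shows "gl i j * koszul2 = koszul2 * gl i j"
proof -
  have s: "(\<Sum>k<n. x i * x k * c k j) = (\<Sum>k<n. x i * x k * c j k)"
    "(\<Sum>k<n. x k * x i * c j k) = (\<Sum>k<n. x i * x k * c j k)"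
    by (simp_all add: c_sym x_comm)
  have "x i * D j * koszul2 = (\<Sum>k<n. \<Sum>l<n. x k * x l * c k l * (x i * D j) +
    (if k = j then x i * x l * c k l else 0) + (if l = j then x i * x k * c k l else 0))"
    unfolding koszul2_def sum_distrib_left
    by (intro sum.cong refl)
      (simp add: mult.assoc D_x_left c_x_left D_c[symmetric] distrib_left x_comm_left)
  then have 1: "x i * D j * koszul2 = koszul2 * (x i * D j) + ((\<Sum>l<n. x i * x l * c j l) + (\<Sum>k<n. x i * x k * c j k))"
    using assms s
    by (simp add: sum.distrib sum_if_const koszul2_def sum_distrib_right)
  have *: "(\<Sum>m<n. e i m * c j m) * koszul2 = (\<Sum>m<n. \<Sum>k<n. \<Sum>l<n. x k * x l * c k l * (e i m * c j m) -
    (if l = m then if k = i then x k * x l * c j m else 0 else 0) -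
    (if k = m then if l = i then x k * x l * c j m else 0 else 0))"
  proof -
    have "e i m * c j m * (x k * x l * c k l) = x k * x l * c k l * (e i m * c j m) -
      (if l = m then if k = i then x k * x l * c j m else 0 else 0) -
      (if k = m then if l = i then x k * x l * c j m else 0 else 0)" for m k l
    proof -
      have "e i m * c j m * (x k * x l * c k l) = x k * x l * (e i m * (c j m * c k l))"
        by (simp add: mult.assoc c_x_left e_x_left)
      also have "\<dots> = - (x k * x l * (e i m * c k l) * c j m)"
        by (subst c_anti) (simp add: mult.assoc)
      also have "e i m * c k l = (if k = i \<and> l = m then 1 else 0) + (if k = m \<and> l = i then 1 else 0) - c k l * e i m"
        by (simp add: c_e)
      also have "- (x k * x l * ((if k = i \<and> l = m then 1 else 0) + (if k = m \<and> l = i then 1 else 0) - c k l * e i m) * c j m) =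
        x k * x l * c k l * (e i m * c j m) -
      (if l = m then if k = i then x k * x l * c j m else 0 else 0) -
      (if k = m then if l = i then x k * x l * c j m else 0 else 0)"
        by (simp add: distrib_left distrib_right left_diff_distrib right_diff_distrib mult.assoc)
      finally show ?thesis .
    qed
    moreover have "(\<Sum>m<n. e i m * c j m) * koszul2 =
        (\<Sum>m<n. \<Sum>k<n. \<Sum>l<n. e i m * c j m * (x k * x l * c k l))"
      unfolding koszul2_def by (simp only: sum_distrib_right, simp only: sum_distrib_left)
    ultimately show ?thesis by simp
  qed
  have 2: "(\<Sum>m<n. e i m * c j m) * koszul2 = koszul2 * (\<Sum>m<n. e i m * c j m) -
      (\<Sum>l<n. x i * x l * c j l) - (\<Sum>k<n. x i * x k * c j k)"
  proof -
    have "koszul2 * (\<Sum>m<n. e i m * c j m) =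
        (\<Sum>m<n. \<Sum>k<n. \<Sum>l<n. x k * x l * c k l * (e i m * c j m))"
      unfolding koszul2_def by (simp only: sum_distrib_left, simp only: sum_distrib_right)
    moreover have "(\<Sum>m<n. \<Sum>k<n. \<Sum>l<n. if l = m then if k = i then x k * x l * c j m else 0 else 0) =
        (\<Sum>l<n. x i * x l * c j l)"
      using assms by (simp add: sum_if_const)
    moreover have "(\<Sum>m<n. \<Sum>k<n. \<Sum>l<n. if k = m then if l = i then x k * x l * c j m else 0 else 0) =
        (\<Sum>k<n. x i * x k * c j k)"
      using assms s by (simp add: sum_if_const)
    ultimately show ?thesis
      using * by (simp only: sum_subtractf)
  qed
  show ?thesis
    unfolding gl_def distrib_left distrib_right 1 2 by (simp add: algebra_simps)
qed

end

section \<open>The ring of additive endomorphisms\<close>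

text \<open>Makes the operators on chains elements of a ring, so that the identities of
  \<open>weyl_clifford\<close> can be instantiated with them.\<close>

typedef (overloaded) 'a endo = "{f :: 'a::ab_group_add \<Rightarrow> 'a. \<forall>x y. f (x + y) = f x + f y}"
  morphisms app Endo
  by (rule exI[of _ "\<lambda>x. x"]) simp

lemma app_Endo: "(\<And>x y. f (x + y) = f x + f y) \<Longrightarrow> app (Endo f) = f"
  by (rule Endo_inverse) auto

lemma app_add [simp]: "app f (x + y) = app f x + app f y"
  using app[of f] by blast

lemma endo_eqI: "(\<And>x. app f x = app g x) \<Longrightarrow> f = g"
  by (metis app_inject ext)

instantiation endo :: (ab_group_add) ring
begin

definition "0 = Endo (\<lambda>x. 0)"
definition "f + g = Endo (\<lambda>x. app f x + app g x)"
definition "- f = Endo (\<lambda>x. - app f x)"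
definition "f - g = Endo (\<lambda>x. app f x - app g x)"
definition "f * g = Endo (\<lambda>x. app f (app g x))"

lemma app_simps [simp]:
  "app 0 x = 0" "app (f + g) x = app f x + app g x" "app (- f) x = - app f x"
  "app (f - g) x = app f x - app g x" "app (f * g) x = app f (app g x)"
  unfolding zero_endo_def plus_endo_def uminus_endo_def minus_endo_def times_endo_def
  by (subst app_Endo; simp add: algebra_simps)+

instance
  by standard (auto intro!: endo_eqI simp: algebra_simps)

end

text \<open>For the trivial group 0 = 1, so \<open>ring_1\<close> is out of reach; this is why
  \<open>weyl_clifford\<close> is stated over \<open>ring\<close> and
  \<open>monoid_mult\<close>.\<close>

instantiation endo :: (ab_group_add) monoid_mult
begin

definition "1 = Endo (\<lambda>x. x)"

lemma app_one [simp]: "app 1 x = x"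
  unfolding one_endo_def by (subst app_Endo) auto

instance
  by standard (auto intro!: endo_eqI)

end

lemma app_sum [simp]: "app (\<Sum>i\<in>A. f i) x = (\<Sum>i\<in>A. app (f i) x)"
  by (induction A rule: infinite_finite_induct) auto

section \<open>Linear operators on polynomials\<close>

abbreviation monomial :: "(nat \<Rightarrow>\<^sub>0 nat) \<Rightarrow> 'k::field mpoly" where
  "monomial m \<equiv> Poly_Mapping.single m 1"

abbreviation unit_exp :: "nat \<Rightarrow> nat \<Rightarrow>\<^sub>0 nat" where
  "unit_exp i \<equiv> Poly_Mapping.single i (Suc 0)"

definition plin :: "((nat \<Rightarrow>\<^sub>0 nat) \<Rightarrow> 'k::field mpoly) \<Rightarrow> 'k mpoly \<Rightarrow> 'k mpoly" where
  "plin f p = (\<Sum>m\<in>Poly_Mapping.keys p. const_poly (Poly_Mapping.lookup p m) * f m)"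

lemma const_poly_simps [simp]:
  "const_poly 0 = 0" "const_poly 1 = 1" "const_poly (a + b) = const_poly a + const_poly b"
  "const_poly a * const_poly b = const_poly (a * b)"
  by (simp_all add: const_poly_def single_add mult_single)

lemma const_poly_single [simp]:
  "const_poly c * Poly_Mapping.single m v = Poly_Mapping.single m (c * v)"
  by (simp add: const_poly_def mult_single)

lemma plin_superset:
  assumes "finite S" "Poly_Mapping.keys p \<subseteq> S"
  shows "plin f p = (\<Sum>m\<in>S. const_poly (Poly_Mapping.lookup p m) * f m)"
  unfolding plin_def using assms
  by (intro sum.mono_neutral_left) (auto simp: in_keys_iff)

lemma plin_add [simp]: "plin f (p + q) = plin f p + plin f q"
proof -
  let ?S = "Poly_Mapping.keys p \<union> Poly_Mapping.keys q"
  have "plin f (p + q) = (\<Sum>m\<in>?S. const_poly (Poly_Mapping.lookup (p + q) m) * f m)"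
    by (rule plin_superset) (auto simp: Poly_Mapping.keys_add[THEN subsetD] dest: Poly_Mapping.keys_add[THEN subsetD])
  moreover have "plin f p = (\<Sum>m\<in>?S. const_poly (Poly_Mapping.lookup p m) * f m)"
    "plin f q = (\<Sum>m\<in>?S. const_poly (Poly_Mapping.lookup q m) * f m)"
    by (rule plin_superset; auto)+
  ultimately show ?thesis
    by (simp add: lookup_add distrib_right sum.distrib)
qed

lemma plin_single [simp]: "plin f (Poly_Mapping.single m v) = const_poly v * f m"
  by (cases "v = 0") (auto simp: plin_def)

lemma poly_expand: "p = (\<Sum>m\<in>Poly_Mapping.keys p. Poly_Mapping.single m (Poly_Mapping.lookup p m))"
  by (rule poly_mapping_eqI) (auto simp: lookup_sum lookup_single when_def in_keys_iff)

text \<open>Every polynomial is a sum of terms; as terms are tested with arbitrary coefficients,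
  additivity can replace linearity.\<close>

lemma additive_eqI:
  fixes F G :: "'k::field mpoly \<Rightarrow> 'b::ab_group_add"
  assumes F: "\<And>p q. F (p + q) = F p + F q" and G: "\<And>p q. G (p + q) = G p + G q"
    and "\<And>m v. F (Poly_Mapping.single m v) = G (Poly_Mapping.single m v)"
  shows "F p = G p"
  by (subst (1 2) poly_expand) (simp add: additive_sum[of F, OF F] additive_sum[of G, OF G] assms(3))

section \<open>Partial derivatives and operators that act on coefficients\<close>

definition pderiv :: "nat \<Rightarrow> 'k::field mpoly \<Rightarrow> 'k mpoly" where
  "pderiv i = plin (\<lambda>m. Poly_Mapping.single (m - unit_exp i) (of_nat (Poly_Mapping.lookup m i)))"

lemma pderiv_add [simp]: "pderiv i (p + q) = pderiv i p + pderiv i q"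
  by (simp add: pderiv_def)

lemma pderiv_single: "pderiv i (Poly_Mapping.single m v) =
    Poly_Mapping.single (m - unit_exp i) (v * of_nat (Poly_Mapping.lookup m i))"
  by (simp add: pderiv_def)

text \<open>Subtraction of exponent vectors is truncated. It is exact here because \<open>a\<close>
  is concentrated at \<open>i\<close> and bounded by \<open>m\<close> there.\<close>

lemma exp_add_minus:
  fixes m :: "nat \<Rightarrow>\<^sub>0 nat"
  assumes "Poly_Mapping.lookup a i \<le> Poly_Mapping.lookup m i" "\<And>j. j \<noteq> i \<Longrightarrow> Poly_Mapping.lookup a j = 0"
  shows "m + b - a = m - a + b" "b + m - a = b + (m - a)" "m - a + a = m" "a + (m - a) = m"
proof -
  have "Poly_Mapping.lookup a j \<le> Poly_Mapping.lookup m j" for j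
    using assms by (cases "j = i") auto
  then show "m + b - a = m - a + b" "b + m - a = b + (m - a)" "m - a + a = m" "a + (m - a) = m"
    by (auto intro!: poly_mapping_eqI simp: lookup_add lookup_minus)
qed

lemma pderiv_single_mult:
  "pderiv i (Poly_Mapping.single m v * Poly_Mapping.single m' v') =
   pderiv i (Poly_Mapping.single m v) * Poly_Mapping.single m' v' +
   Poly_Mapping.single m v * pderiv i (Poly_Mapping.single m' v')" (is "?l = ?r + ?s")
proof -
  have r: "?r = Poly_Mapping.single (m + m' - unit_exp i) (v * v' * of_nat (Poly_Mapping.lookup m i))"
  proof (cases "Poly_Mapping.lookup m i = 0")
    case False
    then have "m + m' - unit_exp i = m - unit_exp i + m'"
      by (intro exp_add_minus[of _ i]) (auto simp: lookup_single)
    then show ?thesis by (simp only: pderiv_single mult_single) (simp add: mult_ac)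
  qed (simp add: pderiv_single)
  have s: "?s = Poly_Mapping.single (m + m' - unit_exp i) (v * v' * of_nat (Poly_Mapping.lookup m' i))"
  proof (cases "Poly_Mapping.lookup m' i = 0")
    case False
    then have "m + m' - unit_exp i = m + (m' - unit_exp i)"
      by (intro exp_add_minus[of _ i]) (auto simp: lookup_single)
    then show ?thesis by (simp add: pderiv_single mult_single mult_ac)
  qed (simp add: pderiv_single)
  show ?thesis unfolding r s
    by (simp add: mult_single pderiv_single lookup_add single_add[symmetric] distrib_left)
qed

lemma pderiv_mult: "pderiv i (p * q) = pderiv i p * q + p * pderiv i q"
proof -
  have 1: "pderiv i (Poly_Mapping.single m v * q) =
    pderiv i (Poly_Mapping.single m v) * q + Poly_Mapping.single m v * pderiv i q" for m v
    by (rule additive_eqI[of "\<lambda>q. pderiv i (Poly_Mapping.single m v * q)"])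
      (simp_all add: distrib_left pderiv_single_mult)
  show ?thesis
    by (rule additive_eqI[of "\<lambda>p. pderiv i (p * q)"])
      (simp_all add: distrib_right 1)
qed

lemma pderiv_comm: "pderiv i (pderiv j p) = pderiv j (pderiv i p)"
proof (rule additive_eqI[of "\<lambda>p. pderiv i (pderiv j p)"])
  fix m :: "nat \<Rightarrow>\<^sub>0 nat" and v :: 'a
  have "m - unit_exp j - unit_exp i = m - unit_exp i - unit_exp j"
    by (rule poly_mapping_eqI) (simp add: lookup_minus)
  then show "pderiv i (pderiv j (Poly_Mapping.single m v)) = pderiv j (pderiv i (Poly_Mapping.single m v))"
    by (cases "i = j") (auto simp: pderiv_single lookup_minus lookup_single mult_ac)
qed simp_all

lemma pderiv_var_mult:
  "pderiv i (monomial (unit_exp j) * p) = monomial (unit_exp j) * pderiv i p + (if i = j then p else 0)"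
  by (simp add: pderiv_mult pderiv_single lookup_single)

definition ptw :: "('r \<Rightarrow> 'r) \<Rightarrow> (nat set \<Rightarrow> 'r) \<Rightarrow> nat set \<Rightarrow> 'r" where
  "ptw F z K = F (z K)"

lemma sign_cases:
  obtains "ext_sign k K = (1 :: 'a::comm_ring_1)" | "ext_sign k K = (- 1 :: 'a)"
  by (metis ext_sign_def minus_one_power_iff)

lemma additive_ext_sign:
  fixes F :: "'r::comm_ring_1 \<Rightarrow> 'r"
  assumes "\<And>p q. F (p + q) = F p + F q"
  shows "F (ext_sign k K * p) = ext_sign k K * F p"
  by (cases rule: sign_cases[of k K, where 'a='r])
    (auto simp: additive_minus[of F, OF assms])

lemma additive_wedge_sign:
  fixes F :: "'r::comm_ring_1 \<Rightarrow> 'r"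
  assumes "\<And>p q. F (p + q) = F p + F q"
  shows "F (wedge_sign I J * p) = wedge_sign I J * F p"
  using minus_one_power_iff[of "card {(i, j). i \<in> I \<and> j \<in> J \<and> j < i}", where 'a='r]
  by (auto simp: wedge_sign_def additive_minus[of F, OF assms] split: if_splits)

lemma ptw_add: "(\<And>p q. F (p + q) = F p + F q) \<Longrightarrow> ptw F (z + w) = ptw F z + ptw F w"
  by (auto simp: ptw_def fun_apply)

lemma ptw_wedge:
  fixes F :: "'r::comm_ring_1 \<Rightarrow> 'r"
  assumes "\<And>p q. F (p + q) = F p + F q"
  shows "ptw F (wedge k z) = wedge k (ptw F z)"
  using assms[of 0 0] by (auto simp: ptw_def wedge_def additive_ext_sign[of F, OF assms])

lemma ptw_contract:
  fixes F :: "'r::comm_ring_1 \<Rightarrow> 'r"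
  assumes "\<And>p q. F (p + q) = F p + F q"
  shows "ptw F (contract k z) = contract k (ptw F z)"
  using assms[of 0 0] by (auto simp: ptw_def contract_def additive_ext_sign[of F, OF assms])

abbreviation kderiv :: "nat \<Rightarrow> (nat set \<Rightarrow> 'k::field mpoly) \<Rightarrow> nat set \<Rightarrow> 'k mpoly" where
  "kderiv i \<equiv> ptw (pderiv i)"

lemma kderiv_add [simp]: "kderiv i (z + w) = kderiv i z + kderiv i w"
  by (rule ptw_add) simp

lemma kderiv_kmult: "kderiv i (kmult z w) = kmult (kderiv i z) w + kmult z (kderiv i w)"
proof -
  have "pderiv i (wedge_sign I J * a * b) =
    wedge_sign I J * pderiv i a * b + wedge_sign I J * a * pderiv i b" for I J and a b :: "'a mpoly"
    using additive_wedge_sign[of "pderiv i" I J "a * b"]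
    by (simp only: mult.assoc pderiv_mult pderiv_add distrib_left)
  then show ?thesis
    by (auto simp: ptw_def kmult_def fun_apply additive_sum[of "pderiv i"] simp flip: sum.distrib)
qed

section \<open>Quadratic monomials\<close>

text \<open>
  The position of \<open>x\<^sub>i x\<^sub>j\<close> in the list of quadratic monomials: the monomials in the first \<open>n\<close>
  variables are those at the positions below \<open>triangle n\<close>.
\<close>

definition qidx :: "nat \<Rightarrow> nat \<Rightarrow> nat" where
  "qidx i j = triangle (max i j) + min i j"

lemma qidx_sym: "qidx i j = qidx j i"
  by (simp add: qidx_def max.commute min.commute)

lemma triangle_mono: "m \<le> n \<Longrightarrow> triangle m \<le> triangle n"
  by (induction n) (auto simp: le_Suc_eq)

lemma qidx_less: "qidx i j < triangle n \<longleftrightarrow> i < n \<and> j < n"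
proof
  assume "qidx i j < triangle n"
  then show "i < n \<and> j < n"
    using triangle_mono[of n "max i j"] by (cases "n \<le> max i j") (auto simp: qidx_def)
next
  assume "i < n \<and> j < n"
  then show "qidx i j < triangle n"
    using triangle_mono[of "Suc (max i j)" n] by (simp add: qidx_def) linarith
qed

lemma qidx_max: "triangle m \<le> qidx i j \<Longrightarrow> qidx i j < triangle (Suc m) \<Longrightarrow> m = max i j"
  using qidx_less[of i j m] qidx_less[of i j "Suc m"] by auto

lemma qidx_eq: "qidx i j = qidx k l \<longleftrightarrow> i = k \<and> j = l \<or> i = l \<and> j = k"
proof
  assume *: "qidx i j = qidx k l"
  have "max k l = max i j"
    using qidx_max[of "max k l" i j] * by (auto simp: qidx_def)
  moreover from this have "min i j = min k l" using * by (simp add: qidx_def)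
  ultimately show "i = k \<and> j = l \<or> i = l \<and> j = k" by (auto simp: max_def min_def split: if_splits)
qed (auto simp: qidx_sym)

lemma qidx_exists: "q < triangle n \<Longrightarrow> \<exists>i j. i < n \<and> j < n \<and> q = qidx i j"
proof (induction n)
  case (Suc n)
  show ?case
  proof (cases "q < triangle n")
    case False
    then have "q = qidx (q - triangle n) n" "q - triangle n \<le> n"
      using Suc.prems by (auto simp: qidx_def max_def min_def)
    then show ?thesis by (metis lessI less_Suc_eq_le)
  qed (use Suc in \<open>meson less_SucI\<close>)
qed simp

lemma qidx_surj: "\<exists>i j. q = qidx i j"
proof -
  have "q \<le> triangle q" by (induction q) auto
  then have "q < triangle (Suc q)" by simp
  then show ?thesis using qidx_exists by blast
qed

definition qexp :: "nat \<Rightarrow> nat \<Rightarrow>\<^sub>0 nat" where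
  "qexp q = (THE m. \<exists>i j. q = qidx i j \<and> m = unit_exp i + unit_exp j)"

lemma qexp_qidx [simp]: "qexp (qidx i j) = unit_exp i + unit_exp j"
  unfolding qexp_def by (rule the_equality) (auto simp: qidx_eq add.commute)

lemma sum_lessThan_plus: "(\<Sum>k<m + r. g k) = (\<Sum>k<m. g k) + (\<Sum>k<r. g (m + k :: nat) :: 'a::comm_monoid_add)"
  by (induction r) (auto simp: add.assoc)

text \<open>A position off the diagonal comes from two ordered pairs, a diagonal one from a single
  pair; doubling on the diagonal evens this out, which is the purpose of \<open>contract2\<close>
  below.\<close>

lemma sum_qidx:
  fixes G :: "nat \<Rightarrow> 'a::comm_monoid_add"
  shows "(\<Sum>i<n. \<Sum>j<n. if i = j then G (qidx i j) + G (qidx i j) else G (qidx i j)) =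
    (\<Sum>q<triangle n. G q + G q)"
proof (induction n)
  case (Suc n)
  let ?g = "\<lambda>i j. if i = j then G (qidx i j) + G (qidx i j) else G (qidx i j)"
  have a: "(\<Sum>i<n. ?g i n) = (\<Sum>a<n. G (triangle n + a))" "(\<Sum>j<n. ?g n j) = (\<Sum>a<n. G (triangle n + a))"
    by (intro sum.cong refl; auto simp: qidx_def max_def min_def)+
  have b: "?g n n = G (triangle n + n) + G (triangle n + n)"
    by (simp add: qidx_def)
  have t: "triangle (Suc n) = triangle n + Suc n" by simp
  have "(\<Sum>i<Suc n. \<Sum>j<Suc n. ?g i j) = (\<Sum>i<n. \<Sum>j<n. ?g i j) + (\<Sum>i<n. ?g i n) + ((\<Sum>j<n. ?g n j) + ?g n n)"
    by (simp add: sum.distrib add_ac)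
  also have "\<dots> = (\<Sum>q<triangle (Suc n). G q + G q)"
    unfolding Suc a b t sum_lessThan_plus by (simp add: sum.distrib add_ac)
  finally show ?case .
qed simp

definition quads :: "nat \<Rightarrow> 'k::field mpoly list" where
  "quads n = map (\<lambda>q. monomial (qexp q)) [0..<triangle n]"

lemma length_quads [simp]: "length (quads n) = triangle n"
  by (simp add: quads_def)

lemma koszul_diff_sum: "koszul_diff fs z = (\<Sum>k<length fs. scal (fs ! k) (contract k z))"
proof
  fix K
  have "(\<Sum>k<length fs. scal (fs ! k) (contract k z)) K =
    (\<Sum>k<length fs. fs ! k * contract k z K)"
    by (simp add: fun_apply scal_def)
  also have "\<dots> = (\<Sum>k\<in>{..<length fs} - K. fs ! k * contract k z K)"
    by (rule sum.mono_neutral_right) (auto simp: contract_def)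
  also have "\<dots> = koszul_diff fs z K"
    unfolding koszul_diff_def by (rule sum.cong) (auto simp: contract_def ext_sign_def mult_ac)
  finally show "koszul_diff fs z K = (\<Sum>k<length fs. scal (fs ! k) (contract k z)) K" by simp
qed

lemma koszul_diff_quads:
  "koszul_diff (quads n) z = (\<Sum>q<triangle n. scal (monomial (qexp q)) (contract q z))"
  unfolding koszul_diff_sum by (simp add: quads_def)

section \<open>The action of the general linear Lie algebra\<close>

definition op_x :: "nat \<Rightarrow> (nat set \<Rightarrow> 'k::field mpoly) endo" where
  "op_x i = Endo (scal (monomial (unit_exp i)))"

definition op_D :: "nat \<Rightarrow> (nat set \<Rightarrow> 'k::field mpoly) endo" where
  "op_D i = Endo (kderiv i)"

definition op_e :: "nat \<Rightarrow> nat \<Rightarrow> (nat set \<Rightarrow> 'k::field mpoly) endo" where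
  "op_e i j = Endo (wedge (qidx i j))"

definition contract2 :: "nat \<Rightarrow> nat \<Rightarrow> (nat set \<Rightarrow> 'k::field mpoly) \<Rightarrow> nat set \<Rightarrow> 'k mpoly" where
  "contract2 i j z = (if i = j then contract (qidx i j) z + contract (qidx i j) z else contract (qidx i j) z)"

definition op_c :: "nat \<Rightarrow> nat \<Rightarrow> (nat set \<Rightarrow> 'k::field mpoly) endo" where
  "op_c i j = Endo (contract2 i j)"

lemma app_op [simp]:
  "app (op_x i) z = scal (monomial (unit_exp i)) z"
  "app (op_D i) z = kderiv i z"
  "app (op_e i j) z = wedge (qidx i j) z"
  "app (op_c i j) z = contract2 i j z"
  unfolding op_x_def op_D_def op_e_def op_c_def
  by (subst app_Endo; simp add: contract2_def)+

lemma kderiv_scal_var: "kderiv i (scal (monomial (unit_exp j)) z) =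
   scal (monomial (unit_exp j)) (kderiv i z) + (if i = j then z else 0)"
  by (rule ext) (simp add: ptw_def scal_def fun_apply pderiv_var_mult)

lemma contract2_anticommute: "contract2 i j (contract2 k l z) = - contract2 k l (contract2 i j z)"
proof -
  have c: "contract2 a b z = scal (if a = b then 1 + 1 else 1) (contract (qidx a b) z)" for a b and z :: "nat set \<Rightarrow> 'a mpoly"
    by (cases "a = b") (simp_all only: contract2_def if_True if_False scal_add_left scal_one simp_thms)
  show ?thesis
    unfolding c contract_scal scal_scal by (subst contract_anticommute) (simp only: scal_minus mult.commute)
qed

lemma wedge_double [simp]: "wedge k (2 * z) = 2 * wedge k z"
  by (simp only: mult_2 wedge_add)

lemma scal_double [simp]: "scal p (2 * z) = 2 * scal p z"
  by (simp only: mult_2 scal_add)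

lemma op_c_e: "op_c i j * op_e k l = (if i = k \<and> j = l then 1 else 0) +
    (if i = l \<and> j = k then 1 else 0) - op_e k l * op_c i j"
proof (rule endo_eqI)
  fix z :: "nat set \<Rightarrow> 'a mpoly"
  have cw: "contract (qidx i j) (wedge (qidx k l) z) =
    (if i = k \<and> j = l \<or> i = l \<and> j = k then z else 0) - wedge (qidx k l) (contract (qidx i j) z)"
    by (simp only: contract_wedge qidx_eq)
  show "app (op_c i j * op_e k l) z = app ((if i = k \<and> j = l then 1 else 0) +
    (if i = l \<and> j = k then 1 else 0) - op_e k l * op_c i j) z"
  proof (cases "i = j")
    case True
    then show ?thesis using cw by (cases "k = j"; cases "l = j") (simp_all add: contract2_def)
  next
    case False
    then show ?thesis using cw by (cases "i = k"; cases "j = l"; cases "i = l"; cases "j = k") (simp_all add: contract2_def)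
  qed
qed

lemma op_e_e: "op_e i j * op_e k l = - (op_e k l * op_e i j)"
  by (rule endo_eqI) (simp, rule wedge_anticommute)

lemma op_c_c: "op_c i j * op_c k l = - (op_c k l * op_c i j)"
  by (rule endo_eqI) (simp, rule contract2_anticommute)

lemma op_x_x: "op_x i * op_x j = op_x j * op_x i"
  by (rule endo_eqI) (simp add: mult.commute)

lemma op_D_D: "op_D i * op_D j = op_D j * op_D i"
  by (rule endo_eqI, rule ext) (simp add: ptw_def pderiv_comm[of i j])

lemma op_D_x: "op_D i * op_x j = op_x j * op_D i + (if i = j then 1 else 0)"
  by (rule endo_eqI) (simp add: kderiv_scal_var)

lemma op_e_sym: "op_e i j = op_e j i"
  by (simp add: op_e_def qidx_sym[of i j])

lemma op_c_sym: "op_c i j = op_c j i"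
  by (rule endo_eqI) (simp add: contract2_def qidx_sym[of i j])

lemma op_e_x: "op_e i j * op_x k = op_x k * op_e i j"
  by (rule endo_eqI) simp

lemma op_c_x: "op_c i j * op_x k = op_x k * op_c i j"
  by (rule endo_eqI, cases "i = j")
    (simp_all only: app_simps app_op contract2_def if_True if_False scal_add contract_scal simp_thms)

lemma op_e_D: "op_e i j * op_D k = op_D k * op_e i j"
  by (rule endo_eqI) (simp add: ptw_wedge)

lemma op_c_D: "op_c i j * op_D k = op_D k * op_c i j"
  by (rule endo_eqI, cases "i = j")
    (simp_all only: app_simps app_op contract2_def if_True if_False kderiv_add simp_thms
      ptw_contract[of "pderiv k", OF pderiv_add])

interpretation weyl: weyl_clifford n op_x op_D op_e op_c for n
  by unfold_locales (rule op_x_x op_D_D op_D_x op_e_e op_c_c op_c_e op_e_sym op_c_sym op_e_x op_c_x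
    op_e_D op_c_D)+

text \<open>The operator E_ij, which replaces x_j by x_i in coefficients and generators. The
  doubling in \<open>contract2\<close> at \<open>k = j\<close> reflects that x_j^2 is sent to 2 x_i
  x_j.\<close>

definition glop :: "nat \<Rightarrow> nat \<Rightarrow> nat \<Rightarrow> (nat set \<Rightarrow> 'k::field mpoly) \<Rightarrow> nat set \<Rightarrow> 'k mpoly" where
  "glop n i j z = scal (monomial (unit_exp i)) (kderiv j z) +
     (\<Sum>k<n. wedge (qidx i k) (contract2 j k z))"

text \<open>Twice the operator s of the overview, since the sum runs over ordered pairs.\<close>

definition dual_diff :: "nat \<Rightarrow> (nat set \<Rightarrow> 'k::field mpoly) \<Rightarrow> nat set \<Rightarrow> 'k mpoly" where
  "dual_diff n z = (\<Sum>k<n. \<Sum>l<n. wedge (qidx k l) (kderiv k (kderiv l z)))"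

lemma app_gl [simp]: "app (weyl.gl n i j) z = glop n i j z"
  by (simp add: weyl.gl_def glop_def)

lemma app_dual_koszul2 [simp]: "app (weyl.dual_koszul2 n) z = dual_diff n z"
  by (simp add: weyl.dual_koszul2_def dual_diff_def)

lemma app_koszul2 [simp]:
  "app (weyl.koszul2 n) z = koszul_diff (quads n) z + koszul_diff (quads n) z"
proof -
  have "app (weyl.koszul2 n) z = (\<Sum>i<n. \<Sum>j<n. scal (monomial (unit_exp i + unit_exp j)) (contract2 i j z))"
    by (simp add: weyl.koszul2_def mult_single)
  also have "\<dots> = (\<Sum>i<n. \<Sum>j<n. if i = j
      then scal (monomial (qexp (qidx i j))) (contract (qidx i j) z) + scal (monomial (qexp (qidx i j))) (contract (qidx i j) z)
      else scal (monomial (qexp (qidx i j))) (contract (qidx i j) z))"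
    by (intro sum.cong refl) (auto simp: contract2_def)
  also have "\<dots> = koszul_diff (quads n) z + koszul_diff (quads n) z"
    using sum_qidx[where n = n and G = "\<lambda>q. scal (monomial (qexp q)) (contract q z)"]
    by (simp only: koszul_diff_quads sum.distrib)
  finally show ?thesis .
qed

lemma double_cancel:
  fixes z w :: "nat set \<Rightarrow> 'k::field_char_0 mpoly"
  assumes "z + z = w + w"
  shows "z = w"
proof
  fix K
  have "2 * z K = 2 * w K"
    using fun_cong[OF assms, of K] by (simp add: fun_apply)
  then show "z K = w K" by simp
qed

lemma glop_add [simp]: "glop n i j (z + w) = glop n i j z + glop n i j w"
  using app_add[of "weyl.gl n i j" z w] by (simp only: app_gl)

lemma koszul_diff_add [simp]: "koszul_diff fs (z + w) = koszul_diff fs z + koszul_diff fs w"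
  by (simp add: koszul_diff_sum sum.distrib)

lemma koszul_diff_glop:
  fixes z :: "nat set \<Rightarrow> 'k::field_char_0 mpoly"
  assumes "i < n" "j < n"
  shows "koszul_diff (quads n) (glop n i j z) = glop n i j (koszul_diff (quads n) z)"
  using arg_cong[OF weyl.gl_koszul2[OF assms], of "\<lambda>f. app f z"]
  by - (rule double_cancel, simp only: app_simps app_gl app_koszul2 glop_add)

text \<open>On a cycle the summand sd vanishes. The ring identity is about 2d and 2s, so one factor
  2 is cancelled and the other stays in \<open>dual_diff\<close>.\<close>

lemma laplacian_cycle:
  fixes z :: "nat set \<Rightarrow> 'k::field_char_0 mpoly"
  assumes "koszul_diff (quads n) z = 0"
  shows "koszul_diff (quads n) (dual_diff n z) =
    (\<Sum>i<n. \<Sum>j<n. glop n i j (glop n j i z)) - (\<Sum>j<n. \<Sum>i<n. glop n i i z)"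
proof -
  have "dual_diff n (0 :: nat set \<Rightarrow> 'k mpoly) = 0"
    using app_add[of "weyl.dual_koszul2 n :: (nat set \<Rightarrow> 'k mpoly) endo" 0 0]
    by (simp only: app_dual_koszul2 add_0_left add_cancel_right_right)
  then show ?thesis
    using arg_cong[OF weyl.laplacian[of n], of "\<lambda>f. app f z"] assms
    by - (rule double_cancel,
      simp only: app_simps app_gl app_koszul2 app_dual_koszul2 app_sum add_0_left add_0_right)
qed

lemma glop_commutator:
  assumes "i < n" "j < n"
  shows "glop n i j (glop n j i z) = glop n j i (glop n i j z) + glop n i i z - glop n j j z"
  using arg_cong[OF weyl.gl_commutator[OF assms], of "\<lambda>f. app f z"]
  by (simp only: app_simps app_gl)

text \<open>A product of two odd operators is even: the involutions from both Leibniz rules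
  cancel.\<close>

lemma wedge_contract_kmult:
  "wedge a (contract b (kmult z w)) = kmult (wedge a (contract b z)) w + kmult z (wedge a (contract b w))"
  by (simp add: contract_kmult kmult_wedge_left kmult_wedge_right)

lemma kmult_sum_left: "kmult (\<Sum>i\<in>A. f i) w = (\<Sum>i\<in>A. kmult (f i) w)"
  by (rule additive_sum[of "\<lambda>z. kmult z w"]) (rule kmult_add_left)

lemma kmult_sum_right: "kmult w (\<Sum>i\<in>A. f i) = (\<Sum>i\<in>A. kmult w (f i))"
  by (rule additive_sum[of "kmult w"]) (rule kmult_add_right)

lemma glop_kmult: "glop n i j (kmult z w) = kmult (glop n i j z) w + kmult z (glop n i j w)"
proof -
  have "wedge (qidx i k) (contract2 j k (kmult z w)) =
    kmult (wedge (qidx i k) (contract2 j k z)) w + kmult z (wedge (qidx i k) (contract2 j k w))" for k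
    by (cases "j = k") (simp_all only: contract2_def wedge_contract_kmult kmult_add_left kmult_add_right
        wedge_add if_True if_False simp_thms add_ac)
  then show ?thesis
    unfolding glop_def kderiv_kmult
    by (simp add: kmult_add_left kmult_add_right kmult_scal_left kmult_scal_right kmult_sum_left
        kmult_sum_right sum.distrib)
qed

lemma koszul_diff_kmult:
  "koszul_diff fs (kmult z w) = kmult (koszul_diff fs z) w + kmult (invol z) (koszul_diff fs w)"
  unfolding koszul_diff_sum contract_kmult
  by (simp add: sum.distrib kmult_sum_left kmult_sum_right kmult_scal_left kmult_scal_right)

section \<open>Supports\<close>

text \<open>Degree, parity, multidegree and activity are all conditions on single terms x^m e_K. In
  this form each operator needs just one transfer rule.\<close>

definition ksupp :: "(nat set \<Rightarrow> (nat \<Rightarrow>\<^sub>0 nat) \<Rightarrow> bool) \<Rightarrow> (nat set \<Rightarrow> 'k::field mpoly) set" where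
  "ksupp G = {z. \<forall>K. \<forall>m\<in>Poly_Mapping.keys (z K). G K m}"

lemma ksuppD: "z \<in> ksupp G \<Longrightarrow> m \<in> Poly_Mapping.keys (z K) \<Longrightarrow> G K m"
  by (auto simp: ksupp_def)

lemma ksupp_mono: "z \<in> ksupp G \<Longrightarrow> (\<And>K m. G K m \<Longrightarrow> G' K m) \<Longrightarrow> z \<in> ksupp G'"
  by (auto simp: ksupp_def)

lemma ksupp_zero [simp]: "0 \<in> ksupp G"
  by (simp add: ksupp_def fun_apply)

lemma ksupp_add: "z \<in> ksupp G \<Longrightarrow> w \<in> ksupp G \<Longrightarrow> z + w \<in> ksupp G"
  unfolding ksupp_def using Poly_Mapping.keys_add by (fastforce simp: fun_apply)

lemma ksupp_uminus: "z \<in> ksupp G \<Longrightarrow> - z \<in> ksupp G"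
  by (simp add: ksupp_def fun_apply)

lemma ksupp_diff: "z \<in> ksupp G \<Longrightarrow> w \<in> ksupp G \<Longrightarrow> z - w \<in> ksupp G"
  using ksupp_add[of z G "- w"] by (simp add: ksupp_uminus)

lemma ksupp_sum: "(\<And>i. i \<in> A \<Longrightarrow> f i \<in> ksupp G) \<Longrightarrow> (\<Sum>i\<in>A. f i) \<in> ksupp G"
  by (induction A rule: infinite_finite_induct) (auto intro: ksupp_add)

lemma keys_sign [simp]:
  "Poly_Mapping.keys (ext_sign k K * p) = Poly_Mapping.keys (p :: 'k::field mpoly)"
  by (cases rule: sign_cases[of k K, where 'a="'k mpoly"]) auto

lemma ksupp_scal:
  assumes "z \<in> ksupp G" "\<And>K m a. a \<in> Poly_Mapping.keys p \<Longrightarrow> G K m \<Longrightarrow> G' K (a + m)"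
  shows "scal p z \<in> ksupp G'"
  using assms Poly_Mapping.keys_mult[of p] unfolding ksupp_def scal_def by blast

lemma ksupp_wedge:
  assumes "z \<in> ksupp G" "\<And>K m. k \<notin> K \<Longrightarrow> G K m \<Longrightarrow> G' (insert k K) m"
  shows "wedge k z \<in> ksupp G'"
proof -
  have "G' K m" if "k \<in> K" "m \<in> Poly_Mapping.keys (z (K - {k}))" for K m
    using assms(2)[of "K - {k}" m] ksuppD[OF assms(1) that(2)] that(1) by (simp add: insert_absorb)
  then show ?thesis by (auto simp: ksupp_def wedge_def)
qed

lemma ksupp_contract:
  assumes "z \<in> ksupp G" "\<And>K m. k \<notin> K \<Longrightarrow> G (insert k K) m \<Longrightarrow> G' K m"
  shows "contract k z \<in> ksupp G'"
  using assms by (auto simp: ksupp_def contract_def)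

lemma plin_zero [simp]: "plin f 0 = 0"
  by (simp add: plin_def)

lemma keys_sum_subset:
  fixes g :: "'b \<Rightarrow> 'k::field mpoly"
  shows "Poly_Mapping.keys (sum g A) \<subseteq> (\<Union>a\<in>A. Poly_Mapping.keys (g a))"
proof (induction A rule: infinite_finite_induct)
  case (insert a A)
  then show ?case
    using Poly_Mapping.keys_add[of "g a" "sum g A"] by auto
qed auto

lemma keys_plin: "Poly_Mapping.keys (plin f p) \<subseteq> (\<Union>m\<in>Poly_Mapping.keys p. Poly_Mapping.keys (f m))"
proof -
  have "Poly_Mapping.keys (const_poly c * q) \<subseteq> Poly_Mapping.keys q" for c and q :: "'a mpoly"
    using Poly_Mapping.keys_mult[of "const_poly c" q] by (auto simp: const_poly_def split: if_splits)
  then show ?thesis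
    unfolding plin_def
    by (intro order_trans[OF keys_sum_subset] UN_mono order_refl)
qed

lemma ksupp_kderiv:
  assumes "z \<in> ksupp G" "\<And>K m. G K (m + unit_exp i) \<Longrightarrow> G' K m"
  shows "kderiv i z \<in> ksupp G'"
proof -
  have "G' K m" if "m \<in> Poly_Mapping.keys (pderiv i (z K))" for K m
  proof -
    have "m \<in> (\<Union>m\<in>Poly_Mapping.keys (z K). Poly_Mapping.keys
        (Poly_Mapping.single (m - unit_exp i) (of_nat (Poly_Mapping.lookup m i) :: 'a)))"
      using that keys_plin unfolding pderiv_def by (rule subsetD[rotated])
    then obtain m' where m': "m' \<in> Poly_Mapping.keys (z K)" "m = m' - unit_exp i" "Poly_Mapping.lookup m' i \<noteq> 0"
      by (force split: if_splits)
    then have "m' = m + unit_exp i"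
      by (subst exp_add_minus(3)[of _ i, symmetric]) (auto simp: lookup_single)
    then show ?thesis using m'(1) assms by (auto dest: ksuppD)
  qed
  then show ?thesis by (auto simp: ksupp_def ptw_def)
qed

lemma ksupp_kmult:
  assumes "z \<in> ksupp G" "w \<in> ksupp G'"
    "\<And>K L m m'. finite K \<Longrightarrow> finite L \<Longrightarrow> K \<inter> L = {} \<Longrightarrow> G K m \<Longrightarrow> G' L m' \<Longrightarrow> G'' (K \<union> L) (m + m')"
  shows "kmult z w \<in> ksupp G''"
proof -
  have sgn: "Poly_Mapping.keys (wedge_sign I J * p) = Poly_Mapping.keys p" for I J and p :: "'a mpoly"
    using minus_one_power_iff[of "card {(i, j). i \<in> I \<and> j \<in> J \<and> j < i}", where 'a="'a mpoly"]
    by (auto simp: wedge_sign_def split: if_splits)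
  have "G'' K m" if fin: "finite K" and m: "m \<in> Poly_Mapping.keys (kmult z w K)" for K m
  proof -
    obtain I where I: "I \<subseteq> K" "m \<in> Poly_Mapping.keys (wedge_sign I (K - I) * (z I * w (K - I)))"
      using m keys_sum_subset unfolding kmult_def mult.assoc by blast
    then obtain a b where ab: "m = a + b" "a \<in> Poly_Mapping.keys (z I)" "b \<in> Poly_Mapping.keys (w (K - I))"
      unfolding sgn using Poly_Mapping.keys_mult by blast
    then have "G'' (I \<union> (K - I)) m"
      unfolding ab(1) using fin I(1)
      by (intro assms(3) ksuppD[OF assms(1) ab(2)] ksuppD[OF assms(2) ab(3)]) (auto intro: finite_subset)
    then show ?thesis using I(1) by (simp add: Un_absorb1)
  qed
  moreover have "finite K" if "m \<in> Poly_Mapping.keys (kmult z w K)" for K m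
    using that kmult_infinite[of K z w] by (cases "finite K") auto
  ultimately show ?thesis by (auto simp: ksupp_def)
qed

lemma ksupp_invol: "z \<in> ksupp G \<Longrightarrow> invol z \<in> ksupp G"
proof -
  have "Poly_Mapping.keys ((- 1) ^ c * p) = Poly_Mapping.keys p" for c and p :: "'a mpoly"
    by (auto simp: minus_one_power_iff)
  then show "z \<in> ksupp G \<Longrightarrow> invol z \<in> ksupp G" by (simp add: ksupp_def invol_def)
qed

lemma ksupp_contract2:
  assumes "z \<in> ksupp G" "\<And>K m. qidx i j \<notin> K \<Longrightarrow> G (insert (qidx i j) K) m \<Longrightarrow> G' K m"
  shows "contract2 i j z \<in> ksupp G'"
proof -
  have c: "contract (qidx i j) z \<in> ksupp G'"
    by (rule ksupp_contract[OF assms(1)]) (rule assms(2))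
  show ?thesis
    unfolding contract2_def using c ksupp_add[OF c c] by (cases "i = j") (simp_all only: if_True if_False simp_thms)
qed

lemma ksupp_glop:
  assumes "z \<in> ksupp G"
    and "\<And>K m. G K (m + unit_exp j) \<Longrightarrow> G' K (unit_exp i + m)"
    and "\<And>K m k. k < n \<Longrightarrow> qidx j k \<notin> K \<Longrightarrow> qidx i k \<notin> K \<Longrightarrow> G (insert (qidx j k) K) m \<Longrightarrow> G' (insert (qidx i k) K) m"
  shows "glop n i j z \<in> ksupp G'"
  unfolding glop_def
proof (intro ksupp_add ksupp_sum)
  show "scal (monomial (unit_exp i)) (kderiv j z) \<in> ksupp G'"
    by (rule ksupp_scal, rule ksupp_kderiv[OF assms(1), of _ "\<lambda>K m. G K (m + unit_exp j)"]) (auto intro: assms)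
  show "wedge (qidx i k) (contract2 j k z) \<in> ksupp G'" if "k \<in> {..<n}" for k
    by (rule ksupp_wedge, rule ksupp_contract2[OF assms(1), of _ _ "\<lambda>K m. qidx j k \<notin> K \<and> G (insert (qidx j k) K) m"])
      (use that assms(3) in auto)
qed

lemma ksupp_koszul_diff:
  assumes "z \<in> ksupp G"
    and "\<And>K m k a. k < length fs \<Longrightarrow> k \<notin> K \<Longrightarrow> G (insert k K) m \<Longrightarrow> a \<in> Poly_Mapping.keys (fs ! k) \<Longrightarrow> G' K (a + m)"
  shows "koszul_diff fs z \<in> ksupp G'"
  unfolding koszul_diff_sum
proof (intro ksupp_sum)
  show "scal (fs ! k) (contract k z) \<in> ksupp G'" if "k \<in> {..<length fs}" for k
    by (rule ksupp_scal, rule ksupp_contract[OF assms(1), of _ "\<lambda>K m. k \<notin> K \<and> G (insert k K) m"])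
      (use that assms(2) in auto)
qed

lemma ksupp_dual_diff:
  assumes "z \<in> ksupp G"
    and "\<And>K m k l. k < n \<Longrightarrow> l < n \<Longrightarrow> qidx k l \<notin> K \<Longrightarrow> G K (m + unit_exp k + unit_exp l) \<Longrightarrow> G' (insert (qidx k l) K) m"
  shows "dual_diff n z \<in> ksupp G'"
  unfolding dual_diff_def
proof (intro ksupp_sum)
  fix k l assume kl: "k \<in> {..<n}" "l \<in> {..<n}"
  have "kderiv l z \<in> ksupp (\<lambda>K m. G K (m + unit_exp l))"
    by (rule ksupp_kderiv[OF assms(1)])
  then have "kderiv k (kderiv l z) \<in> ksupp (\<lambda>K m. G K (m + unit_exp k + unit_exp l))"
    by (rule ksupp_kderiv)
  then show "wedge (qidx k l) (kderiv k (kderiv l z)) \<in> ksupp G'"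
    by (rule ksupp_wedge) (use kl assms(2) in auto)
qed

section \<open>Diagonal operators\<close>

text \<open>Serves as a projection onto selected terms (values 0 and 1) and as division by a number
  that depends on the term.\<close>

definition diagop :: "(nat set \<Rightarrow> (nat \<Rightarrow>\<^sub>0 nat) \<Rightarrow> 'k::field) \<Rightarrow> (nat set \<Rightarrow> 'k mpoly) \<Rightarrow> nat set \<Rightarrow> 'k mpoly" where
  "diagop c z K = plin (\<lambda>m. Poly_Mapping.single m (c K m)) (z K)"

lemma lookup_diag: "Poly_Mapping.lookup (plin (\<lambda>m. Poly_Mapping.single m (c m)) p) m = Poly_Mapping.lookup p m * c m"
  by (rule additive_eqI[of "\<lambda>p. Poly_Mapping.lookup (plin (\<lambda>m. Poly_Mapping.single m (c m)) p) m"])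
    (auto simp: lookup_add distrib_right lookup_single when_def)

lemma lookup_diagop [simp]:
  "Poly_Mapping.lookup (diagop c z K) m = Poly_Mapping.lookup (z K) m * c K m"
  by (simp add: diagop_def lookup_diag)

lemma diagop_add [simp]: "diagop c (z + w) = diagop c z + diagop c w"
  by (auto simp: diagop_def fun_apply)

lemma kelem_eqI: "(\<And>K m. Poly_Mapping.lookup (z K) m = Poly_Mapping.lookup (w K) m) \<Longrightarrow> z = w"
  by (intro ext poly_mapping_eqI) auto

lemma diagop_zero: "z \<in> ksupp G \<Longrightarrow> (\<And>K m. G K m \<Longrightarrow> c K m = 0) \<Longrightarrow> diagop c z = 0"
  by (rule kelem_eqI) (metis fun_apply(2) in_keys_iff ksuppD lookup_diagop lookup_zero mult_eq_0_iff)

lemma ksupp_diagop: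
  assumes "z \<in> ksupp G" "\<And>K m. G K m \<Longrightarrow> c K m \<noteq> 0 \<Longrightarrow> G' K m"
  shows "diagop c z \<in> ksupp G'"
  unfolding ksupp_def using assms by (auto simp: in_keys_iff) (metis in_keys_iff ksuppD)

lemma plin_diag_monomial_mult:
  "plin (\<lambda>m. Poly_Mapping.single m (c m)) (monomial a * p) =
   monomial a * plin (\<lambda>m. Poly_Mapping.single m (c (a + m))) p"
  by (rule additive_eqI[of "\<lambda>p. plin (\<lambda>m. Poly_Mapping.single m (c m)) (monomial a * p)"])
    (auto simp: distrib_left mult_single)

text \<open>A summand of the differential takes x^m e_(insert k K) to x^(a + m) e_K up to sign, so
  \<open>c\<close> and \<open>c'\<close> have to agree along this arrow.\<close>

lemma diagop_scal_contract:
  assumes "\<And>K m. k \<notin> K \<Longrightarrow> c K (a + m) = c' (insert k K) m"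
  shows "diagop c (scal (monomial a) (contract k z)) = scal (monomial a) (contract k (diagop c' z))"
proof
  fix K
  show "diagop c (scal (monomial a) (contract k z)) K = scal (monomial a) (contract k (diagop c' z)) K"
    using assms[of K]
    by (auto simp: diagop_def scal_def contract_def plin_diag_monomial_mult
        additive_ext_sign[of "plin _"])
qed

section \<open>Degrees\<close>

lemma keys_add_nat: "Poly_Mapping.keys (a + b) = Poly_Mapping.keys a \<union> Poly_Mapping.keys (b :: nat \<Rightarrow>\<^sub>0 nat)"
  by (auto simp: in_keys_iff lookup_add)

lemma monom_degree_superset:
  assumes "finite S" "Poly_Mapping.keys m \<subseteq> S"
  shows "monom_degree m = (\<Sum>i\<in>S. Poly_Mapping.lookup m i)"
  unfolding monom_degree_def using assms by (intro sum.mono_neutral_left) (auto simp: in_keys_iff)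

lemma monom_degree_add [simp]: "monom_degree (a + b) = monom_degree a + monom_degree b"
proof -
  let ?S = "Poly_Mapping.keys a \<union> Poly_Mapping.keys b"
  have "monom_degree (a + b) = (\<Sum>i\<in>?S. Poly_Mapping.lookup (a + b) i)"
    "monom_degree a = (\<Sum>i\<in>?S. Poly_Mapping.lookup a i)"
    "monom_degree b = (\<Sum>i\<in>?S. Poly_Mapping.lookup b i)"
    by (rule monom_degree_superset; auto simp: keys_add_nat)+
  then show ?thesis by (simp add: lookup_add sum.distrib)
qed

lemma monom_degree_single [simp]: "monom_degree (Poly_Mapping.single i k) = k"
  by (cases "k = 0") (auto simp: monom_degree_def)

lemma monom_degree_zero [simp]: "monom_degree 0 = 0"
  by (simp add: monom_degree_def)

definition even_exp :: "nat \<Rightarrow> (nat \<Rightarrow>\<^sub>0 nat) \<Rightarrow> bool" where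
  "even_exp n m \<longleftrightarrow> Poly_Mapping.keys m \<subseteq> {..<n} \<and> even (monom_degree m)"

text \<open>For \<open>N = length fs\<close> these are the chains over the Veronese ring, as
  \<open>carrier_koszul\<close> shows: the sum of graded pieces becomes a parity condition on
  exponents.\<close>

definition kelems :: "nat \<Rightarrow> nat \<Rightarrow> (nat set \<Rightarrow> 'k::field mpoly) set" where
  "kelems n N = ksupp (\<lambda>K m. K \<subseteq> {..<N} \<and> even_exp n m)"

lemma kelems_simps:
  "z \<in> kelems n N \<Longrightarrow> w \<in> kelems n N \<Longrightarrow> z + w \<in> kelems n N"
  "z \<in> kelems n N \<Longrightarrow> w \<in> kelems n N \<Longrightarrow> z - w \<in> kelems n N"
  "z \<in> kelems n N \<Longrightarrow> - z \<in> kelems n N"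
  "0 \<in> kelems n N"
  unfolding kelems_def by (auto intro: ksupp_add ksupp_diff ksupp_uminus)

lemma kelems_glop:
  assumes "i < n" "j < n" "z \<in> kelems n (triangle n)"
  shows "glop n i j z \<in> kelems n (triangle n)"
  using assms(3) unfolding kelems_def
  by (rule ksupp_glop) (use assms in \<open>auto simp: even_exp_def keys_add_nat qidx_less\<close>)

lemma kelems_dual_diff:
  assumes "z \<in> kelems n (triangle n)"
  shows "dual_diff n z \<in> kelems n (triangle n)"
  using assms unfolding kelems_def
  by (rule ksupp_dual_diff) (auto simp: even_exp_def keys_add_nat qidx_less)

section \<open>Acyclicity of the squares\<close>

definition diag_part :: "nat set \<Rightarrow> nat set" where
  "diag_part K = {i. qidx i i \<in> K}"

lemma qidx_diag_eq [simp]: "qidx i i = qidx j j \<longleftrightarrow> i = j"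
  by (auto simp: qidx_eq)

lemma diag_part_insert_diag [simp]: "diag_part (insert (qidx i i) K) = insert i (diag_part K)"
  by (auto simp: diag_part_def)

text \<open>
  A monomial \<open>x\<^sup>m e\<^sub>K\<close> is active at \<open>i\<close> if it dies in the quotient by \<open>x\<^sub>i\<^sup>2\<close> and \<open>e\<^sub>i\<^sub>i\<close>, where
  \<open>e\<^sub>i\<^sub>i\<close> is the exterior generator of \<open>x\<^sub>i\<^sup>2\<close>. As \<open>x\<^sub>1\<^sup>2, \<dots>, x\<^sub>n\<^sup>2\<close> is a regular sequence, the
  kernel of the quotient map, which is spanned by the active monomials, is acyclic.
\<close>

definition active :: "nat \<Rightarrow> nat set \<Rightarrow> (nat \<Rightarrow>\<^sub>0 nat) \<Rightarrow> nat set" where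
  "active n K m = {i. i < n \<and> (i \<in> diag_part K \<or> 2 \<le> Poly_Mapping.lookup m i)}"

lemma finite_active [simp]: "finite (active n K m)"
  by (simp add: active_def)

text \<open>Division by x_i^2 that drops the terms not divisible by it, hence a left inverse of
  multiplication by x_i^2.\<close>

definition pdiv :: "nat \<Rightarrow> 'k::field mpoly \<Rightarrow> 'k mpoly" where
  "pdiv i = plin (\<lambda>m. if 2 \<le> Poly_Mapping.lookup m i then monomial (m - Poly_Mapping.single i 2) else 0)"

lemma pdiv_add [simp]: "pdiv i (p + q) = pdiv i p + pdiv i q"
  by (simp add: pdiv_def)

lemma unit_exp_double: "unit_exp i + unit_exp i = Poly_Mapping.single i 2"
  by (simp add: single_add[symmetric] numeral_2_eq_2)

lemma pdiv_square_mult: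
  "pdiv i (monomial (Poly_Mapping.single j 2) * p) =
   (if i = j then p else monomial (Poly_Mapping.single j 2) * pdiv i p)"
proof (rule additive_eqI[of "\<lambda>p. pdiv i (monomial (Poly_Mapping.single j 2) * p)"])
  fix m :: "nat \<Rightarrow>\<^sub>0 nat" and v :: 'a
  have "Poly_Mapping.single j 2 + m - Poly_Mapping.single i 2 =
    Poly_Mapping.single j 2 + (m - Poly_Mapping.single i 2)" if "2 \<le> Poly_Mapping.lookup m i"
    using that by (intro exp_add_minus[of _ i]) (auto simp: lookup_single)
  moreover have "Poly_Mapping.single i 2 + m - Poly_Mapping.single i 2 = m"
    by (rule poly_mapping_eqI) (simp add: lookup_add lookup_minus)
  ultimately show "pdiv i (monomial (Poly_Mapping.single j 2) * Poly_Mapping.single m v) =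
    (if i = j then Poly_Mapping.single m v
     else monomial (Poly_Mapping.single j 2) * pdiv i (Poly_Mapping.single m v))"
    by (auto simp: pdiv_def mult_single lookup_add lookup_single when_def)
qed (simp_all add: distrib_left)

lemma square_mult_pdiv:
  "monomial (Poly_Mapping.single i 2) * pdiv i p =
   plin (\<lambda>m. Poly_Mapping.single m (if 2 \<le> Poly_Mapping.lookup m i then 1 else 0)) p"
proof (rule additive_eqI[of "\<lambda>p. monomial (Poly_Mapping.single i 2) * pdiv i p"])
  fix m :: "nat \<Rightarrow>\<^sub>0 nat" and v :: 'a
  have "Poly_Mapping.single i 2 + (m - Poly_Mapping.single i 2) = m" if "2 \<le> Poly_Mapping.lookup m i"
    using that by (intro exp_add_minus[of _ i]) (auto simp: lookup_single)
  then show "monomial (Poly_Mapping.single i 2) * pdiv i (Poly_Mapping.single m v) =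
    plin (\<lambda>m. Poly_Mapping.single m (if 2 \<le> Poly_Mapping.lookup m i then 1 else 0)) (Poly_Mapping.single m v)"
    by (auto simp: pdiv_def mult_single)
qed (simp_all add: distrib_left)

abbreviation kdiv :: "nat \<Rightarrow> (nat set \<Rightarrow> 'k::field mpoly) \<Rightarrow> nat set \<Rightarrow> 'k mpoly" where
  "kdiv i \<equiv> ptw (pdiv i)"

definition diff_diag :: "nat \<Rightarrow> (nat set \<Rightarrow> 'k::field mpoly) \<Rightarrow> nat set \<Rightarrow> 'k mpoly" where
  "diff_diag n z = (\<Sum>i<n. scal (monomial (Poly_Mapping.single i 2)) (contract (qidx i i) z))"

definition diff_off :: "nat \<Rightarrow> (nat set \<Rightarrow> 'k::field mpoly) \<Rightarrow> nat set \<Rightarrow> 'k mpoly" where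
  "diff_off n z = (\<Sum>q\<in>{..<triangle n} - range (\<lambda>i. qidx i i). scal (monomial (qexp q)) (contract q z))"

text \<open>The Koszul homotopy for the squares: x_i^2 is divided out and e_ii put in its
  place.\<close>

definition diag_homotopy :: "nat \<Rightarrow> (nat set \<Rightarrow> 'k::field mpoly) \<Rightarrow> nat set \<Rightarrow> 'k mpoly" where
  "diag_homotopy n z = (\<Sum>i<n. wedge (qidx i i) (kdiv i z))"

lemma diff_split: "koszul_diff (quads n) z = diff_diag n z + diff_off n z"
proof -
  let ?D = "(\<lambda>i. qidx i i) ` {..<n}"
  let ?f = "\<lambda>q. scal (monomial (qexp q)) (contract q z)"
  have D: "?D \<subseteq> {..<triangle n}" "{..<triangle n} - range (\<lambda>i. qidx i i) = {..<triangle n} - ?D"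
    by (auto simp: qidx_less)
  have "koszul_diff (quads n) z = sum ?f ({..<triangle n} - ?D) + sum ?f ?D"
    unfolding koszul_diff_quads by (rule sum.subset_diff) (use D in auto)
  also have "sum ?f ?D = diff_diag n z"
    unfolding diff_diag_def
    by (subst sum.reindex) (auto simp: inj_on_def unit_exp_double)
  finally show ?thesis unfolding diff_off_def D(2) by (simp add: add.commute)
qed

text \<open>For \<open>i \<noteq> j\<close> the operators anticommute. For \<open>i = j\<close> a
  term with e_ii is reproduced by the second summand only, and a term without it by the first,
  provided that x_i^2 divides it.\<close>

lemma homotopy_term:
  "scal (monomial (Poly_Mapping.single j 2)) (contract (qidx j j) (wedge (qidx i i) (kdiv i z))) +
   wedge (qidx i i) (kdiv i (scal (monomial (Poly_Mapping.single j 2)) (contract (qidx j j) z))) =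
   (if i = j then diagop (\<lambda>K m. if i \<in> diag_part K \<or> 2 \<le> Poly_Mapping.lookup m i then 1 else 0) z else 0)"
proof (cases "i = j")
  case False
  have "kdiv i (scal (monomial (Poly_Mapping.single j 2)) w) =
    scal (monomial (Poly_Mapping.single j 2)) (kdiv i w)" for w :: "nat set \<Rightarrow> 'a mpoly"
    using False by (auto simp: ptw_def scal_def pdiv_square_mult)
  then show ?thesis
    using False by (simp add: contract_wedge ptw_contract)
next
  case True
  have 1: "kdiv i (scal (monomial (Poly_Mapping.single i 2)) w) = w" for w :: "nat set \<Rightarrow> 'a mpoly"
    by (auto simp: ptw_def scal_def pdiv_square_mult)
  have "scal (monomial (Poly_Mapping.single i 2)) (contract (qidx i i) (wedge (qidx i i) (kdiv i z))) K +
    wedge (qidx i i) (contract (qidx i i) z) K =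
    diagop (\<lambda>K m. if i \<in> diag_part K \<or> 2 \<le> Poly_Mapping.lookup m i then 1 else 0) z K" for K
  proof (cases "qidx i i \<in> K")
    case True
    then show ?thesis
      by (auto simp: scal_def contract_def wedge_def diag_part_def insert_absorb diagop_def
          intro!: poly_mapping_eqI simp: lookup_diag)
  next
    case False
    then show ?thesis
      by (auto simp: scal_def contract_def wedge_def diag_part_def diagop_def ptw_def square_mult_pdiv)
  qed
  then show ?thesis
    unfolding True[symmetric] 1 by (auto simp: fun_apply fun_eq_iff)
qed

lemma homotopy:
  "diff_diag n (diag_homotopy n z) + diag_homotopy n (diff_diag n z) =
   diagop (\<lambda>K m. of_nat (card (active n K m))) z"
proof -
  have k: "kdiv i (\<Sum>j<n. g j) = (\<Sum>j<n. kdiv i (g j))" for i and g :: "nat \<Rightarrow> nat set \<Rightarrow> 'a mpoly"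
    by (rule additive_sum[of "kdiv i"]) (simp add: ptw_add)
  have "diff_diag n (diag_homotopy n z) = (\<Sum>j<n. \<Sum>i<n.
    scal (monomial (Poly_Mapping.single j 2)) (contract (qidx j j) (wedge (qidx i i) (kdiv i z))))"
    by (simp only: diff_diag_def diag_homotopy_def contract_sum scal_sum)
  also have "\<dots> = (\<Sum>i<n. \<Sum>j<n.
    scal (monomial (Poly_Mapping.single j 2)) (contract (qidx j j) (wedge (qidx i i) (kdiv i z))))"
    by (rule sum.swap)
  finally have "diff_diag n (diag_homotopy n z) + diag_homotopy n (diff_diag n z) =
    (\<Sum>i<n. \<Sum>j<n. if i = j then diagop (\<lambda>K m. if i \<in> diag_part K \<or> 2 \<le> Poly_Mapping.lookup m i then 1 else 0) z else 0)"
    unfolding diff_diag_def[of n z] diag_homotopy_def[of n "sum _ _"] k wedge_sum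
    by (simp only: sum.distrib[symmetric] homotopy_term)
  also have "\<dots> = (\<Sum>i<n. diagop (\<lambda>K m. if i \<in> diag_part K \<or> 2 \<le> Poly_Mapping.lookup m i then 1 else 0) z)"
    by simp
  also have "\<dots> = diagop (\<lambda>K m. of_nat (card (active n K m))) z"
  proof (rule kelem_eqI)
    fix K m
    have "(\<Sum>i<n. if i \<in> diag_part K \<or> 2 \<le> Poly_Mapping.lookup m i then 1 else (0::'a)) = of_nat (card (active n K m))"
      by (simp add: sum.If_cases active_def) (rule arg_cong[of _ _ "\<lambda>A. of_nat (card A)"], auto)
    then show "Poly_Mapping.lookup ((\<Sum>i<n. diagop (\<lambda>K m. if i \<in> diag_part K \<or> 2 \<le> Poly_Mapping.lookup m i then 1 else 0) z) K) m =
      Poly_Mapping.lookup (diagop (\<lambda>K m. of_nat (card (active n K m))) z K) m"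
      by (simp add: fun_apply lookup_sum sum_distrib_left[symmetric])
  qed
  finally show ?thesis .
qed

lemma ksupp_kdiv:
  assumes "z \<in> ksupp G" "\<And>K m. G K (m + Poly_Mapping.single i 2) \<Longrightarrow> G' K m"
  shows "kdiv i z \<in> ksupp G'"
proof -
  have "G' K m" if "m \<in> Poly_Mapping.keys (pdiv i (z K))" for K m
  proof -
    have "m \<in> (\<Union>m\<in>Poly_Mapping.keys (z K). Poly_Mapping.keys
        (if 2 \<le> Poly_Mapping.lookup m i then monomial (m - Poly_Mapping.single i 2) else 0 :: 'a mpoly))"
      using that keys_plin unfolding pdiv_def by (rule subsetD[rotated])
    then obtain m' where m': "m' \<in> Poly_Mapping.keys (z K)" "m = m' - Poly_Mapping.single i 2" "2 \<le> Poly_Mapping.lookup m' i"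
      by (force split: if_splits)
    then have "m' = m + Poly_Mapping.single i 2"
      by (subst exp_add_minus(3)[of _ i, symmetric]) (auto simp: lookup_single)
    then show ?thesis using m'(1) assms by (auto dest: ksuppD)
  qed
  then show ?thesis by (auto simp: ksupp_def ptw_def)
qed

lemma ksupp_diag_homotopy:
  assumes "z \<in> ksupp G"
    and "\<And>K m i. i < n \<Longrightarrow> qidx i i \<notin> K \<Longrightarrow> G K (m + Poly_Mapping.single i 2) \<Longrightarrow> G' (insert (qidx i i) K) m"
  shows "diag_homotopy n z \<in> ksupp G'"
  unfolding diag_homotopy_def
proof (rule ksupp_sum)
  fix i assume "i \<in> {..<n}"
  then show "wedge (qidx i i) (kdiv i z) \<in> ksupp G'"
    using ksupp_kdiv[OF assms(1), of i "\<lambda>K m. G K (m + Poly_Mapping.single i 2)"] assms(2)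
    by (auto intro: ksupp_wedge)
qed

lemma ksupp_diff_off:
  assumes "z \<in> ksupp G"
    and "\<And>K m i j. i < n \<Longrightarrow> j < n \<Longrightarrow> i \<noteq> j \<Longrightarrow> qidx i j \<notin> K \<Longrightarrow> G (insert (qidx i j) K) m \<Longrightarrow>
      G' K (unit_exp i + unit_exp j + m)"
  shows "diff_off n z \<in> ksupp G'"
  unfolding diff_off_def
proof (intro ksupp_sum)
  fix q assume q: "q \<in> {..<triangle n} - range (\<lambda>i. qidx i i)"
  then obtain i j where ij: "i < n" "j < n" "i \<noteq> j" "q = qidx i j"
    using qidx_exists by blast
  have "contract q z \<in> ksupp (\<lambda>K m. q \<notin> K \<and> G (insert q K) m)"
    by (rule ksupp_contract[OF assms(1)]) simp
  then show "scal (monomial (qexp q)) (contract q z) \<in> ksupp G'"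
    by (rule ksupp_scal) (use ij assms(2) in auto)
qed

lemma diff_diag_diagop:
  assumes "\<And>K m i. i < n \<Longrightarrow> i \<notin> diag_part K \<Longrightarrow> c K (Poly_Mapping.single i 2 + m) = c' (insert (qidx i i) K) m"
  shows "diagop c (diff_diag n z) = diff_diag n (diagop c' z)"
proof -
  have "diagop c (diff_diag n z) = (\<Sum>i<n. diagop c (scal (monomial (Poly_Mapping.single i 2)) (contract (qidx i i) z)))"
    unfolding diff_diag_def by (rule additive_sum[of "diagop c"]) simp
  also have "\<dots> = diff_diag n (diagop c' z)"
    unfolding diff_diag_def
    by (intro sum.cong refl diagop_scal_contract) (use assms in \<open>auto simp: diag_part_def\<close>)
  finally show ?thesis .
qed

lemma diff_off_diagop:
  assumes "\<And>K m i j. i < n \<Longrightarrow> j < n \<Longrightarrow> i \<noteq> j \<Longrightarrow> qidx i j \<notin> K \<Longrightarrow>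
    c K (unit_exp i + unit_exp j + m) = c' (insert (qidx i j) K) m"
  shows "diagop c (diff_off n z) = diff_off n (diagop c' z)"
proof -
  let ?S = "{..<triangle n} - range (\<lambda>i. qidx i i)"
  have "diagop c (diff_off n z) = (\<Sum>q\<in>?S. diagop c (scal (monomial (qexp q)) (contract q z)))"
    unfolding diff_off_def by (rule additive_sum[of "diagop c"]) simp
  also have "\<dots> = diff_off n (diagop c' z)"
    unfolding diff_off_def
  proof (intro sum.cong refl diagop_scal_contract)
    fix q K m assume "q \<in> ?S" "q \<notin> K"
    moreover from this obtain i j where "i < n" "j < n" "i \<noteq> j" "q = qidx i j"
      using qidx_exists by blast
    ultimately show "c K (qexp q + m) = c' (insert q K) m"
      using assms by auto
  qed
  finally show ?thesis .
qed

lemma active_insert_diag: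
  "i \<notin> diag_part K \<Longrightarrow> active n K (Poly_Mapping.single i 2 + m) = active n (insert (qidx i i) K) m"
  by (auto simp: active_def lookup_add lookup_single when_def)

text \<open>\<open>diff_diag\<close> preserves the set of active indices, so it commutes with
  division by the size of this set. After this division \<open>homotopy\<close> returns
  \<open>z\<close> itself.\<close>

lemma diff_diag_exact:
  fixes z :: "nat set \<Rightarrow> 'k::field_char_0 mpoly"
  assumes "z \<in> ksupp G" "\<And>K m. G K m \<Longrightarrow> active n K m \<noteq> {}" "diff_diag n z = 0"
  shows "z = diff_diag n (diag_homotopy n (diagop (\<lambda>K m. 1 / of_nat (card (active n K m))) z))"
proof -
  let ?u = "diagop (\<lambda>K m. 1 / of_nat (card (active n K m))) z"
  have "diff_diag n ?u = diagop (\<lambda>K m. 1 / of_nat (card (active n K m))) (diff_diag n z)"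
    by (rule diff_diag_diagop[symmetric]) (simp add: active_insert_diag)
  also have "\<dots> = 0" unfolding assms(3) by (rule diagop_zero[of _ "\<lambda>_ _. False"]) (auto simp: ksupp_def fun_apply)
  finally have u: "diff_diag n ?u = 0" .
  have "diag_homotopy n (0 :: nat set \<Rightarrow> 'k mpoly) = 0"
  proof -
    have "kdiv i (0 :: nat set \<Rightarrow> 'k mpoly) = 0" for i
      by (rule ext) (simp add: ptw_def pdiv_def fun_apply)
    then show ?thesis by (simp add: diag_homotopy_def)
  qed
  then have "diff_diag n (diag_homotopy n ?u) = diagop (\<lambda>K m. of_nat (card (active n K m))) ?u"
    using homotopy[of n ?u] u by simp
  also have "\<dots> = z"
  proof (rule kelem_eqI)
    fix K m
    have "Poly_Mapping.lookup (z K) m = 0 \<or> active n K m \<noteq> {}"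
      using assms(1,2) by (metis in_keys_iff ksuppD)
    then show "Poly_Mapping.lookup (diagop (\<lambda>K m. of_nat (card (active n K m))) ?u K) m = Poly_Mapping.lookup (z K) m"
      by auto
  qed
  finally show ?thesis ..
qed

section \<open>From the square part of the differential to all of it\<close>

lemma koszul_diff_zero [simp]: "koszul_diff fs 0 = 0"
  by (simp add: koszul_diff_sum)

lemma koszul_diff_minus: "koszul_diff fs (z - w) = koszul_diff fs z - koszul_diff fs w"
  using koszul_diff_add[of fs "z - w" w] by (simp only: diff_add_cancel eq_diff_eq)

lemma koszul_diff_sq:
  fixes z :: "nat set \<Rightarrow> 'k::field_char_0 mpoly"
  shows "koszul_diff fs (koszul_diff fs z) = 0"
proof -
  let ?n = "length fs"
  let ?f = "\<lambda>k l. scal (fs ! k * fs ! l) (contract k (contract l z))"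
  have 1: "koszul_diff fs (koszul_diff fs z) = (\<Sum>k<?n. \<Sum>l<?n. ?f k l)"
    by (simp only: koszul_diff_sum contract_sum scal_sum contract_scal scal_scal)
  also have "\<dots> = (\<Sum>l<?n. \<Sum>k<?n. ?f k l)"
    by (rule sum.swap)
  also have "\<dots> = (\<Sum>l<?n. \<Sum>k<?n. - ?f l k)"
    by (subst contract_anticommute) (simp only: scal_minus mult.commute)
  also have "\<dots> = - koszul_diff fs (koszul_diff fs z)"
    unfolding 1 by (simp only: sum_negf)
  finally have "koszul_diff fs (koszul_diff fs z) + koszul_diff fs (koszul_diff fs z) = 0 + 0"
    by (metis add.right_inverse add_0_right)
  then show ?thesis by (rule double_cancel)
qed

text \<open>The filtration degree: \<open>diff_diag\<close> lowers it by one,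
  \<open>diff_off\<close> preserves it.\<close>

definition diag_count :: "nat \<Rightarrow> nat set \<Rightarrow> nat" where
  "diag_count n K = card (diag_part K \<inter> {..<n})"

lemma diag_count_insert_diag:
  "i < n \<Longrightarrow> i \<notin> diag_part K \<Longrightarrow> diag_count n (insert (qidx i i) K) = Suc (diag_count n K)"
  by (simp add: diag_count_def)

lemma diag_part_insert_off: "i \<noteq> j \<Longrightarrow> diag_part (insert (qidx i j) K) = diag_part K"
  by (auto simp: diag_part_def qidx_eq)

lemma diag_count_insert_off: "i \<noteq> j \<Longrightarrow> diag_count n (insert (qidx i j) K) = diag_count n K"
  by (simp add: diag_count_def diag_part_insert_off)

lemma diag_count_pos: "0 < diag_count n K \<Longrightarrow> active n K m \<noteq> {}"
  by (auto simp: diag_count_def active_def card_gt_0_iff)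

lemma diagop_zero_right [simp]: "diagop c 0 = 0"
  by (rule kelem_eqI) (simp add: fun_apply)

text \<open>The lowest layer of the cycle is killed by \<open>diff_diag\<close>, hence equals
  \<open>diff_diag w\<close> with \<open>w\<close> one layer higher. Subtracting the full boundary
  of \<open>w\<close> leaves a cycle in the layers above \<open>p\<close>. The number
  \<open>k\<close> counts the layers from \<open>p\<close> to \<open>n\<close> that are still to be
  cleared.\<close>

lemma active_cycle_boundary_aux:
  fixes z :: "nat set \<Rightarrow> 'k::field_char_0 mpoly"
  assumes "p + k = Suc n"
    and "z \<in> ksupp (\<lambda>K m. K \<subseteq> {..<triangle n} \<and> even_exp n m \<and> active n K m \<noteq> {} \<and> p \<le> diag_count n K)"
    and "koszul_diff (quads n) z = 0"
  shows "\<exists>b\<in>kelems n (triangle n). z = koszul_diff (quads n) b"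
  using assms
proof (induction k arbitrary: p z)
  case 0
  have "diag_count n K \<le> n" for K
    using card_mono[of "{..<n}" "diag_part K \<inter> {..<n}"] by (simp add: diag_count_def)
  then have "\<not> p \<le> diag_count n K" for K
    using 0 by (metis add_0_right not_less_eq_eq)
  then have "z = 0" using 0(2) by (auto simp: ksupp_def fun_eq_iff fun_apply)
  then show ?case using kelems_simps(4) by (metis koszul_diff_zero)
next
  case (Suc k)
  define zp where "zp = diagop (\<lambda>K m. if diag_count n K = p then 1 else 0) z"
  \<comment> \<open>Selects layer \<open>p - 1\<close> of the boundary of \<open>z\<close>, to which
    only \<open>diff_diag zp\<close> contributes. The form with \<open>Suc\<close> selects nothing
    when \<open>p = 0\<close>.\<close>
  define c :: "nat set \<Rightarrow> (nat \<Rightarrow>\<^sub>0 nat) \<Rightarrow> 'k"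
    where "c K m = (if Suc (diag_count n K) = p then 1 else 0)" for K m
  define w where "w = diag_homotopy n (diagop (\<lambda>K m. 1 / of_nat (card (active n K m))) zp)"
  let ?C = "\<lambda>K m. K \<subseteq> {..<triangle n} \<and> even_exp n m"
  let ?G = "\<lambda>K m. ?C K m \<and> Suc p \<le> diag_count n K"
  have zp: "zp \<in> ksupp (\<lambda>K m. ?C K m \<and> active n K m \<noteq> {} \<and> diag_count n K = p)"
    unfolding zp_def using Suc.prems(2) by (rule ksupp_diagop) (auto split: if_splits)
  have "diagop c (diff_diag n z) = diff_diag n zp"
    unfolding zp_def by (rule diff_diag_diagop) (simp add: c_def diag_count_insert_diag)
  moreover have "diagop c (diff_off n z) = diff_off n (diagop c z)"
    by (rule diff_off_diagop) (simp add: c_def diag_count_insert_off)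
  moreover have "diagop c z = 0"
    by (rule diagop_zero[OF Suc.prems(2)]) (auto simp: c_def)
  moreover have "diff_off n (0 :: nat set \<Rightarrow> 'k mpoly) = 0"
    by (simp add: diff_off_def)
  ultimately have "diff_diag n zp = 0"
    using Suc.prems(3) diagop_add[of c "diff_diag n z" "diff_off n z"] by (simp add: diff_split)
  then have w: "zp = diff_diag n w"
    unfolding w_def by (intro diff_diag_exact[OF zp]) auto
  have wG: "w \<in> ksupp ?G"
    unfolding w_def
  proof (rule ksupp_diag_homotopy)
    show "diagop (\<lambda>K m. 1 / of_nat (card (active n K m))) zp \<in> ksupp (\<lambda>K m. ?C K m \<and> diag_count n K = p)"
      by (rule ksupp_diagop[OF zp]) auto
    show "?G (insert (qidx i i) K) m" if "i < n" "qidx i i \<notin> K"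
      "?C K (m + Poly_Mapping.single i 2) \<and> diag_count n K = p" for K m i
      using that by (auto simp: diag_part_def diag_count_insert_diag qidx_less even_exp_def keys_add_nat)
  qed
  have "z - zp = diagop (\<lambda>K m. if diag_count n K = p then 0 else 1) z"
    unfolding zp_def by (rule kelem_eqI) (simp add: fun_apply lookup_minus)
  moreover have "\<dots> \<in> ksupp ?G"
    using Suc.prems(2) by (rule ksupp_diagop) (auto split: if_splits)
  moreover have "diff_off n w \<in> ksupp ?G"
    using wG by (rule ksupp_diff_off) (auto simp: diag_count_insert_off even_exp_def keys_add_nat)
  moreover have "z - koszul_diff (quads n) w = (z - zp) - diff_off n w"
    unfolding diff_split w[symmetric] by (simp only: diff_diff_eq)
  ultimately have "z - koszul_diff (quads n) w \<in> ksupp ?G"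
    by (simp only: ksupp_diff)
  \<comment> \<open>From layer one on, some e_ii occurs in each term, so activity is
    automatic.\<close>
  then have "z - koszul_diff (quads n) w \<in> ksupp (\<lambda>K m. K \<subseteq> {..<triangle n} \<and> even_exp n m \<and> active n K m \<noteq> {} \<and> Suc p \<le> diag_count n K)"
    by (rule ksupp_mono) (use diag_count_pos in fastforce)
  moreover have "koszul_diff (quads n) (z - koszul_diff (quads n) w) = 0"
    using Suc.prems(3) by (simp add: koszul_diff_minus koszul_diff_sq)
  ultimately obtain b where b: "b \<in> kelems n (triangle n)"
    "z - koszul_diff (quads n) w = koszul_diff (quads n) b"
    using Suc.IH[of "Suc p"] Suc.prems(1) by auto
  have "w \<in> kelems n (triangle n)"
    unfolding kelems_def using wG by (rule ksupp_mono) auto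
  moreover have "z = koszul_diff (quads n) (b + w)"
    using b(2) by (simp add: algebra_simps)
  ultimately show ?case using b(1) kelems_simps(1) by blast
qed

lemma active_cycle_boundary:
  fixes z :: "nat set \<Rightarrow> 'k::field_char_0 mpoly"
  assumes "z \<in> kelems n (triangle n)" "z \<in> ksupp (\<lambda>K m. active n K m \<noteq> {})"
    and "koszul_diff (quads n) z = 0"
  obtains b where "b \<in> kelems n (triangle n)" "z = koszul_diff (quads n) b"
proof -
  have "z \<in> ksupp (\<lambda>K m. K \<subseteq> {..<triangle n} \<and> even_exp n m \<and> active n K m \<noteq> {} \<and> 0 \<le> diag_count n K)"
    using assms(1,2) by (auto simp: kelems_def ksupp_def)
  then show thesis using active_cycle_boundary_aux[of 0 "Suc n" n z] assms(3) that by auto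
qed

lemma scal_diff_right: "scal p (z - w) = scal p z - scal p w"
  using scal_add[of p z "- w"] by (simp only: scal_minus diff_conv_add_uminus)

section \<open>The subalgebra generated by the linear strand\<close>

text \<open>Degree 2 in x is degree 1 in the Veronese ring, so these cycles have bidegree (i, i + 1)
  for some \<open>i\<close>.\<close>

definition linear_cycles :: "nat \<Rightarrow> 'k::field mpoly list \<Rightarrow> (nat set \<Rightarrow> 'k mpoly) set" where
  "linear_cycles n fs = {z. koszul_diff fs z = 0 \<and> (\<exists>i. z \<in> ksupp (\<lambda>K m.
     K \<subseteq> {..<length fs} \<and> card K = i \<and> Poly_Mapping.keys m \<subseteq> {..<n} \<and> monom_degree m = 2))}"

text \<open>The subalgebra is generated among cycles, before boundaries are divided out, so that
  \<open>glop\<close> and the change of basis act on it directly.\<close>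

inductive_set lingen :: "nat \<Rightarrow> 'k::field mpoly list \<Rightarrow> (nat set \<Rightarrow> 'k mpoly) set"
  for n and fs where
  scalar: "scal (const_poly c) (ext_basis {}) \<in> lingen n fs"
| linear: "z \<in> linear_cycles n fs \<Longrightarrow> z \<in> lingen n fs"
| add: "z \<in> lingen n fs \<Longrightarrow> w \<in> lingen n fs \<Longrightarrow> z + w \<in> lingen n fs"
| mult: "z \<in> lingen n fs \<Longrightarrow> w \<in> lingen n fs \<Longrightarrow> kmult z w \<in> lingen n fs"

lemma ksupp_ext_basis: "G I 0 \<Longrightarrow> ext_basis I \<in> ksupp G"
  by (auto simp: ksupp_def ext_basis_def)

lemma keys_const_poly: "Poly_Mapping.keys (const_poly c) \<subseteq> {0}"
  by (simp add: const_poly_def)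

lemma ksupp_scal_const: "z \<in> ksupp G \<Longrightarrow> scal (const_poly c) z \<in> ksupp G"
  by (erule ksupp_scal) (use keys_const_poly[of c] in auto)

lemma kelems_kmult: "z \<in> kelems n N \<Longrightarrow> w \<in> kelems n N \<Longrightarrow> kmult z w \<in> kelems n N"
  unfolding kelems_def by (erule (1) ksupp_kmult) (auto simp: even_exp_def keys_add_nat)

lemma kelems_scal_const: "z \<in> kelems n N \<Longrightarrow> scal (const_poly c) z \<in> kelems n N"
  unfolding kelems_def by (rule ksupp_scal_const)

lemma kelems_one: "ext_basis {} \<in> kelems n N"
  unfolding kelems_def by (rule ksupp_ext_basis) (simp add: even_exp_def)

lemma lingen_kelems: "q \<in> lingen n fs \<Longrightarrow> q \<in> kelems n (length fs)"
proof (induction rule: lingen.induct)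
  case (linear z)
  then show ?case unfolding linear_cycles_def kelems_def by (auto simp: even_exp_def elim!: ksupp_mono)
qed (auto intro: kelems_simps kelems_kmult kelems_scal_const kelems_one)

lemma kelems_supported: "z \<in> kelems n N \<Longrightarrow> ext_supported N z"
  unfolding kelems_def ext_supported_def ksupp_def by (metis (mono_tags, lifting) all_not_in_conv keys_eq_empty mem_Collect_eq)

lemma koszul_diff_scal: "koszul_diff fs (scal p z) = scal p (koszul_diff fs z)"
  by (simp add: koszul_diff_sum scal_sum mult.commute)

lemma contract_one [simp]: "contract k (ext_basis {}) = 0"
  by (auto simp: contract_def ext_basis_def fun_apply)

lemma koszul_diff_one [simp]: "koszul_diff fs (ext_basis {}) = 0"
  by (simp add: koszul_diff_sum)

lemma kmult_zero [simp]: "kmult 0 z = 0" "kmult z 0 = 0"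
  by (auto simp: kmult_def fun_apply)

lemma lingen_cycle: "q \<in> lingen n fs \<Longrightarrow> koszul_diff fs q = 0"
  by (induction rule: lingen.induct) (simp_all add: linear_cycles_def koszul_diff_scal koszul_diff_kmult)

lemma lingen_scal: "q \<in> lingen n fs \<Longrightarrow> scal (const_poly c) q \<in> lingen n fs"
proof -
  assume q: "q \<in> lingen n fs"
  have "kmult (scal (const_poly c) (ext_basis {})) q \<in> lingen n fs"
    by (intro lingen.mult lingen.scalar q)
  moreover have "kmult (ext_basis {}) q = q"
    by (rule kmult_one_left) (rule ext_supported_infinite[OF kelems_supported[OF lingen_kelems[OF q]]])
  ultimately show ?thesis by (simp add: kmult_scal_left)
qed

lemma lingen_zero: "0 \<in> lingen n fs"
  using lingen.scalar[of 0 n fs] by simp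

lemma lingen_sum: "(\<And>i. i \<in> A \<Longrightarrow> f i \<in> lingen n fs) \<Longrightarrow> (\<Sum>i\<in>A. f i) \<in> lingen n fs"
  by (induction A rule: infinite_finite_induct) (auto intro: lingen.add lingen_zero)

lemma glop_zero [simp]: "glop n i j 0 = 0"
  using glop_add[of n i j 0 0] by (simp only: add_0_left add_cancel_right_right)

lemma ptw_pderiv_one [simp]: "kderiv j (scal (const_poly c) (ext_basis {})) = 0"
  by (rule ext) (auto simp: ptw_def ext_basis_def fun_apply scal_def const_poly_def pderiv_single pderiv_def)

lemma glop_scalar: "glop n i j (scal (const_poly c) (ext_basis {})) = 0"
proof -
  have "contract2 j k (scal (const_poly c) (ext_basis {})) = 0" for k
    by (simp add: contract2_def)
  then show ?thesis by (simp add: glop_def)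
qed

lemma glop_linear_cycles:
  fixes z :: "nat set \<Rightarrow> 'k::field_char_0 mpoly"
  assumes "i < n" "j < n" "z \<in> linear_cycles n (quads n)"
  shows "glop n i j z \<in> linear_cycles n (quads n)"
proof -
  obtain p where z: "koszul_diff (quads n) z = 0" "z \<in> ksupp (\<lambda>K m.
     K \<subseteq> {..<length (quads n :: 'k mpoly list)} \<and> card K = p \<and> Poly_Mapping.keys m \<subseteq> {..<n} \<and> monom_degree m = 2)"
    using assms(3) by (auto simp: linear_cycles_def)
  have "glop n i j z \<in> ksupp (\<lambda>K m. K \<subseteq> {..<length (quads n :: 'k mpoly list)} \<and> card K = p \<and>
      Poly_Mapping.keys m \<subseteq> {..<n} \<and> monom_degree m = 2)"
    using z(2)
  proof (rule ksupp_glop)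
    fix K m k
    assume *: "k < n" "qidx j k \<notin> K" "qidx i k \<notin> K"
      "insert (qidx j k) K \<subseteq> {..<length (quads n :: 'k mpoly list)} \<and> card (insert (qidx j k) K) = p \<and>
       Poly_Mapping.keys m \<subseteq> {..<n} \<and> monom_degree m = 2"
    then have "finite K" by (auto intro: finite_subset)
    then show "insert (qidx i k) K \<subseteq> {..<length (quads n :: 'k mpoly list)} \<and> card (insert (qidx i k) K) = p \<and>
       Poly_Mapping.keys m \<subseteq> {..<n} \<and> monom_degree m = 2"
      using * assms(1) by (auto simp: qidx_less)
  qed (use assms(1) in \<open>auto simp: keys_add_nat\<close>)
  then show ?thesis
    using koszul_diff_glop[OF assms(1,2), of z] z(1) by (auto simp: linear_cycles_def)
qed

lemma glop_lingen:
  fixes q :: "nat set \<Rightarrow> 'k::field_char_0 mpoly"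
  assumes "i < n" "j < n" "q \<in> lingen n (quads n)"
  shows "glop n i j q \<in> lingen n (quads n)"
  using assms(3)
proof (induction rule: lingen.induct)
  case (mult z w)
  then show ?case by (simp add: glop_kmult lingen.add lingen.mult)
qed (use assms in \<open>auto simp: glop_scalar lingen_zero intro: lingen.intros glop_linear_cycles\<close>)

text \<open>The set P of the overview.\<close>

definition reach :: "nat \<Rightarrow> (nat set \<Rightarrow> 'k::field_char_0 mpoly) set" where
  "reach n = {q + koszul_diff (quads n) b | q b. q \<in> lingen n (quads n) \<and> b \<in> kelems n (triangle n)}"

lemma reachI:
  "q \<in> lingen n (quads n) \<Longrightarrow> b \<in> kelems n (triangle n) \<Longrightarrow> q + koszul_diff (quads n) b \<in> reach n"
  by (auto simp: reach_def)

lemma reach_lingen: "q \<in> lingen n (quads n) \<Longrightarrow> q \<in> reach n"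
  using reachI[of q n 0] kelems_simps(4)[of n "triangle n"] by simp

lemma reach_boundary: "b \<in> kelems n (triangle n) \<Longrightarrow> koszul_diff (quads n) b \<in> reach n"
  using reachI[OF lingen_zero] by simp

lemma reach_zero: "0 \<in> reach n"
  by (rule reach_lingen[OF lingen_zero])

lemma reach_add: "z \<in> reach n \<Longrightarrow> w \<in> reach n \<Longrightarrow> z + w \<in> reach n"
proof -
  assume "z \<in> reach n" "w \<in> reach n"
  then obtain q b q' b' where *: "z = q + koszul_diff (quads n) b" "w = q' + koszul_diff (quads n) b'"
    "q \<in> lingen n (quads n)" "b \<in> kelems n (triangle n)" "q' \<in> lingen n (quads n)" "b' \<in> kelems n (triangle n)"
    unfolding reach_def by blast
  show ?thesis
    using reachI[OF lingen.add[OF *(3,5)] kelems_simps(1)[OF *(4,6)]] unfolding *(1,2) by (simp add: add_ac)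
qed

lemma reach_scal: "z \<in> reach n \<Longrightarrow> scal (const_poly c) z \<in> reach n"
  unfolding reach_def
  by clarify (metis (no_types, lifting) koszul_diff_scal lingen_scal scal_add kelems_scal_const)

lemma reach_minus: "z \<in> reach n \<Longrightarrow> - z \<in> reach n"
proof -
  assume "z \<in> reach n"
  moreover have "scal (const_poly (- 1)) z = - z"
    by (rule ext) (simp add: scal_def const_poly_def single_uminus fun_apply)
  ultimately show ?thesis using reach_scal[of z n "- 1"] by simp
qed

lemma reach_diff: "z \<in> reach n \<Longrightarrow> w \<in> reach n \<Longrightarrow> z - w \<in> reach n"
  by (metis add_uminus_conv_diff reach_add reach_minus)

lemma reach_sum: "(\<And>i. i \<in> A \<Longrightarrow> f i \<in> reach n) \<Longrightarrow> (\<Sum>i\<in>A. f i) \<in> reach n"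
  by (induction A rule: infinite_finite_induct) (auto intro: reach_add reach_zero)

lemma reach_glop: "i < n \<Longrightarrow> j < n \<Longrightarrow> z \<in> reach n \<Longrightarrow> glop n i j z \<in> reach n"
  unfolding reach_def
  by clarify (metis (no_types, lifting) koszul_diff_glop glop_add glop_lingen kelems_glop)

section \<open>Products of star cycles\<close>

definition xexp :: "nat set \<Rightarrow> nat \<Rightarrow>\<^sub>0 nat" where
  "xexp A = (\<Sum>a\<in>A. unit_exp a)"

text \<open>
  For a set \<open>I\<close> of positions of monomials divisible by \<open>x\<^sub>a\<close> and different from \<open>x\<^sub>a\<^sup>2\<close>, this is the
  boundary of \<open>e\<^sub>a\<^sub>a \<and> e\<^sub>I\<close> divided by \<open>x\<^sub>a\<close>, hence a cycle. It has odd degree in \<open>x\<close>, so only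
  products of two such cycles live over the Veronese ring.
\<close>

definition star :: "nat \<Rightarrow> nat set \<Rightarrow> nat set \<Rightarrow> 'k::field mpoly" where
  "star a I = scal (monomial (unit_exp a)) (ext_basis I) -
     wedge (qidx a a) (\<Sum>k\<in>I. scal (monomial (qexp k - unit_exp a)) (contract k (ext_basis I)))"

text \<open>Positions are read as edges: x_i x_j joins \<open>i\<close> and \<open>j\<close>. The
  loop at \<open>a\<close> is left out because \<open>star\<close> treats e_aa separately.\<close>

definition edges_at :: "nat \<Rightarrow> nat \<Rightarrow> nat set" where
  "edges_at n a = qidx a ` ({..<n} - {a})"

lemma edges_at_subset: "a < n \<Longrightarrow> edges_at n a \<subseteq> {..<triangle n}"
  by (auto simp: edges_at_def qidx_less)

lemma koszul_diff_wedge: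
  assumes "k < length fs"
  shows "koszul_diff fs (wedge k z) = scal (fs ! k) z - wedge k (koszul_diff fs z)"
proof -
  have "scal (fs ! l) (contract l (wedge k z)) =
    (if l = k then scal (fs ! k) z else 0) - wedge k (scal (fs ! l) (contract l z))" for l
    by (cases "l = k") (simp_all add: contract_wedge scal_diff_right)
  then show ?thesis
    using assms by (simp add: koszul_diff_sum wedge_sum sum_subtractf)
qed

lemma monomial_nonzero [simp]: "(monomial m :: 'k::field mpoly) \<noteq> 0"
  by (metis lookup_single_eq lookup_zero zero_neq_one)

lemma star_cycle:
  fixes n :: nat
  defines "fs \<equiv> (quads n :: 'k::field_char_0 mpoly list)"
  assumes "a < n" "I \<subseteq> edges_at n a"
  shows "koszul_diff fs (star a I) = 0"
proof -
  let ?x = "monomial (unit_exp a) :: 'k mpoly"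
  let ?w = "ext_basis I :: nat set \<Rightarrow> 'k mpoly"
  have fin: "finite I" "I \<subseteq> {..<triangle n}" using assms edges_at_subset[of a n] by (auto intro: finite_subset)
  have "koszul_diff fs ?w = (\<Sum>k\<in>I. scal (monomial (qexp k)) (contract k ?w))"
    unfolding fs_def koszul_diff_quads
    by (rule sum.mono_neutral_right) (use fin in \<open>auto simp: contract_def ext_basis_def fun_eq_iff fun_apply scal_def\<close>)
  also have "\<dots> = scal ?x (\<Sum>k\<in>I. scal (monomial (qexp k - unit_exp a)) (contract k ?w))"
    unfolding scal_sum
  proof (intro sum.cong refl)
    fix k assume "k \<in> I"
    then obtain j where "k = qidx a j" using assms(3) by (auto simp: edges_at_def)
    moreover have "unit_exp a + unit_exp j - unit_exp a = unit_exp j"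
      by (rule poly_mapping_eqI) (simp add: lookup_add lookup_minus)
    ultimately show "scal (monomial (qexp k)) (contract k ?w) =
      scal ?x (scal (monomial (qexp k - unit_exp a)) (contract k ?w))"
      by (simp add: mult_single)
  qed
  finally have "koszul_diff fs (wedge (qidx a a) ?w) = scal ?x (star a I)"
    using assms(2) by (simp add: fs_def koszul_diff_wedge qidx_less star_def scal_diff_right quads_def mult_single)
  \<comment> \<open>A boundary is a cycle, and multiplication by x_a is injective, so the factor can
    be cancelled.\<close>
  then have "scal ?x (koszul_diff fs (star a I)) = 0"
    by (metis koszul_diff_scal koszul_diff_sq)
  then show ?thesis
    by (auto simp: scal_def fun_eq_iff fun_apply)
qed

lemma star_ksupp:
  assumes "a < n" "I \<subseteq> edges_at n a"
  shows "star a I \<in> ksupp (\<lambda>K m. K \<subseteq> {..<triangle n} \<and> card K = card I \<and>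
    Poly_Mapping.keys m \<subseteq> {..<n} \<and> monom_degree m = 1)" (is "_ \<in> ksupp ?G")
  unfolding star_def wedge_sum
proof (intro ksupp_diff ksupp_sum)
  have fin: "finite I" "I \<subseteq> {..<triangle n}" using assms edges_at_subset[of a n] by (auto intro: finite_subset)
  show "scal (monomial (unit_exp a)) (ext_basis I) \<in> ksupp ?G"
    by (rule ksupp_scal, rule ksupp_ext_basis[of "\<lambda>K m. K = I \<and> m = 0"]) (use fin assms in auto)
  fix k assume k: "k \<in> I"
  then obtain j where j: "k = qidx a j" "j < n" "j \<noteq> a" using assms(2) by (auto simp: edges_at_def)
  have g: "qexp k - unit_exp a = unit_exp j"
    unfolding j(1) qexp_qidx by (rule poly_mapping_eqI) (simp add: lookup_add lookup_minus)
  have aa: "qidx a a \<notin> I" using assms(2) by (auto simp: edges_at_def qidx_eq)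
  have "ext_basis I \<in> ksupp (\<lambda>K m. K = I \<and> m = 0)" by (rule ksupp_ext_basis) simp
  then have "contract k (ext_basis I) \<in> ksupp (\<lambda>K m. K = I - {k} \<and> m = 0)"
    by (rule ksupp_contract) auto
  then have "scal (monomial (unit_exp j)) (contract k (ext_basis I)) \<in> ksupp (\<lambda>K m. K = I - {k} \<and> m = unit_exp j)"
    by (rule ksupp_scal) auto
  then show "wedge (qidx a a) (scal (monomial (qexp k - unit_exp a)) (contract k (ext_basis I))) \<in> ksupp ?G"
    unfolding g
    by (rule ksupp_wedge) (use fin aa k assms(1) j card_Suc_Diff1[of I k] in \<open>auto simp: qidx_less\<close>)
qed

text \<open>Equality in the quotient by all x_i^2 and e_ii with indices below
  \<open>n\<close>.\<close>

definition inactive_eq :: "nat \<Rightarrow> (nat set \<Rightarrow> 'k::field mpoly) \<Rightarrow> (nat set \<Rightarrow> 'k mpoly) \<Rightarrow> bool" where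
  "inactive_eq n z w \<longleftrightarrow> z - w \<in> ksupp (\<lambda>K m. active n K m \<noteq> {})"

lemma inactive_eq_refl [simp]: "inactive_eq n z z"
  by (simp add: inactive_eq_def)

lemma inactive_eq_trans: "inactive_eq n z w \<Longrightarrow> inactive_eq n w u \<Longrightarrow> inactive_eq n z u"
  unfolding inactive_eq_def using ksupp_add[of "z - w" _ "w - u"] by simp

lemma active_mono: "K \<subseteq> L \<Longrightarrow> active n K m \<subseteq> active n L (m + m')"
  by (auto simp: active_def lookup_add diag_part_def)

lemma active_nonempty_mono:
  assumes "active n K m \<noteq> {}" "K \<subseteq> L"
  shows "active n L (m + m') \<noteq> {}" "active n L (m' + m) \<noteq> {}"
  using active_mono[OF assms(2), of n m m'] assms(1) by (auto simp: add.commute)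

lemma ksupp_True: "z \<in> ksupp (\<lambda>_ _. True)"
  by (simp add: ksupp_def)

lemma inactive_eq_kmult:
  assumes "inactive_eq n z z'" "inactive_eq n w w'"
  shows "inactive_eq n (kmult z w) (kmult z' w')"
proof -
  have "kmult (z - z') w \<in> ksupp (\<lambda>K m. active n K m \<noteq> {})"
    using assms(1) unfolding inactive_eq_def
    by (rule ksupp_kmult[OF _ ksupp_True]) (erule active_nonempty_mono(1), simp)
  moreover have "kmult z' (w - w') \<in> ksupp (\<lambda>K m. active n K m \<noteq> {})"
    by (rule ksupp_kmult[OF ksupp_True assms(2)[unfolded inactive_eq_def]])
      (erule active_nonempty_mono(2), simp)
  ultimately have "kmult (z - z') w + kmult z' (w - w') \<in> ksupp (\<lambda>K m. active n K m \<noteq> {})"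
    by (rule ksupp_add)
  moreover have "kmult (z - z') w + kmult z' (w - w') = kmult z w - kmult z' w'"
    using kmult_add_left[of "z - z'" z' w] kmult_add_right[of z' "w - w'" w'] by (simp add: algebra_simps)
  ultimately show ?thesis by (simp add: inactive_eq_def)
qed

lemma inactive_eq_scal: "inactive_eq n z w \<Longrightarrow> inactive_eq n (scal p z) (scal p w)"
  unfolding inactive_eq_def scal_diff_right[symmetric]
  by (erule ksupp_scal) (erule active_nonempty_mono(2), simp)

lemma inactive_eq_sum:
  "(\<And>i. i \<in> A \<Longrightarrow> inactive_eq n (f i) (g i)) \<Longrightarrow> inactive_eq n (\<Sum>i\<in>A. f i) (\<Sum>i\<in>A. g i)"
  unfolding inactive_eq_def sum_subtractf[symmetric] by (rule ksupp_sum)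

text \<open>All other summands of the star contain e_aa.\<close>

lemma star_inactive_eq:
  assumes "a < n"
  shows "inactive_eq n (star a I) (scal (monomial (unit_exp a)) (ext_basis I))"
proof -
  have "wedge (qidx a a) w \<in> ksupp (\<lambda>K m. active n K m \<noteq> {})" for w :: "nat set \<Rightarrow> 'a mpoly"
    by (rule ksupp_wedge[of _ "\<lambda>_ _. True"]) (use assms in \<open>auto simp: ksupp_def active_def\<close>)
  then show ?thesis unfolding inactive_eq_def star_def
    by (metis (no_types, lifting) add_diff_cancel_left' diff_add_cancel ksupp_uminus minus_diff_eq)
qed

text \<open>Two factors of degree one in x give degree two, so the product lies in the linear strand
  over the Veronese ring.\<close>

lemma star_product:
  fixes n :: nat
  assumes "a < n" "I \<subseteq> edges_at n a" "b < n" "J \<subseteq> edges_at n b"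
  shows "kmult (star a I) (star b J) \<in> linear_cycles n (quads n :: 'k::field_char_0 mpoly list)"
proof -
  have "kmult (star a I) (star b J) \<in> ksupp (\<lambda>K m. K \<subseteq> {..<triangle n} \<and> card K = card I + card J \<and>
    Poly_Mapping.keys m \<subseteq> {..<n} \<and> monom_degree m = 2)"
    by (rule ksupp_kmult[OF star_ksupp[OF assms(1,2)] star_ksupp[OF assms(3,4)]])
      (auto simp: card_Un_disjoint keys_add_nat)
  then show ?thesis
    unfolding linear_cycles_def by (auto simp: koszul_diff_kmult star_cycle assms)
qed

lemma sign_square: "(wedge_sign I J :: 'r::comm_ring_1) = 1 \<or> (wedge_sign I J :: 'r) = - 1"
  by (simp add: wedge_sign_def minus_one_power_iff)

lemma lingen_sign:
  assumes "s = 1 \<or> s = - 1" "q \<in> lingen n fs"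
  shows "scal s q \<in> lingen n fs"
proof -
  have "- 1 = const_poly (- 1 :: 'a)" by (simp add: const_poly_def single_uminus)
  then show ?thesis using assms lingen_scal[of q n fs "- 1"] by auto
qed

text \<open>Each edge in \<open>I\<close> is assigned to one of its ends in \<open>A\<close>. The
  induction removes two elements of \<open>A\<close> with their edges; the product of their stars is
  one linear cycle, and modulo active terms the stars multiply like the terms x_a e_I, up to
  sign.\<close>

lemma product_realization:
  fixes n :: nat
  assumes "finite A" "even (card A)" "A \<subseteq> {..<n}" "I \<subseteq> (\<Union>a\<in>A. edges_at n a)"
  shows "\<exists>q\<in>lingen n (quads n :: 'k::field_char_0 mpoly list).
    inactive_eq n q (scal (monomial (xexp A)) (ext_basis I))"
  using assms
proof (induction "card A" arbitrary: A I rule: less_induct)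
  case less
  show ?case
  proof (cases "A = {}")
    case True
    then have "scal (monomial (xexp A)) (ext_basis I) = scal (const_poly 1) (ext_basis {} :: nat set \<Rightarrow> 'k mpoly)"
      using less.prems by (simp add: xexp_def)
    then show ?thesis by (metis inactive_eq_refl lingen.scalar)
  next
    case False
    then obtain a where a: "a \<in> A" by blast
    have "A - {a} \<noteq> {}"
    proof
      assume "A - {a} = {}"
      then have "A = {a}" using a by auto
      then show False using less.prems(2) by simp
    qed
    then obtain b where b: "b \<in> A" "b \<noteq> a" by blast
    define A' where "A' = A - {a, b}"
    have A: "A = insert a (insert b A')" "a \<notin> insert b A'" "b \<notin> A'" "finite A'"
      using a b less.prems(1) by (auto simp: A'_def)
    then have card: "card A = Suc (Suc (card A'))" by simp
    \<comment> \<open>An edge joining \<open>a\<close> and \<open>b\<close> goes to \<open>a\<close>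
      alone, which keeps the three sets disjoint.\<close>
    define Ia where "Ia = I \<inter> edges_at n a"
    define Ib where "Ib = (I - Ia) \<inter> edges_at n b"
    define I' where "I' = I - Ia - Ib"
    have "I' \<subseteq> (\<Union>a\<in>A'. edges_at n a)" using less.prems(4) A by (auto simp: I'_def Ia_def Ib_def)
    then obtain q where q: "q \<in> lingen n (quads n :: 'k mpoly list)"
      "inactive_eq n q (scal (monomial (xexp A')) (ext_basis I'))"
      using less.hyps[of A' I'] less.prems A card by auto
    have ab: "a < n" "b < n" "Ia \<subseteq> edges_at n a" "Ib \<subseteq> edges_at n b"
      using less.prems(3) a b by (auto simp: Ia_def Ib_def)
    have fin: "finite Ia" "finite Ib" "finite I'"
    proof -
      have "finite I" using less.prems edges_at_subset
        by (metis (no_types, lifting) UN_least finite_lessThan finite_subset lessThan_iff subsetD)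
      then show "finite Ia" "finite Ib" "finite I'" by (auto simp: Ia_def Ib_def I'_def)
    qed
    define s :: "'k mpoly" where "s = wedge_sign Ia Ib * wedge_sign (Ia \<union> Ib) I'"
    have s: "s = 1 \<or> s = - 1"
      using sign_square[of Ia Ib, where 'r="'k mpoly"] sign_square[of "Ia \<union> Ib" I', where 'r="'k mpoly"]
      by (auto simp: s_def)
    let ?p = "kmult (kmult (star a Ia) (star b Ib)) q"
    have "inactive_eq n ?p (kmult (kmult (scal (monomial (unit_exp a)) (ext_basis Ia))
      (scal (monomial (unit_exp b)) (ext_basis Ib))) (scal (monomial (xexp A')) (ext_basis I')))"
      using ab q by (intro inactive_eq_kmult star_inactive_eq)
    also have "kmult (kmult (scal (monomial (unit_exp a)) (ext_basis Ia))
      (scal (monomial (unit_exp b)) (ext_basis Ib))) (scal (monomial (xexp A')) (ext_basis I')) =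
      scal s (scal (monomial (xexp A)) (ext_basis I))"
    proof -
      have "Ia \<inter> Ib = {}" "(Ia \<union> Ib) \<inter> I' = {}" "Ia \<union> Ib \<union> I' = I"
        by (auto simp: Ia_def Ib_def I'_def)
      moreover have "monomial (xexp A) = monomial (unit_exp a) * monomial (unit_exp b) * (monomial (xexp A') :: 'k mpoly)"
        using A by (simp add: xexp_def mult_single add.assoc)
      ultimately show ?thesis using fin
        by (simp add: kmult_scal_left kmult_scal_right kmult_ext_basis s_def mult_ac del: mult_single)
    qed
    finally have "inactive_eq n (scal s ?p) (scal s (scal s (scal (monomial (xexp A)) (ext_basis I))))"
      by (rule inactive_eq_scal)
    moreover have "scal s (scal s z) = z" for z :: "nat set \<Rightarrow> 'k mpoly" using s by auto
    moreover have "scal s ?p \<in> lingen n (quads n)"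
      by (rule lingen_sign[OF s], rule lingen.mult[OF lingen.linear[OF star_product[OF ab(1,3) ab(2,4)]] q(1)])
    ultimately show ?thesis by metis
  qed
qed

section \<open>Nested neighbourhoods\<close>

text \<open>
  Summing \<open>card (N i) - card (N j) \<le> card (N i - N j)\<close> over all pairs gives an inequality between
  the two sides of \<open>eq\<close>; the lemma is its equality case.
\<close>

lemma nested_neighbourhoods:
  fixes M :: "nat \<Rightarrow> nat \<Rightarrow> bool" and n :: nat
  defines "N \<equiv> \<lambda>i. {j. j < n \<and> M i j}"
  assumes sym: "\<And>i j. M i j = M j i"
    and eq: "(\<Sum>i<n. int (card (N i)) ^ 2) + (\<Sum>i<n. \<Sum>j<n. int (card (N i) - card (N j))) =
      int n * (\<Sum>i<n. int (card (N i)))"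
    and ij: "i < n" "j < n"
  shows "card (N i - N j) = card (N i) - card (N j)"
proof -
  have fin: "finite (N i)" for i by (simp add: N_def)
  have ind: "int (card (N i \<inter> N j)) = (\<Sum>k<n. of_bool (M i k) * of_bool (M k j))" for i j
  proof -
    have "N i \<inter> N j = {k \<in> {..<n}. M i k \<and> M k j}" using sym by (auto simp: N_def)
    then show ?thesis by (simp add: sum.If_cases Int_def flip: of_bool_conj)
  qed
  have cardN: "int (card (N k)) = (\<Sum>i<n. of_bool (M i k))" for k
  proof -
    have "N k = {i \<in> {..<n}. M i k}" using sym by (auto simp: N_def)
    then show ?thesis by (simp add: of_bool_def sum.If_cases Int_def)
  qed
  \<comment> \<open>Walks i, k, j are counted by their middle vertex; \<open>k\<close> is the middle
    of \<open>card (N k)\<close> squared of them.\<close>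
  have "(\<Sum>i<n. \<Sum>j<n. int (card (N i \<inter> N j))) = (\<Sum>i<n. \<Sum>k<n. \<Sum>j<n. of_bool (M i k) * of_bool (M k j))"
    unfolding ind by (intro sum.cong refl sum.swap)
  also have "\<dots> = (\<Sum>k<n. \<Sum>i<n. \<Sum>j<n. of_bool (M i k) * of_bool (M k j))"
    by (rule sum.swap)
  also have "\<dots> = (\<Sum>k<n. (\<Sum>i<n. of_bool (M i k)) * (\<Sum>j<n. of_bool (M j k)))"
    unfolding sum_product using sym by simp
  also have "\<dots> = (\<Sum>k<n. int (card (N k)) ^ 2)"
    unfolding cardN power2_eq_square ..
  finally have sq: "(\<Sum>i<n. \<Sum>j<n. int (card (N i \<inter> N j))) = (\<Sum>k<n. int (card (N k)) ^ 2)" .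
  have le: "card (N i \<inter> N j) \<le> card (N i)" "card (N i \<inter> N j) \<le> card (N j)" for i j
    by (intro card_mono fin; blast)+
  have diff: "int (card (N i - N j)) = int (card (N i)) - int (card (N i \<inter> N j))" for i j
    using card_Diff_subset_Int[of "N i" "N j"] fin le(1)[of i j] by (simp add: of_nat_diff)
  have "(\<Sum>p\<in>{..<n} \<times> {..<n}. int (card (N (fst p)) - card (N (snd p)))) =
    (\<Sum>p\<in>{..<n} \<times> {..<n}. int (card (N (fst p) - N (snd p))))"
    using eq unfolding sum.cartesian_product' fst_conv snd_conv diff sum_subtractf sq by (simp add: sum_distrib_left)
  moreover have "int (card (N i) - card (N j)) \<le> int (card (N i - N j))" for i j
    using diff[of i j] le(2)[of i j] by linarith
  ultimately have "int (card (N (fst (i, j))) - card (N (snd (i, j)))) = int (card (N (fst (i, j)) - N (snd (i, j))))"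
    using ij by - (rule sum_mono_inv[where I = "{..<n} \<times> {..<n}"], auto)
  then show ?thesis by simp
qed

section \<open>Weights\<close>

text \<open>The exterior part of the multidegree: a generator has the multidegree of its monomial,
  which makes the differential homogeneous.\<close>

definition kwt :: "nat set \<Rightarrow> nat \<Rightarrow>\<^sub>0 nat" where
  "kwt K = (\<Sum>q\<in>K. qexp q)"

lemma kwt_insert: "finite K \<Longrightarrow> q \<notin> K \<Longrightarrow> kwt (insert q K) = qexp q + kwt K"
  by (simp add: kwt_def)

definition weight_space :: "nat \<Rightarrow> (nat \<Rightarrow>\<^sub>0 nat) \<Rightarrow> (nat set \<Rightarrow> 'k::field mpoly) set" where
  "weight_space n \<mu> = ksupp (\<lambda>K m. K \<subseteq> {..<triangle n} \<and> even_exp n m \<and> m + kwt K = \<mu>)"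

lemma weight_space_kelems: "z \<in> weight_space n \<mu> \<Longrightarrow> z \<in> kelems n (triangle n)"
  unfolding weight_space_def kelems_def by (erule ksupp_mono) auto

text \<open>The degree of vertex \<open>i\<close> in the graph with edge set \<open>K\<close>, a
  loop counting twice.\<close>

lemma lookup_kwt:
  assumes "K \<subseteq> {..<triangle n}" "i < n"
  shows "Poly_Mapping.lookup (kwt K) i =
    (\<Sum>k<n. if qidx i k \<in> K then if i = k then 2 else 1 else 0)"
proof -
  have "finite K" using assms(1) by (rule finite_subset) simp
  then show ?thesis using assms(1)
  proof (induction K rule: finite_induct)
    case empty
    show ?case by (simp add: kwt_def)
  next
    case (insert q K)
    obtain a b where ab: "a < n" "b < n" "q = qidx a b"
      using insert.prems qidx_exists by blast
    have "(\<Sum>k<n. if qidx i k \<in> insert q K then if i = k then 2 else 1 else 0) =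
      (\<Sum>k<n. (if qidx i k = q then if i = k then 2 else 1 else 0) +
        (if qidx i k \<in> K then if i = k then 2 else (1::nat) else 0))"
      by (intro sum.cong refl) (use insert.hyps in auto)
    also have "\<dots> = (\<Sum>k<n. if qidx i k = q then if i = k then 2 else 1 else 0) + Poly_Mapping.lookup (kwt K) i"
      using insert by (simp add: sum.distrib)
    also have "(\<Sum>k<n. if qidx i k = q then if i = k then 2 else 1 else 0) =
      (\<Sum>k<n. (if k = b then if i = a then 1 else 0 else 0) + (if k = a then if i = b then 1 else 0 else (0::nat)))"
      by (intro sum.cong refl) (auto simp: ab qidx_eq)
    also have "\<dots> = Poly_Mapping.lookup (qexp q) i"
      using ab by (auto simp: sum.distrib lookup_add lookup_single when_def)
    finally show ?case using insert by (simp add: kwt_insert lookup_add)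
  qed
qed

lemma lookup_euler: "Poly_Mapping.lookup (monomial (unit_exp i) * pderiv i p) m =
   of_nat (Poly_Mapping.lookup m i) * Poly_Mapping.lookup p m"
proof (rule additive_eqI[of "\<lambda>p. Poly_Mapping.lookup (monomial (unit_exp i) * pderiv i p) m"])
  fix m' :: "nat \<Rightarrow>\<^sub>0 nat" and v :: 'a
  have "unit_exp i + (m' - unit_exp i) = m'" if "Poly_Mapping.lookup m' i \<noteq> 0"
    using that by (intro exp_add_minus[of _ i]) (auto simp: lookup_single)
  then show "Poly_Mapping.lookup (monomial (unit_exp i) * pderiv i (Poly_Mapping.single m' v)) m =
    of_nat (Poly_Mapping.lookup m i) * Poly_Mapping.lookup (Poly_Mapping.single m' v) m"
    by (cases "Poly_Mapping.lookup m' i = 0") (auto simp: pderiv_single mult_single lookup_single when_def)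
qed (simp_all add: distrib_left lookup_add)

lemma wedge_contract_same: "wedge q (contract q z) K = (if q \<in> K then z K else 0)"
  by (auto simp: wedge_def contract_def insert_absorb)

lemma lookup_const_mult: "Poly_Mapping.lookup (const_poly c * p) m = c * Poly_Mapping.lookup p m"
  by (rule additive_eqI[of "\<lambda>p. Poly_Mapping.lookup (const_poly c * p) m"])
    (auto simp: distrib_left lookup_add lookup_single when_def)

text \<open>E_ii is the Euler operator of x_i on coefficients plus a count of the generators
  divisible by x_i, with e_ii counted twice. Together they read off the weight at
  \<open>i\<close>.\<close>

lemma glop_weight:
  assumes "i < n" "z \<in> weight_space n \<mu>"
  shows "glop n i i z = scal (const_poly (of_nat (Poly_Mapping.lookup \<mu> i))) z"
proof (rule kelem_eqI)
  fix K m
  let ?c = "\<lambda>k. if qidx i k \<in> K then if i = k then 2 else (1::nat) else 0"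
  have w: "wedge (qidx i k) (contract2 i k z) K = of_nat (?c k) * z K" for k
    using wedge_contract_same[of "qidx i k" z K] by (auto simp: contract2_def fun_apply)
  have "Poly_Mapping.lookup (glop n i i z K) m =
    of_nat (Poly_Mapping.lookup m i) * Poly_Mapping.lookup (z K) m +
    Poly_Mapping.lookup (of_nat (\<Sum>k<n. ?c k) * z K) m"
    unfolding of_nat_sum sum_distrib_right w[symmetric]
    by (simp only: glop_def fun_apply scal_def ptw_def lookup_add lookup_euler)
  also have "of_nat (\<Sum>k<n. ?c k) * z K = const_poly (of_nat (\<Sum>k<n. ?c k)) * z K"
    by (simp only: const_poly_def single_of_nat)
  finally have g: "Poly_Mapping.lookup (glop n i i z K) m =
    of_nat (Poly_Mapping.lookup m i + (\<Sum>k<n. ?c k)) * Poly_Mapping.lookup (z K) m"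
    by (simp only: lookup_const_mult of_nat_add distrib_right)
  show "Poly_Mapping.lookup (glop n i i z K) m =
    Poly_Mapping.lookup (scal (const_poly (of_nat (Poly_Mapping.lookup \<mu> i))) z K) m"
  proof (cases "m \<in> Poly_Mapping.keys (z K)")
    case True
    then have "K \<subseteq> {..<triangle n}" "m + kwt K = \<mu>"
      using assms(2) by (auto simp: weight_space_def dest: ksuppD)
    then have "Poly_Mapping.lookup m i + (\<Sum>k<n. ?c k) = Poly_Mapping.lookup \<mu> i"
      using lookup_kwt[OF _ assms(1), of K] by (auto simp: lookup_add)
    then show ?thesis unfolding g by (simp only: scal_def lookup_const_mult)
  next
    case False
    then have "Poly_Mapping.lookup (z K) m = 0" by (simp add: in_keys_iff)
    then show ?thesis unfolding g by (simp only: scal_def lookup_const_mult mult_zero_right)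
  qed
qed

lemma glop_weight_space:
  assumes "i < n" "j < n" "z \<in> weight_space n \<mu>"
  shows "glop n i j z \<in> ksupp (\<lambda>K m. K \<subseteq> {..<triangle n} \<and> even_exp n m \<and> m + kwt K + unit_exp j = \<mu> + unit_exp i)"
  using assms(3) unfolding weight_space_def
proof (rule ksupp_glop)
  show "K \<subseteq> {..<triangle n} \<and> even_exp n (unit_exp i + m) \<and>
       unit_exp i + m + kwt K + unit_exp j = \<mu> + unit_exp i"
    if "K \<subseteq> {..<triangle n} \<and> even_exp n (m + unit_exp j) \<and> m + unit_exp j + kwt K = \<mu>" for K m
    using that assms by (auto simp: even_exp_def keys_add_nat add_ac)
next
  fix K m k
  assume *: "k < n" "qidx j k \<notin> K" "qidx i k \<notin> K"
    "insert (qidx j k) K \<subseteq> {..<triangle n} \<and> even_exp n m \<and> m + kwt (insert (qidx j k) K) = \<mu>"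
  then have "finite K" by (auto intro: finite_subset)
  then show "insert (qidx i k) K \<subseteq> {..<triangle n} \<and> even_exp n m \<and>
      m + kwt (insert (qidx i k) K) + unit_exp j = \<mu> + unit_exp i"
    using * assms by (auto simp: kwt_insert qidx_less add_ac)
qed

text \<open>The distance of sum mu_i^2 to its bound, which decreases when that sum grows. The
  truncated subtraction is exact by \<open>sum_squares_le\<close>.\<close>

definition weight_gap :: "nat \<Rightarrow> (nat \<Rightarrow>\<^sub>0 nat) \<Rightarrow> nat" where
  "weight_gap n \<mu> = (\<Sum>i<n. Poly_Mapping.lookup \<mu> i)\<^sup>2 - (\<Sum>i<n. (Poly_Mapping.lookup \<mu> i)\<^sup>2)"

lemma sum_squares_le: "(\<Sum>i\<in>A. (f i :: nat)\<^sup>2) \<le> (\<Sum>i\<in>A. f i)\<^sup>2"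
  by (induction A rule: infinite_finite_induct) (auto simp: power2_sum intro: le_trans)

text \<open>Moving a unit from \<open>j\<close> to \<open>i\<close> keeps the total and adds 2 (mu_i
  - mu_j) + 2 to the sum of squares.\<close>

lemma weight_gap_less:
  assumes "i < n" "j < n" "i \<noteq> j" "Poly_Mapping.lookup \<mu> j \<le> Poly_Mapping.lookup \<mu> i"
    and \<nu>: "\<nu> + unit_exp j = \<mu> + unit_exp i"
  shows "weight_gap n \<nu> < weight_gap n \<mu>"
proof -
  let ?m = "Poly_Mapping.lookup \<mu>" and ?v = "Poly_Mapping.lookup \<nu>"
  have v: "?v k + (if k = j then 1 else 0) = ?m k + (if k = i then 1 else 0)" for k
    using arg_cong[OF \<nu>, of "\<lambda>x. Poly_Mapping.lookup x k"] by (auto simp: lookup_add lookup_single when_def)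
  have split: "(\<Sum>k<n. f k) = f i + f j + (\<Sum>k\<in>{..<n} - {i, j}. f k)" for f :: "nat \<Rightarrow> nat"
  proof -
    have "{..<n} = insert i (insert j ({..<n} - {i, j}))" using assms by auto
    then show ?thesis using assms by (metis (no_types, lifting) Diff_iff add.assoc finite_Diff finite_insert
        finite_lessThan insertCI insertE sum.insert)
  qed
  have vi: "?v i = ?m i + 1" "?m j = ?v j + 1" using v[of i] v[of j] assms by auto
  have rest: "(\<Sum>k\<in>{..<n} - {i, j}. g (?v k)) = (\<Sum>k\<in>{..<n} - {i, j}. g (?m k))" for g :: "nat \<Rightarrow> nat"
  proof (intro sum.cong refl)
    fix k assume "k \<in> {..<n} - {i, j}"
    then show "g (?v k) = g (?m k)" using v[of k] by auto
  qed
  have "(\<Sum>k<n. ?v k) = (\<Sum>k<n. ?m k)"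
    unfolding split[of ?v] split[of ?m] using rest[of "\<lambda>x. x"] vi by simp
  moreover have "(\<Sum>k<n. (?m k)\<^sup>2) < (\<Sum>k<n. (?v k)\<^sup>2)"
    unfolding split[of "\<lambda>k. (?v k)\<^sup>2"] split[of "\<lambda>k. (?m k)\<^sup>2"] rest[of "\<lambda>x. x\<^sup>2"] vi
    using assms(4) vi by (simp add: power2_eq_square algebra_simps)
  moreover have "(\<Sum>k<n. (?v k)\<^sup>2) \<le> (\<Sum>k<n. ?v k)\<^sup>2" by (rule sum_squares_le)
  ultimately show ?thesis unfolding weight_gap_def by simp
qed

text \<open>The scalar by which the Laplacian acts on a highest weight vector of weight \<open>\<mu>\<close>.\<close>

definition casimir_value :: "nat \<Rightarrow> (nat \<Rightarrow>\<^sub>0 nat) \<Rightarrow> int" where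
  "casimir_value n \<mu> = (\<Sum>i<n. int (Poly_Mapping.lookup \<mu> i) ^ 2) +
     (\<Sum>i<n. \<Sum>j<n. int (Poly_Mapping.lookup \<mu> i - Poly_Mapping.lookup \<mu> j)) -
     int n * (\<Sum>i<n. int (Poly_Mapping.lookup \<mu> i))"

lemma inactive_monomial:
  assumes K: "K \<subseteq> {..<triangle n}" and m: "even_exp n m" and "active n K m = {}"
    and "casimir_value n (m + kwt K) = 0"
  obtains A where "A \<subseteq> {..<n}" "even (card A)" "m = xexp A" "K \<subseteq> (\<Union>a\<in>A. edges_at n a)"
proof -
  define A where "A = Poly_Mapping.keys m"
  have A: "A \<subseteq> {..<n}" "even (monom_degree m)" using m by (auto simp: even_exp_def A_def)
  then have fin: "finite A" using finite_subset by blast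
  have m1: "Poly_Mapping.lookup m i = of_bool (i \<in> A)" for i
  proof (cases "i \<in> A")
    case True
    then have "i < n" "Poly_Mapping.lookup m i \<noteq> 0"
      using subsetD[OF A(1)] by (auto simp: A_def in_keys_iff)
    moreover from this have "\<not> 2 \<le> Poly_Mapping.lookup m i"
      using assms(3) by (auto simp: active_def)
    ultimately have "Poly_Mapping.lookup m i = 1" by linarith
    then show ?thesis using True by simp
  qed (simp add: A_def in_keys_iff)
  have mA: "m = xexp A"
    by (rule poly_mapping_eqI) (simp add: m1 xexp_def lookup_sum lookup_single when_def fin)
  have "monom_degree m = (\<Sum>i\<in>A. Poly_Mapping.lookup m i)"
    by (simp add: monom_degree_def A_def)
  then have cardA: "even (card A)" using A(2) by (simp add: m1)
  have nodiag: "qidx i i \<notin> K" for i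
  proof
    assume "qidx i i \<in> K"
    moreover from this have "i < n" using K qidx_less by blast
    ultimately show False using assms(3) by (auto simp: active_def diag_part_def)
  qed
  \<comment> \<open>The symmetric matrix of the term: the exponents on the diagonal, the edges off
    it. Its row sums are the weight because inactivity excludes loops and exponents above 1.\<close>
  define M where "M i j \<longleftrightarrow> (if i = j then i \<in> A else qidx i j \<in> K)" for i j
  define N where "N i = {j. j < n \<and> M i j}" for i
  have cN: "card (N i) = Poly_Mapping.lookup (m + kwt K) i" if "i < n" for i
  proof -
    have "Poly_Mapping.lookup (m + kwt K) i = of_bool (i \<in> A) +
      (\<Sum>k<n. if qidx i k \<in> K then if i = k then 2 else 1 else 0)"
      by (simp add: lookup_add m1 lookup_kwt[OF K that])
    also have "\<dots> = (\<Sum>k<n. (if k = i then of_bool (i \<in> A) else 0) + (if qidx i k \<in> K then if i = k then 2 else 1 else 0))"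
      using that by (simp add: sum.distrib)
    also have "\<dots> = (\<Sum>k<n. if M i k then 1 else 0)"
      by (intro sum.cong refl) (use nodiag in \<open>auto simp: M_def\<close>)
    also have "\<dots> = card (N i)"
      by (simp add: sum.If_cases N_def Int_def)
    finally show ?thesis ..
  qed
  have nested: "card (N i - N j) = card (N i) - card (N j)" if "i < n" "j < n" for i j
    unfolding N_def
  proof (rule nested_neighbourhoods)
    show "M i j = M j i" for i j by (auto simp: M_def qidx_sym)
    show "(\<Sum>i<n. int (card {j. j < n \<and> M i j}) ^ 2) +
      (\<Sum>i<n. \<Sum>j<n. int (card {j. j < n \<and> M i j} - card {ja. ja < n \<and> M j ja})) =
      int n * (\<Sum>i<n. int (card {j. j < n \<and> M i j}))"
      using assms(4) cN unfolding casimir_value_def N_def by (simp cong: sum.cong_simp)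
  qed (use that in auto)
  \<comment> \<open>Let \<open>j\<close> be the end with the larger row. Nestedness puts row
    \<open>i\<close> inside row \<open>j\<close>; as \<open>j\<close> lies in row \<open>i\<close>,
    it lies in its own row, that is, x_j divides the monomial.\<close>
  have touch: "j \<in> A" if "i < n" "j < n" "qidx i j \<in> K" "i \<noteq> j" "card (N i) \<le> card (N j)" for i j
  proof -
    have "finite (N i - N j)" by (simp add: N_def)
    then have "N i \<subseteq> N j" using nested[of i j] that by auto
    moreover have "j \<in> N i" using that by (auto simp: N_def M_def)
    ultimately show ?thesis by (auto simp: N_def M_def)
  qed
  have "K \<subseteq> (\<Union>a\<in>A. edges_at n a)"
  proof
    fix q assume q: "q \<in> K"
    then obtain i j where ij: "i < n" "j < n" "q = qidx i j" using K qidx_exists by blast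
    then have "i \<noteq> j" using nodiag q by auto
    then have "q \<in> edges_at n i" "q \<in> edges_at n j"
      unfolding edges_at_def using ij \<open>i \<noteq> j\<close> qidx_sym[of i j] by (blast, force)
    moreover have "i \<in> A \<or> j \<in> A"
    proof -
      have "qidx i j \<in> K" "qidx j i \<in> K" using q ij(3) qidx_sym[of i j] by simp_all
      then show ?thesis using touch[of i j] touch[of j i] ij \<open>i \<noteq> j\<close> by linarith
    qed
    ultimately show "q \<in> (\<Union>a\<in>A. edges_at n a)" by blast
  qed
  then show thesis using that A(1) cardA mA by blast
qed

lemma weight_cycle_casimir_zero:
  fixes z :: "nat set \<Rightarrow> 'k::field_char_0 mpoly"
  assumes z: "z \<in> weight_space n \<mu>" "koszul_diff (quads n) z = 0"
    and "casimir_value n \<mu> = 0"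
  shows "z \<in> reach n"
proof -
  \<comment> \<open>Within one weight \<open>K\<close> determines the exponent, so each coefficient
    of \<open>z\<close> is a single term.\<close>
  define mK where "mK K = \<mu> - kwt K" for K
  have key: "m = mK K \<and> K \<subseteq> {..<triangle n} \<and> even_exp n m \<and> m + kwt K = \<mu>" if "m \<in> Poly_Mapping.keys (z K)" for K m
    using z(1) that by (auto simp: weight_space_def mK_def dest: ksuppD)
  define c where "c K = Poly_Mapping.lookup (z K) (mK K)" for K
  define S where "S = {K. z K \<noteq> 0 \<and> active n K (mK K) = {}}"
  have nonzero: "\<exists>m. m \<in> Poly_Mapping.keys p" if "p \<noteq> 0" for p :: "'k mpoly"
    using that by (metis in_keys_iff lookup_zero poly_mapping_eqI)
  have "S \<subseteq> Pow {..<triangle n}"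
  proof
    fix K assume "K \<in> S"
    then obtain m where "m \<in> Poly_Mapping.keys (z K)" using nonzero by (auto simp: S_def)
    then show "K \<in> Pow {..<triangle n}" using key by blast
  qed
  then have finS: "finite S" by (rule finite_subset) simp
  have "\<exists>q\<in>lingen n (quads n :: 'k mpoly list). inactive_eq n q (scal (monomial (mK K)) (ext_basis K))" if KS: "K \<in> S" for K
  proof -
    obtain m where "m \<in> Poly_Mapping.keys (z K)" using KS nonzero by (auto simp: S_def)
    then have "K \<subseteq> {..<triangle n}" "even_exp n (mK K)" "mK K + kwt K = \<mu>" using key by blast+
    then obtain A where A: "A \<subseteq> {..<n}" "even (card A)" "mK K = xexp A" "K \<subseteq> (\<Union>a\<in>A. edges_at n a)"
      using KS assms(3) by (auto simp: S_def elim: inactive_monomial)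
    then have "finite A" using finite_subset by blast
    then show ?thesis using product_realization[OF _ A(2,1,4)] A(3) by auto
  qed
  then obtain q where q: "\<And>K. K \<in> S \<Longrightarrow> q K \<in> lingen n (quads n :: 'k mpoly list)"
    "\<And>K. K \<in> S \<Longrightarrow> inactive_eq n (q K) (scal (monomial (mK K)) (ext_basis K))" by metis
  \<comment> \<open>A lift of the inactive part of \<open>z\<close> to the subalgebra. Then
    \<open>z - p\<close> is a cycle with active terms only, hence a boundary.\<close>
  define p where "p = (\<Sum>K\<in>S. scal (const_poly (c K)) (q K))"
  have p: "p \<in> lingen n (quads n)" unfolding p_def by (intro lingen_sum lingen_scal q)
  let ?z0 = "\<Sum>K\<in>S. scal (const_poly (c K)) (scal (monomial (mK K)) (ext_basis K))"
  have z0: "?z0 L = (if L \<in> S then Poly_Mapping.single (mK L) (c L) else 0)" for L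
  proof -
    have "?z0 L = (\<Sum>K\<in>S. if K = L then Poly_Mapping.single (mK L) (c L) else 0)"
      unfolding sum_fun_apply by (intro sum.cong refl) (auto simp: scal_def ext_basis_def)
    then show ?thesis using finS by simp
  qed
  have zS: "z K = Poly_Mapping.single (mK K) (c K)" for K
  proof (rule poly_mapping_eqI)
    fix m
    show "Poly_Mapping.lookup (z K) m = Poly_Mapping.lookup (Poly_Mapping.single (mK K) (c K)) m"
      using key[of m K] by (auto simp: c_def lookup_single when_def in_keys_iff)
  qed
  have "inactive_eq n z ?z0"
    unfolding inactive_eq_def ksupp_def
  proof (intro CollectI allI ballI)
    fix K m assume m: "m \<in> Poly_Mapping.keys ((z - ?z0) K)"
    have "(z - ?z0) K = (if K \<in> S then 0 else z K)"
      unfolding minus_apply z0 using zS[of K] by simp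
    with m have K: "K \<notin> S" "m \<in> Poly_Mapping.keys (z K)" by (auto split: if_splits)
    then have "z K \<noteq> 0" by auto
    moreover have "m = mK K" using key[OF K(2)] by blast
    ultimately show "active n K m \<noteq> {}" using K(1) by (auto simp: S_def)
  qed
  moreover have "inactive_eq n ?z0 p"
    unfolding p_def
  proof (intro inactive_eq_sum inactive_eq_scal)
    fix K assume "K \<in> S"
    then have "- (q K - scal (monomial (mK K)) (ext_basis K)) \<in> ksupp (\<lambda>K m. active n K m \<noteq> {})"
      using q(2) unfolding inactive_eq_def by (intro ksupp_uminus)
    then show "inactive_eq n (scal (monomial (mK K)) (ext_basis K)) (q K)"
      unfolding inactive_eq_def by simp
  qed
  ultimately have "z - p \<in> ksupp (\<lambda>K m. active n K m \<noteq> {})"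
    using inactive_eq_trans inactive_eq_def by blast
  moreover have "z - p \<in> kelems n (triangle n)"
    using weight_space_kelems[OF z(1)] lingen_kelems[OF p] by (auto intro: kelems_simps)
  moreover have "koszul_diff (quads n) (z - p) = 0"
    using z(2) lingen_cycle[OF p] by (simp add: koszul_diff_minus)
  ultimately obtain b where b: "b \<in> kelems n (triangle n)" "z - p = koszul_diff (quads n) b"
    by (metis active_cycle_boundary)
  then have "z = p + koszul_diff (quads n) b" by (simp add: algebra_simps)
  then show ?thesis using reachI[OF p b(1)] by simp
qed

lemma weight_cycle_reach:
  fixes z :: "nat set \<Rightarrow> 'k::field_char_0 mpoly"
  assumes "z \<in> weight_space n \<mu>" "koszul_diff (quads n) z = 0"
  shows "z \<in> reach n"
  using assms
proof (induction "weight_gap n \<mu>" arbitrary: \<mu> z rule: less_induct)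
  case less
  let ?\<mu> = "Poly_Mapping.lookup \<mu>"
  let ?s = "\<lambda>c. scal (const_poly (of_int c :: 'k)) z"
  have s_add: "?s (a + b) = ?s a + ?s b" for a b
    by (simp add: scal_add_left)
  have s_sum: "?s (\<Sum>i\<in>A. f i) = (\<Sum>i\<in>A. ?s (f i))" for A and f :: "nat \<Rightarrow> int"
    by (rule additive_sum[of ?s]) (rule s_add)
  have eig: "glop n i i z = ?s (int (?\<mu> i))" if "i < n" for i
    using glop_weight[OF that less.prems(1)] by simp
  \<comment> \<open>E_ij moves a unit of weight from \<open>j\<close> to \<open>i\<close>, so the
    induction hypothesis applies. If mu_j = 0, there is no such weight and the image is
    zero.\<close>
  have raise: "glop n i j z \<in> reach n" if ij: "i < n" "j < n" "i \<noteq> j" "?\<mu> j \<le> ?\<mu> i" for i j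
  proof (cases "?\<mu> j = 0")
    case True
    have "\<not> m + kwt K + unit_exp j = \<mu> + unit_exp i" for m K
    proof
      assume "m + kwt K + unit_exp j = \<mu> + unit_exp i"
      from arg_cong[OF this, of "\<lambda>x. Poly_Mapping.lookup x j"] show False
        using True ij by (simp add: lookup_add lookup_single)
    qed
    then have "glop n i j z = 0"
      using glop_weight_space[OF ij(1,2) less.prems(1)] by (auto simp: ksupp_def fun_eq_iff fun_apply)
    then show ?thesis using reach_zero by simp
  next
    case False
    define \<nu> where "\<nu> = \<mu> + unit_exp i - unit_exp j"
    have \<nu>: "\<nu> + unit_exp j = \<mu> + unit_exp i"
      unfolding \<nu>_def using False by (intro exp_add_minus[of _ j]) (auto simp: lookup_single lookup_add)
    have "glop n i j z \<in> weight_space n \<nu>"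
      unfolding weight_space_def using glop_weight_space[OF ij(1,2) less.prems(1)]
      by (rule ksupp_mono) (simp only: \<nu>[symmetric] add_right_cancel)
    moreover have "koszul_diff (quads n) (glop n i j z) = 0"
      using less.prems(2) by (simp add: koszul_diff_glop ij)
    ultimately show ?thesis
      using less.hyps[OF weight_gap_less[OF ij \<nu>]] by blast
  qed
  \<comment> \<open>The contribution of the pair to f(mu); truncated subtraction of naturals is the
    positive part.\<close>
  define e where "e i j = (if i = j then int (?\<mu> i) ^ 2 else int (?\<mu> i - ?\<mu> j))" for i j
  have summand: "glop n i j (glop n j i z) - ?s (e i j) \<in> reach n" if ij: "i < n" "j < n" for i j
  proof (cases "i = j")
    case True
    have "?s (int (?\<mu> i)) \<in> weight_space n \<mu>"
      using less.prems(1) unfolding weight_space_def by (rule ksupp_scal_const)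
    from glop_weight[OF ij(1) this] have "glop n i j (glop n j i z) = ?s (e i j)"
      using True eig[OF ij(1)] by (simp add: e_def power2_eq_square)
    then show ?thesis using reach_zero by simp
  next
    case False
    show ?thesis
    proof (cases "?\<mu> j \<le> ?\<mu> i")
      case True
      have "glop n i j (glop n j i z) - ?s (e i j) = glop n j i (glop n i j z)"
      proof -
        have "int (?\<mu> i) = e i j + int (?\<mu> j)" using True False by (simp add: e_def)
        then have "glop n i i z = ?s (e i j) + glop n j j z"
          unfolding eig[OF ij(1)] eig[OF ij(2)] by (simp only: s_add)
        then show ?thesis using glop_commutator[OF ij, of z] by simp
      qed
      then show ?thesis using reach_glop[OF ij(2,1) raise[OF ij False True]] by simp
    next
      case F: False
      then have "e i j = 0" using False by (simp add: e_def)
      then show ?thesis using reach_glop[OF ij raise[OF ij(2,1)]] F False by simp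
    qed
  qed
  have esum: "(\<Sum>i<n. \<Sum>j<n. e i j) - (\<Sum>j<n. \<Sum>i<n. int (?\<mu> i)) = casimir_value n \<mu>"
  proof -
    have "(\<Sum>i<n. \<Sum>j<n. e i j) = (\<Sum>i<n. \<Sum>j<n. (if i = j then int (?\<mu> i) ^ 2 else 0) + int (?\<mu> i - ?\<mu> j))"
      by (intro sum.cong refl) (simp add: e_def)
    also have "\<dots> = (\<Sum>i<n. int (?\<mu> i) ^ 2) + (\<Sum>i<n. \<Sum>j<n. int (?\<mu> i - ?\<mu> j))"
      by (simp add: sum.distrib)
    finally show ?thesis by (simp add: casimir_value_def)
  qed
  have "(\<Sum>i<n. \<Sum>j<n. glop n i j (glop n j i z) - ?s (e i j)) \<in> reach n"
    by (intro reach_sum summand) auto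
  moreover have "koszul_diff (quads n) (dual_diff n z) \<in> reach n"
    by (intro reach_boundary kelems_dual_diff weight_space_kelems[OF less.prems(1)])
  \<comment> \<open>The Laplacian of \<open>z\<close> is a boundary. Taking away the summands known
    to be in \<open>reach n\<close> leaves a multiple of \<open>z\<close>.\<close>
  ultimately have "koszul_diff (quads n) (dual_diff n z) -
    (\<Sum>i<n. \<Sum>j<n. glop n i j (glop n j i z) - ?s (e i j)) \<in> reach n"
    by (intro reach_diff)
  moreover have "koszul_diff (quads n) (dual_diff n z) -
    (\<Sum>i<n. \<Sum>j<n. glop n i j (glop n j i z) - ?s (e i j)) = ?s (casimir_value n \<mu>)"
  proof -
    have "(\<Sum>i<n. \<Sum>j<n. ?s (e i j)) = ?s (\<Sum>i<n. \<Sum>j<n. e i j)"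
      by (simp only: s_sum)
    moreover have "(\<Sum>j<n. \<Sum>i<n. glop n i i z) = ?s (\<Sum>j<n. \<Sum>i<n. int (?\<mu> i))"
      unfolding s_sum by (intro sum.cong refl eig) simp
    moreover have "?s (\<Sum>i<n. \<Sum>j<n. e i j) - ?s (\<Sum>j<n. \<Sum>i<n. int (?\<mu> i)) = ?s (casimir_value n \<mu>)"
      unfolding esum[symmetric] using s_add[of "(\<Sum>i<n. \<Sum>j<n. e i j) - (\<Sum>j<n. \<Sum>i<n. int (?\<mu> i))" "\<Sum>j<n. \<Sum>i<n. int (?\<mu> i)"]
      by (simp only: diff_add_cancel add_diff_cancel_right')
    ultimately show ?thesis
      unfolding laplacian_cycle[OF less.prems(2)] sum_subtractf by (simp only: diff_diff_eq2 diff_add_eq add_diff_cancel_left' add_diff_cancel diff_diff_eq) (simp add: algebra_simps)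
  qed
  ultimately have F: "?s (casimir_value n \<mu>) \<in> reach n" by simp
  show ?case
  proof (cases "casimir_value n \<mu> = 0")
    case True
    then show ?thesis using weight_cycle_casimir_zero less.prems by blast
  next
    case False
    have "scal (const_poly (1 / of_int (casimir_value n \<mu>))) (?s (casimir_value n \<mu>)) = z"
      using False by (simp del: const_poly_simps(4) add: const_poly_simps(4))
    then show ?thesis using reach_scal[OF F] by metis
  qed
qed

text \<open>The differential preserves multidegree, so the weight components of a cycle are
  cycles.\<close>

lemma cycle_reach:
  fixes z :: "nat set \<Rightarrow> 'k::field_char_0 mpoly"
  assumes "z \<in> kelems n (triangle n)" "koszul_diff (quads n) z = 0"
  shows "z \<in> reach n"
proof -
  \<comment> \<open>The condition on \<open>K\<close> keeps infinite sets out, on which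
    \<open>kwt\<close> is 0 and not additive.\<close>
  define part where "part \<mu> = diagop (\<lambda>K m. if K \<subseteq> {..<triangle n} \<and> m + kwt K = \<mu> then 1 else 0) z" for \<mu>
  define W where "W = (\<Union>K\<in>Pow {..<triangle n}. (\<lambda>m. m + kwt K) ` Poly_Mapping.keys (z K))"
  have fin: "finite W" by (simp add: W_def)
  have "part \<mu> \<in> reach n" for \<mu>
  proof (rule weight_cycle_reach)
    show "part \<mu> \<in> weight_space n \<mu>"
      unfolding part_def weight_space_def using assms(1)[unfolded kelems_def]
      by (rule ksupp_diagop) (auto split: if_splits)
    have "koszul_diff (quads n) (part \<mu>) = diagop (\<lambda>K m. if K \<subseteq> {..<triangle n} \<and> m + kwt K = \<mu> then 1 else 0) (koszul_diff (quads n) z)"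
      unfolding koszul_diff_quads part_def additive_sum[of "diagop _", OF diagop_add]
    proof (intro sum.cong refl diagop_scal_contract[symmetric])
      fix q K m assume q: "q \<in> {..<triangle n}" "q \<notin> K"
      show "(if K \<subseteq> {..<triangle n} \<and> qexp q + m + kwt K = \<mu> then 1 else (0::'k)) =
        (if insert q K \<subseteq> {..<triangle n} \<and> m + kwt (insert q K) = \<mu> then 1 else 0)"
        using q finite_subset[of K "{..<triangle n}"] by (auto simp: kwt_insert add_ac)
    qed
    then show "koszul_diff (quads n) (part \<mu>) = 0" using assms(2) by simp
  qed
  then have "(\<Sum>\<mu>\<in>W. part \<mu>) \<in> reach n" by (intro reach_sum)
  moreover have "(\<Sum>\<mu>\<in>W. part \<mu>) = z"
  proof (rule kelem_eqI)
    fix K m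
    show "Poly_Mapping.lookup ((\<Sum>\<mu>\<in>W. part \<mu>) K) m = Poly_Mapping.lookup (z K) m"
    proof (cases "m \<in> Poly_Mapping.keys (z K)")
      case True
      then have K: "K \<subseteq> {..<triangle n}" using assms(1) by (auto simp: kelems_def dest: ksuppD)
      then have "m + kwt K \<in> W" using True by (auto simp: W_def)
      then show ?thesis
        using fin K by (simp add: fun_apply lookup_sum part_def if_distrib cong: if_cong)
    next
      case False
      then show ?thesis by (simp add: fun_apply lookup_sum part_def in_keys_iff)
    qed
  qed
  ultimately show ?thesis by simp
qed

section \<open>Change of basis\<close>

definition wedge_row :: "(nat \<Rightarrow> 'k::field) \<Rightarrow> nat \<Rightarrow> (nat set \<Rightarrow> 'k mpoly) \<Rightarrow> nat set \<Rightarrow> 'k mpoly" where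
  "wedge_row c L w = (\<Sum>l<L. scal (const_poly (c l)) (wedge l w))"

definition ext_image :: "(nat \<Rightarrow> nat \<Rightarrow> 'k::field) \<Rightarrow> nat \<Rightarrow> nat set \<Rightarrow> nat set \<Rightarrow> 'k mpoly" where
  "ext_image a L I = foldr (\<lambda>i. wedge_row (a i) L) (sorted_list_of_set I) (ext_basis {})"

text \<open>The algebra map induced by the matrix \<open>a\<close> on exterior algebras, linear over
  polynomials. Images of basis elements are ordered products of row forms, so minors never
  appear.\<close>

definition ext_map :: "(nat \<Rightarrow> nat \<Rightarrow> 'k::field) \<Rightarrow> nat \<Rightarrow> nat \<Rightarrow> (nat set \<Rightarrow> 'k mpoly) \<Rightarrow> nat set \<Rightarrow> 'k mpoly" where
  "ext_map a N L z = (\<Sum>I\<in>Pow {..<N}. scal (z I) (ext_image a L I))"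

lemma wedge_row_add [simp]: "wedge_row c L (z + w) = wedge_row c L z + wedge_row c L w"
  by (simp add: wedge_row_def sum.distrib)

lemma wedge_row_scal [simp]: "wedge_row c L (scal p z) = scal p (wedge_row c L z)"
  by (simp add: wedge_row_def scal_sum mult.commute)

lemma wedge_row_sum: "wedge_row c L (\<Sum>i\<in>A. g i) = (\<Sum>i\<in>A. wedge_row c L (g i))"
  by (rule additive_sum[of "wedge_row c L"]) simp

lemma wedge_row_anticommute: "wedge_row c L (wedge_row c' L z) = - wedge_row c' L (wedge_row c L z)"
proof -
  have "wedge_row c L (wedge_row c' L z) =
      (\<Sum>l<L. \<Sum>k<L. scal (const_poly (c l) * const_poly (c' k)) (wedge l (wedge k z)))"
    by (simp only: wedge_row_def wedge_sum scal_sum wedge_scal scal_scal)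
  also have "\<dots> = (\<Sum>k<L. \<Sum>l<L. scal (const_poly (c l) * const_poly (c' k)) (wedge l (wedge k z)))"
    by (rule sum.swap)
  also have "\<dots> = (\<Sum>k<L. \<Sum>l<L. - scal (const_poly (c' k) * const_poly (c l)) (wedge k (wedge l z)))"
    by (subst wedge_anticommute) (simp only: scal_minus mult.commute)
  also have "\<dots> = - wedge_row c' L (wedge_row c L z)"
    by (simp only: wedge_row_def wedge_sum scal_sum wedge_scal scal_scal sum_negf)
  finally show ?thesis .
qed

lemma wedge_row_same:
  fixes z :: "nat set \<Rightarrow> 'k::field_char_0 mpoly"
  shows "wedge_row c L (wedge_row c L z) = 0"
proof (rule double_cancel)
  have "wedge_row c L (wedge_row c L z) = - wedge_row c L (wedge_row c L z)"
    by (rule wedge_row_anticommute)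
  then show "wedge_row c L (wedge_row c L z) + wedge_row c L (wedge_row c L z) = 0 + 0"
    by (metis add.right_inverse add_0_right)
qed

lemma ext_image_empty [simp]: "ext_image a L {} = ext_basis {}"
  by (simp add: ext_image_def)

lemma ext_image_Min:
  assumes "finite I" "k \<in> I" "\<forall>i\<in>I. k \<le> i"
  shows "ext_image a L I = wedge_row (a k) L (ext_image a L (I - {k}))"
proof -
  have "Min I = k" using assms by (intro Min_eqI) auto
  moreover have "I \<noteq> {}" using assms by auto
  ultimately show ?thesis
    using assms(1) by (simp add: ext_image_def sorted_list_of_set_nonempty)
qed

text \<open>The new factor moves past the smaller indices one at a time, each at the cost of a sign.
  A repeated factor gives zero because its square is its own negative.\<close>

lemma wedge_row_ext_image:
  fixes a :: "nat \<Rightarrow> nat \<Rightarrow> 'k::field_char_0"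
  assumes "finite I"
  shows "wedge_row (a i) L (ext_image a L I) =
    (if i \<in> I then 0 else scal (ext_sign i I) (ext_image a L (insert i I)))"
  using assms
proof (induction "card I" arbitrary: I rule: less_induct)
  case less
  show ?case
  proof (cases "\<forall>j\<in>I. i \<le> j")
    case True
    show ?thesis
    proof (cases "i \<in> I")
      case iI: True
      then show ?thesis unfolding ext_image_Min[OF less.prems iI True] by (simp add: wedge_row_same)
    next
      case False
      have "{j \<in> I. j < i} = {}" using True by auto
      then have "(ext_sign i I :: 'k mpoly) = 1" unfolding ext_sign_def by (simp only: card.empty power_0)
      moreover have "ext_image a L (insert i I) = wedge_row (a i) L (ext_image a L (insert i I - {i}))"
        by (rule ext_image_Min) (use True less.prems in auto)
      ultimately show ?thesis using False by simp
    qed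
  next
    case False
    define k where "k = Min I"
    have "I \<noteq> {}" using False by auto
    then have k: "k \<in> I" "\<forall>j\<in>I. k \<le> j" using less.prems by (auto simp: k_def)
    then have ki: "k < i" using False by (meson leD leI le_trans)
    let ?J = "I - {k}"
    have "card ?J < card I" using less.prems k(1) by (rule card_Diff1_less)
    then have IH: "wedge_row (a i) L (ext_image a L ?J) =
      (if i \<in> ?J then 0 else scal (ext_sign i ?J) (ext_image a L (insert i ?J)))"
      using less.hyps[of ?J] less.prems by simp
    have "wedge_row (a i) L (ext_image a L I) = - wedge_row (a k) L (wedge_row (a i) L (ext_image a L ?J))"
      unfolding ext_image_Min[OF less.prems k] by (rule wedge_row_anticommute)
    also have "\<dots> = (if i \<in> I then 0 else scal (- ext_sign i ?J) (wedge_row (a k) L (ext_image a L (insert i ?J))))"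
    proof -
      have "wedge_row (a k) L 0 = 0" by (simp add: wedge_row_def)
      moreover have "- scal p w = scal (- p) w" for p and w :: "nat set \<Rightarrow> 'k mpoly"
        by (rule ext) (simp add: scal_def fun_apply)
      ultimately show ?thesis unfolding IH using ki by simp
    qed
    also have "\<dots> = (if i \<in> I then 0 else scal (ext_sign i I) (ext_image a L (insert i I)))"
    proof (cases "i \<in> I")
      case False
      have "ext_image a L (insert i I) = wedge_row (a k) L (ext_image a L (insert i I - {k}))"
        by (rule ext_image_Min) (use less.prems k ki in auto)
      moreover have "insert i I - {k} = insert i ?J" using ki by auto
      moreover have "(ext_sign i ?J :: 'k mpoly) = - ext_sign i I"
        using ext_sign_remove[OF k(1), of i] ki by simp
      ultimately show ?thesis using False by simp
    qed simp
    finally show ?thesis .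
  qed
qed

lemma ext_map_add [simp]: "ext_map a N L (z + w) = ext_map a N L z + ext_map a N L w"
  by (simp add: ext_map_def fun_apply scal_add_left sum.distrib)

lemma ext_map_scal [simp]: "ext_map a N L (scal p z) = scal p (ext_map a N L z)"
  unfolding ext_map_def scal_sum by (intro sum.cong refl) (simp add: scal_def[of p z])

lemma ext_map_sum: "ext_map a N L (\<Sum>i\<in>A. g i) = (\<Sum>i\<in>A. ext_map a N L (g i))"
  by (rule additive_sum[of "ext_map a N L"]) simp

lemma ext_map_minus: "ext_map a N L (z - w) = ext_map a N L z - ext_map a N L w"
  using ext_map_add[of a N L "z - w" w] by (simp only: diff_add_cancel eq_diff_eq)

lemma ext_map_one [simp]: "ext_map a N L (ext_basis {}) = ext_basis {}"
proof -
  have "ext_map a N L (ext_basis {}) = (\<Sum>I\<in>Pow {..<N}. if I = {} then ext_basis {} else 0)"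
    unfolding ext_map_def by (intro sum.cong refl) (auto simp: ext_basis_def[of "{}" "_"])
  then show ?thesis by simp
qed

text \<open>The case of one generator as left factor, from which multiplicativity follows by
  \<open>ext_supported_induct\<close>.\<close>

lemma ext_map_wedge:
  fixes a :: "nat \<Rightarrow> nat \<Rightarrow> 'k::field_char_0"
  assumes "i < N"
  shows "ext_map a N L (wedge i z) = wedge_row (a i) L (ext_map a N L z)"
proof -
  let ?g = "\<lambda>J. scal (ext_sign i J * z J) (ext_image a L (insert i J))"
  have "ext_map a N L (wedge i z) = (\<Sum>I\<in>{I \<in> Pow {..<N}. i \<in> I}. ?g (I - {i}))"
    unfolding ext_map_def
    by (rule sum.mono_neutral_cong_right) (auto simp: wedge_def insert_absorb)
  also have "\<dots> = (\<Sum>J\<in>{J \<in> Pow {..<N}. i \<notin> J}. ?g J)"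
    by (rule sum.reindex_bij_witness[of _ "insert i" "\<lambda>I. I - {i}"]) (use assms in auto)
  also have "\<dots> = (\<Sum>J\<in>Pow {..<N}. scal (z J) (wedge_row (a i) L (ext_image a L J)))"
  proof (rule sum.mono_neutral_cong_left)
    fix J assume J: "J \<in> {J \<in> Pow {..<N}. i \<notin> J}"
    then have "finite J" by (auto intro: finite_subset)
    then show "?g J = scal (z J) (wedge_row (a i) L (ext_image a L J))"
      using J by (simp add: wedge_row_ext_image mult.commute)
  next
    show "\<forall>J\<in>Pow {..<N} - {J \<in> Pow {..<N}. i \<notin> J}. scal (z J) (wedge_row (a i) L (ext_image a L J)) = 0"
    proof
      fix J assume J: "J \<in> Pow {..<N} - {J \<in> Pow {..<N}. i \<notin> J}"
      then have "finite J" by (auto intro: finite_subset)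
      then show "scal (z J) (wedge_row (a i) L (ext_image a L J)) = 0"
        using J by (simp add: wedge_row_ext_image)
    qed
  qed auto
  also have "\<dots> = wedge_row (a i) L (ext_map a N L z)"
    by (simp add: ext_map_def wedge_row_sum)
  finally show ?thesis .
qed

lemma ksupp_ext_image:
  assumes "finite I"
  shows "ext_image a L I \<in> ksupp (\<lambda>K m. K \<subseteq> {..<L} \<and> card K = card I \<and> m = 0)"
  using assms
proof (induction "card I" arbitrary: I)
  case 0
  then show ?case by (auto intro: ksupp_ext_basis)
next
  case (Suc c)
  define k where "k = Min I"
  have "I \<noteq> {}" using Suc.hyps(2) by auto
  then have k: "k \<in> I" "\<forall>j\<in>I. k \<le> j" using Suc.prems by (auto simp: k_def)
  have c: "c = card (I - {k})" using Suc k(1) by simp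
  show ?case
    unfolding ext_image_Min[OF Suc.prems k] wedge_row_def
  proof (intro ksupp_sum ksupp_scal_const)
    fix l assume l: "l \<in> {..<L}"
    have "ext_image a L (I - {k}) \<in> ksupp (\<lambda>K m. K \<subseteq> {..<L} \<and> card K = card (I - {k}) \<and> m = 0)"
      using Suc.hyps(1)[OF c] Suc.prems by simp
    then show "wedge l (ext_image a L (I - {k})) \<in> ksupp (\<lambda>K m. K \<subseteq> {..<L} \<and> card K = card I \<and> m = 0)"
      by (rule ksupp_wedge) (use l c Suc.hyps(2) finite_subset in \<open>fastforce simp: card_insert_if\<close>)
  qed
qed

text \<open>The matrix entries are constants, so exponents and homological degree are
  preserved.\<close>

lemma ksupp_ext_map:
  assumes "z \<in> ksupp (\<lambda>K m. K \<subseteq> {..<N} \<and> P (card K) m)"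
  shows "ext_map a N L z \<in> ksupp (\<lambda>K m. K \<subseteq> {..<L} \<and> P (card K) m)"
  unfolding ext_map_def
proof (rule ksupp_sum)
  fix I assume "I \<in> Pow {..<N}"
  then have "finite I" by (auto intro: finite_subset)
  from ksupp_ext_image[OF this]
  show "scal (z I) (ext_image a L I) \<in> ksupp (\<lambda>K m. K \<subseteq> {..<L} \<and> P (card K) m)"
  proof (rule ksupp_scal)
    fix K and m p :: "nat \<Rightarrow>\<^sub>0 nat"
    assume "p \<in> Poly_Mapping.keys (z I)" "K \<subseteq> {..<L} \<and> card K = card I \<and> m = 0"
    then show "K \<subseteq> {..<L} \<and> P (card K) (p + m)" using ksuppD[OF assms, of p I] by simp
  qed
qed

lemma ksupp_supported:
  assumes "z \<in> ksupp (\<lambda>K m. K \<subseteq> {..<N} \<and> Q K m)"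
  shows "ext_supported N z"
proof -
  have "Poly_Mapping.lookup (z I) m = 0" if "\<not> I \<subseteq> {..<N}" for I m
    using ksuppD[OF assms, of m I] that by (auto simp: in_keys_iff)
  then show ?thesis
    unfolding ext_supported_def by (intro allI impI poly_mapping_eqI) (simp only: lookup_zero)
qed

lemma ext_map_supported: "ext_supported L (ext_map a N L z)"
proof -
  have "ext_supported L (ext_image a L I)" if "finite I" for I
    using ksupp_ext_image[OF that] by (rule ksupp_supported)
  moreover have "finite I" if "I \<in> Pow {..<N}" for I
    using that by (auto intro: finite_subset)
  ultimately have "ext_supported L (ext_image a L I)" if "I \<in> Pow {..<N}" for I
    using that by blast
  then show ?thesis
    unfolding ext_map_def ext_supported_def sum_fun_apply scal_def by (auto intro!: sum.neutral)
qed

lemma ext_map_kmult: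
  fixes a :: "nat \<Rightarrow> nat \<Rightarrow> 'k::field_char_0"
  assumes "ext_supported N z" "ext_supported N w"
  shows "ext_map a N L (kmult z w) = kmult (ext_map a N L z) (ext_map a N L w)"
  using assms(1)
proof (induction rule: ext_supported_induct)
  case one
  have "kmult (ext_basis {}) w = w"
    by (rule kmult_one_left) (rule ext_supported_infinite[OF assms(2)])
  moreover have "kmult (ext_basis {}) (ext_map a N L w) = ext_map a N L w"
    by (rule kmult_one_left) (rule ext_supported_infinite[OF ext_map_supported])
  ultimately show ?case by simp
next
  case (wedge k z)
  have "kmult (wedge_row c L u) v = wedge_row c L (kmult u v)" for c and u v :: "nat set \<Rightarrow> 'k mpoly"
    by (simp add: wedge_row_def kmult_sum_left kmult_scal_left kmult_wedge_left)
  then show ?case using wedge by (simp add: kmult_wedge_left ext_map_wedge)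
qed (simp_all add: kmult_add_left kmult_scal_left)

lemma ext_map_zero [simp]: "ext_map a N L 0 = 0"
  using ext_map_add[of a N L 0 0] by (simp only: add_0_left add_cancel_right_right)

text \<open>Both sides obey the same Leibniz rule for \<open>wedge\<close>, because row
  \<open>k\<close> of the matrix writes \<open>gs ! k\<close> in terms of \<open>fs\<close>.\<close>

lemma ext_map_koszul_diff:
  fixes a :: "nat \<Rightarrow> nat \<Rightarrow> 'k::field_char_0"
  assumes "\<And>i. i < length gs \<Longrightarrow> gs ! i = (\<Sum>l<length fs. const_poly (a i l) * fs ! l)"
    and "ext_supported (length gs) z"
  shows "koszul_diff fs (ext_map a (length gs) (length fs) z) =
    ext_map a (length gs) (length fs) (koszul_diff gs z)"
  using assms(2)
proof (induction rule: ext_supported_induct)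
  case (wedge k z)
  let ?L = "length fs"
  let ?F = "ext_map a (length gs) ?L"
  have scal_sum_left: "scal (\<Sum>l<?L. p l) w = (\<Sum>l<?L. scal (p l) w)" for p and w :: "nat set \<Rightarrow> 'k mpoly"
    by (rule additive_sum[of "\<lambda>p. scal p w"]) (rule scal_add_left)
  have "koszul_diff fs (wedge_row (a k) ?L w) = scal (gs ! k) w - wedge_row (a k) ?L (koszul_diff fs w)" for w
  proof -
    have "koszul_diff fs (wedge_row (a k) ?L w) =
      (\<Sum>l<?L. scal (const_poly (a k l)) (scal (fs ! l) w - wedge l (koszul_diff fs w)))"
      unfolding wedge_row_def additive_sum[of "koszul_diff fs", OF koszul_diff_add] koszul_diff_scal
      by (intro sum.cong refl) (simp add: koszul_diff_wedge)
    also have "\<dots> = scal (gs ! k) w - wedge_row (a k) ?L (koszul_diff fs w)"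
      unfolding assms(1)[OF wedge(1)] scal_diff_right sum_subtractf scal_sum_left wedge_row_def scal_scal ..
    finally show ?thesis .
  qed
  then show ?case
    using wedge by (simp add: ext_map_wedge koszul_diff_wedge ext_map_minus)
qed (simp_all add: koszul_diff_scal)

lemma ext_map_inverse:
  fixes a b :: "nat \<Rightarrow> nat \<Rightarrow> 'k::field_char_0"
  assumes "\<And>l k. l < L \<Longrightarrow> k < L \<Longrightarrow> (\<Sum>q<N. b l q * a q k) = (if l = k then 1 else 0)"
    and "ext_supported L z"
  shows "ext_map a N L (ext_map b L N z) = z"
  using assms(2)
proof (induction rule: ext_supported_induct)
  case (wedge l z)
  let ?w = "ext_map a N L (ext_map b L N z)"
  have const_sum: "(\<Sum>q<N. const_poly (f q)) = const_poly (\<Sum>q<N. f q :: 'k)" for f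
    by (rule additive_sum[of const_poly, symmetric]) simp
  have scal_sum_left: "(\<Sum>q<N. scal (p q) w) = scal (\<Sum>q<N. p q) w" for p and w :: "nat set \<Rightarrow> 'k mpoly"
    by (rule additive_sum[of "\<lambda>p. scal p w", symmetric]) (rule scal_add_left)
  have "ext_map a N L (ext_map b L N (wedge l z)) =
    (\<Sum>q<N. scal (const_poly (b l q)) (ext_map a N L (wedge q (ext_map b L N z))))"
    unfolding ext_map_wedge[OF wedge(1)] wedge_row_def[of "b l"] ext_map_sum ext_map_scal ..
  also have "\<dots> = (\<Sum>q<N. scal (const_poly (b l q)) (wedge_row (a q) L ?w))"
    by (intro sum.cong refl) (simp add: ext_map_wedge)
  also have "\<dots> = (\<Sum>q<N. \<Sum>k<L. scal (const_poly (b l q * a q k)) (wedge k z))"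
    unfolding wedge(2) wedge_row_def scal_sum scal_scal const_poly_simps ..
  also have "\<dots> = (\<Sum>k<L. \<Sum>q<N. scal (const_poly (b l q * a q k)) (wedge k z))"
    by (rule sum.swap)
  also have "\<dots> = (\<Sum>k<L. if l = k then wedge k z else 0)"
    unfolding scal_sum_left const_sum
    by (intro sum.cong refl) (use wedge(1) assms(1) in simp)
  also have "\<dots> = wedge l z" using wedge(1) by simp
  finally show ?case .
qed simp_all

lemma kelems_ext_map: "z \<in> kelems n N \<Longrightarrow> ext_map a N L z \<in> kelems n L"
  unfolding kelems_def by (rule ksupp_ext_map)

lemma linear_cycles_ext_map:
  fixes a :: "nat \<Rightarrow> nat \<Rightarrow> 'k::field_char_0"
  assumes "\<And>i. i < length gs \<Longrightarrow> gs ! i = (\<Sum>l<length fs. const_poly (a i l) * fs ! l)"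
    and "z \<in> linear_cycles n gs"
  shows "ext_map a (length gs) (length fs) z \<in> linear_cycles n fs"
proof -
  obtain i where i: "z \<in> ksupp (\<lambda>K m. K \<subseteq> {..<length gs} \<and> card K = i \<and>
      Poly_Mapping.keys m \<subseteq> {..<n} \<and> monom_degree m = 2)" and d: "koszul_diff gs z = 0"
    using assms(2) by (auto simp: linear_cycles_def)
  have "z \<in> kelems n (length gs)"
    using lingen_kelems[OF lingen.linear[OF assms(2)]] .
  then have "koszul_diff fs (ext_map a (length gs) (length fs) z) = 0"
    using ext_map_koszul_diff[OF assms(1) kelems_supported] d by simp
  then show ?thesis using ksupp_ext_map[OF i] by (auto simp: linear_cycles_def)
qed

lemma lingen_ext_map:
  fixes a :: "nat \<Rightarrow> nat \<Rightarrow> 'k::field_char_0"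
  assumes "\<And>i. i < length gs \<Longrightarrow> gs ! i = (\<Sum>l<length fs. const_poly (a i l) * fs ! l)"
    and "q \<in> lingen n gs"
  shows "ext_map a (length gs) (length fs) q \<in> lingen n fs"
  using assms(2)
proof (induction rule: lingen.induct)
  case (mult z w)
  then show ?case
    by (simp add: ext_map_kmult kelems_supported[OF lingen_kelems] lingen.mult)
qed (auto intro: lingen.intros linear_cycles_ext_map[OF assms(1)])

section \<open>Coordinates of quadratic forms and transfer to an arbitrary basis\<close>

lemma basis_expansion:
  fixes fs :: "'k::field mpoly list"
  assumes "is_basis_of fs V" "p \<in> V"
  shows "\<exists>c. p = (\<Sum>l<length fs. const_poly (c l) * fs ! l)"
proof -
  have "p \<in> poly_vs.span (set fs)" using assms by (simp add: is_basis_of_def)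
  then obtain u where "p = (\<Sum>v\<in>set fs. scale_poly (u v) v)"
    by (auto simp: poly_vs.span_finite)
  also have "\<dots> = (\<Sum>l<length fs. scale_poly (u (fs ! l)) (fs ! l))"
    using assms(1) by (intro sum.reindex_bij_betw[symmetric] bij_betw_nth) (auto simp: is_basis_of_def)
  finally show ?thesis by (auto simp: scale_poly_def)
qed

lemma basis_independent:
  fixes fs :: "'k::field mpoly list"
  assumes "is_basis_of fs V" "(\<Sum>l<length fs. const_poly (c l) * fs ! l) = 0" "k < length fs"
  shows "c k = 0"
proof -
  have fs: "distinct fs" "poly_vs.independent (set fs)" using assms(1) by (auto simp: is_basis_of_def)
  define u where "u v = c (THE l. l < length fs \<and> fs ! l = v)" for v
  have u: "u (fs ! l) = c l" if "l < length fs" for l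
  proof -
    have "(THE k. k < length fs \<and> fs ! k = fs ! l) = l"
      using that fs(1) by (intro the_equality) (auto simp: nth_eq_iff_index_eq)
    then show ?thesis by (simp add: u_def)
  qed
  have "(\<Sum>v\<in>set fs. scale_poly (u v) v) = (\<Sum>l<length fs. scale_poly (u (fs ! l)) (fs ! l))"
    using fs(1) by (intro sum.reindex_bij_betw[symmetric] bij_betw_nth) auto
  also have "\<dots> = 0" using assms(2) u by (simp add: scale_poly_def)
  finally have "u (fs ! k) = 0"
    using poly_vs.independentD[OF fs(2), of "set fs" u "fs ! k"] assms(3) by simp
  then show ?thesis using u assms(3) by simp
qed

lemma quads_homog: "q < triangle n \<Longrightarrow> quads n ! q \<in> homog_poly n 2"
  using qidx_exists[of q n] by (auto simp: quads_def homog_poly_def keys_add_nat)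

lemma monom_degree_two:
  assumes "monom_degree m = 2"
  shows "\<exists>i j. m = unit_exp i + unit_exp j"
proof -
  have pos: "\<exists>i. 1 \<le> Poly_Mapping.lookup m i" if "monom_degree m \<noteq> 0" for m
  proof (rule ccontr)
    assume "\<not> ?thesis"
    then have "m = 0" by (intro poly_mapping_eqI) (auto simp: not_le)
    then show False using that by simp
  qed
  obtain i where i: "1 \<le> Poly_Mapping.lookup m i" using pos[of m] assms by auto
  define m' where "m' = m - unit_exp i"
  have m: "unit_exp i + m' = m"
    unfolding m'_def using i by (intro exp_add_minus[of _ i]) (auto simp: lookup_single)
  then have d: "monom_degree m' = 1" using assms monom_degree_add[of "unit_exp i" m'] by simp
  then obtain j where j: "1 \<le> Poly_Mapping.lookup m' j" using pos[of m'] by auto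
  define m'' where "m'' = m' - unit_exp j"
  have m2: "unit_exp j + m'' = m'"
    unfolding m''_def using j by (intro exp_add_minus[of _ j]) (auto simp: lookup_single)
  then have "monom_degree m'' = 0" using d monom_degree_add[of "unit_exp j" m''] by simp
  then have "m'' = 0"
    using pos[of m''] by (auto simp: monom_degree_def intro!: poly_mapping_eqI simp: in_keys_iff)
  then show ?thesis using m m2 by auto
qed

lemma homog_two_expansion:
  fixes p :: "'k::field mpoly"
  assumes "p \<in> homog_poly n 2"
  shows "p = (\<Sum>q<triangle n. const_poly (Poly_Mapping.lookup p (qexp q)) * quads n ! q)"
proof -
  have inj: "qexp q = qexp q' \<longleftrightarrow> q = q'" for q q'
  proof
    assume e: "qexp q = qexp q'"
    obtain i j k l where q: "q = qidx i j" "q' = qidx k l" using qidx_surj by blast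
    have f: "(if i = a then 1 else 0) + (if j = a then 1 else 0) =
      (if k = a then 1 else 0) + (if l = a then 1 else (0::nat))" for a
      using arg_cong[OF e, of "\<lambda>x. Poly_Mapping.lookup x a"]
      by (simp only: q qexp_qidx lookup_add lookup_single when_def One_nat_def)
    have "i = k \<or> i = l"
      using f[of i] by (cases "k = i"; cases "l = i") simp_all
    then show "q = q'"
    proof
      assume "i = k"
      then have "l = j" using f[of j] by (cases "l = j") simp_all
      then show ?thesis using \<open>i = k\<close> by (simp add: q)
    next
      assume "i = l"
      then have "k = j" using f[of j] by (cases "k = j") simp_all
      then show ?thesis using \<open>i = l\<close> by (simp add: q qidx_sym)
    qed
  qed simp
  have "p = (\<Sum>m\<in>Poly_Mapping.keys p. Poly_Mapping.single m (Poly_Mapping.lookup p m))"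
    by (rule poly_expand)
  also have "\<dots> = (\<Sum>m\<in>qexp ` {..<triangle n}. Poly_Mapping.single m (Poly_Mapping.lookup p m))"
  proof (rule sum.mono_neutral_left)
    show "Poly_Mapping.keys p \<subseteq> qexp ` {..<triangle n}"
    proof
      fix m assume "m \<in> Poly_Mapping.keys p"
      then have m: "Poly_Mapping.keys m \<subseteq> {..<n}" "monom_degree m = 2"
        using assms by (auto simp: homog_poly_def)
      then obtain i j where ij: "m = unit_exp i + unit_exp j" using monom_degree_two by blast
      then have "qidx i j < triangle n" using m(1) by (auto simp: keys_add_nat qidx_less)
      then show "m \<in> qexp ` {..<triangle n}" using ij by (auto intro!: image_eqI[of _ _ "qidx i j"])
    qed
  qed (auto simp: in_keys_iff)
  also have "\<dots> = (\<Sum>q<triangle n. Poly_Mapping.single (qexp q) (Poly_Mapping.lookup p (qexp q)))"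
    by (subst sum.reindex) (auto simp: inj_on_def inj)
  also have "\<dots> = (\<Sum>q<triangle n. const_poly (Poly_Mapping.lookup p (qexp q)) * quads n ! q)"
    by (intro sum.cong refl) (simp add: quads_def)
  finally show ?thesis .
qed

text \<open>The matrix \<open>b\<close> writes the basis in monomials and \<open>a\<close> writes
  monomials in the basis. The cycle is sent to the monomial complex by \<open>b\<close>, decomposed
  there, and brought back by \<open>a\<close>.\<close>

lemma cycle_decomposition:
  fixes fs :: "'k::field_char_0 mpoly list"
  assumes basis: "is_basis_of fs (homog_poly n 2)"
    and z: "z \<in> kelems n (length fs)" "koszul_diff fs z = 0"
  shows "\<exists>q\<in>lingen n fs. \<exists>b\<in>kelems n (length fs). z = q + koszul_diff fs b"
proof -
  let ?gs = "quads n :: 'k mpoly list" and ?L = "length fs" and ?N = "triangle n"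
  have "\<forall>q. \<exists>c. q < ?N \<longrightarrow> ?gs ! q = (\<Sum>l<?L. const_poly (c l) * fs ! l)"
    using basis_expansion[OF basis quads_homog] by blast
  then obtain a where a: "\<And>q. q < ?N \<Longrightarrow> ?gs ! q = (\<Sum>l<?L. const_poly (a q l) * fs ! l)"
    by metis
  have fs_homog: "fs ! l \<in> homog_poly n 2" if "l < ?L" for l
    using basis that poly_vs.span_base[of "fs ! l" "set fs"] by (simp add: is_basis_of_def)
  define b where "b l q = Poly_Mapping.lookup (fs ! l) (qexp q)" for l q
  have b: "fs ! l = (\<Sum>q<?N. const_poly (b l q) * ?gs ! q)" if "l < ?L" for l
    unfolding b_def by (rule homog_two_expansion[OF fs_homog[OF that]])
  \<comment> \<open>Substituting one expansion into the other gives a linear relation among the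
    \<open>fs\<close>; its coefficients vanish by independence.\<close>
  have inv: "(\<Sum>q<?N. b l q * a q k) = (if l = k then 1 else 0)" if "l < ?L" "k < ?L" for l k
  proof -
    let ?c = "\<lambda>k. (\<Sum>q<?N. b l q * a q k) - (if l = k then 1 else 0)"
    have const_sum: "const_poly (\<Sum>q<?N. f q :: 'k) = (\<Sum>q<?N. const_poly (f q))" for f
      by (rule additive_sum[of const_poly]) simp
    have const_diff: "const_poly (x - y) = const_poly x - const_poly (y :: 'k)" for x y
      by (simp add: const_poly_def single_diff)
    have "fs ! l = (\<Sum>q<?N. const_poly (b l q) * (\<Sum>k<?L. const_poly (a q k) * fs ! k))"
      by (subst b[OF that(1)]) (intro sum.cong refl, simp add: a)
    also have "\<dots> = (\<Sum>q<?N. \<Sum>k<?L. const_poly (b l q * a q k) * fs ! k)"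
      by (simp only: sum_distrib_left mult.assoc[symmetric] const_poly_simps)
    also have "\<dots> = (\<Sum>k<?L. const_poly (\<Sum>q<?N. b l q * a q k) * fs ! k)"
      unfolding const_sum sum_distrib_right by (rule sum.swap)
    finally have e: "fs ! l = (\<Sum>k<?L. const_poly (\<Sum>q<?N. b l q * a q k) * fs ! k)" .
    have "(\<Sum>k<?L. const_poly (if l = k then 1 else 0) * fs ! k) = (\<Sum>k<?L. if l = k then fs ! k else 0)"
      by (intro sum.cong refl) simp
    also have "\<dots> = fs ! l" using that(1) by simp
    finally have "(\<Sum>k<?L. const_poly (?c k) * fs ! k) = 0"
      unfolding const_diff left_diff_distrib sum_subtractf using e by simp
    from basis_independent[OF basis this that(2)] show ?thesis by simp
  qed
  let ?z = "ext_map b ?L ?N z"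
  have "?z \<in> kelems n ?N" by (rule kelems_ext_map[OF z(1)])
  moreover have "koszul_diff ?gs ?z = 0"
    using ext_map_koszul_diff[where gs = fs and fs = ?gs and a = b] b kelems_supported[OF z(1)] z(2) by simp
  ultimately have "?z \<in> reach n" by (rule cycle_reach)
  then obtain q c where qc: "q \<in> lingen n ?gs" "c \<in> kelems n ?N" "?z = q + koszul_diff ?gs c"
    unfolding reach_def by blast
  have "z = ext_map a ?N ?L ?z"
    by (rule ext_map_inverse[symmetric]) (use inv kelems_supported[OF z(1)] in auto)
  also have "\<dots> = ext_map a ?N ?L q + koszul_diff fs (ext_map a ?N ?L c)"
    unfolding qc(3) using ext_map_koszul_diff[where gs = ?gs and fs = fs and a = a] a kelems_supported[OF qc(2)] by simp
  finally show ?thesis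
    using lingen_ext_map[where gs = ?gs and fs = fs and a = a, OF _ qc(1)] a kelems_ext_map[OF qc(2)] by fastforce
qed

section \<open>The homology algebra\<close>

lemma graded_total_even:
  "graded_total (veronese 2 (homog_poly n)) = {p :: 'k::field mpoly. \<forall>m\<in>Poly_Mapping.keys p. even_exp n m}"
proof (intro equalityI subsetI)
  fix p :: "'k mpoly" assume "p \<in> graded_total (veronese 2 (homog_poly n))"
  then obtain D a where a: "p = (\<Sum>d\<in>D. a d)" "\<And>d. d \<in> D \<Longrightarrow> a d \<in> homog_poly n (2 * d)"
    by (auto simp: graded_total_def veronese_def)
  have "even_exp n m" if m: "m \<in> Poly_Mapping.keys p" for m
  proof -
    obtain d where "d \<in> D" "m \<in> Poly_Mapping.keys (a d)"
      using m keys_sum_subset[of a D] unfolding a(1) by blast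
    then show ?thesis using a(2) by (auto simp: homog_poly_def even_exp_def)
  qed
  then show "p \<in> {p. \<forall>m\<in>Poly_Mapping.keys p. even_exp n m}" by simp
next
  fix p :: "'k mpoly" assume "p \<in> {p. \<forall>m\<in>Poly_Mapping.keys p. even_exp n m}"
  then have p: "even_exp n m" if "m \<in> Poly_Mapping.keys p" for m using that by simp
  let ?D = "(\<lambda>m. monom_degree m div 2) ` Poly_Mapping.keys p"
  define a where "a d = (\<Sum>m\<in>{m \<in> Poly_Mapping.keys p. monom_degree m div 2 = d}.
    Poly_Mapping.single m (Poly_Mapping.lookup p m))" for d
  have "a d \<in> homog_poly n (2 * d)" for d
  proof -
    have "m \<in> Poly_Mapping.keys p \<and> monom_degree m div 2 = d" if "m \<in> Poly_Mapping.keys (a d)" for m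
      using that keys_sum_subset[of "\<lambda>m. Poly_Mapping.single m (Poly_Mapping.lookup p m)"]
      unfolding a_def by (fastforce split: if_splits)
    then have "Poly_Mapping.keys m \<subseteq> {..<n} \<and> monom_degree m = 2 * d" if "m \<in> Poly_Mapping.keys (a d)" for m
      using that p[of m] by (metis dvd_mult_div_cancel even_exp_def)
    then show ?thesis by (auto simp: homog_poly_def)
  qed
  moreover have "p = (\<Sum>d\<in>?D. a d)"
    unfolding a_def by (subst sum.image_gen[symmetric]) (auto intro: poly_expand)
  ultimately show "p \<in> graded_total (veronese 2 (homog_poly n))"
    unfolding graded_total_def veronese_def mem_Collect_eq by (intro exI[of _ ?D] exI[of _ a]) auto
qed

context
  fixes n :: nat and fs :: "'k::field_char_0 mpoly list" and R :: "nat \<Rightarrow> 'k mpoly set"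
  assumes R: "R = veronese 2 (homog_poly n)"
    and basis: "is_basis_of fs (homog_poly n 2)"
begin

abbreviation (input) "KC \<equiv> kelems n (length fs) :: (nat set \<Rightarrow> 'k mpoly) set"

lemma carrier_koszul: "carrier (koszul_algebra R fs) = KC"
proof -
  have "(\<not> I \<subseteq> {..<length fs} \<longrightarrow> z I = 0) \<longleftrightarrow> (\<forall>m\<in>Poly_Mapping.keys (z I). I \<subseteq> {..<length fs})"
    for I and z :: "nat set \<Rightarrow> 'k mpoly"
    by (metis all_not_in_conv in_keys_iff keys_zero lookup_zero poly_mapping_eqI)
  then have "(\<forall>I. z I \<in> {p. \<forall>m\<in>Poly_Mapping.keys p. even_exp n m} \<and> (\<not> I \<subseteq> {..<length fs} \<longrightarrow> z I = 0)) \<longleftrightarrow>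
      (\<forall>I. \<forall>m\<in>Poly_Mapping.keys (z I). I \<subseteq> {..<length fs} \<and> even_exp n m)" for z :: "nat set \<Rightarrow> 'k mpoly"
    by (simp only: mem_Collect_eq) blast
  then show ?thesis
    unfolding koszul_algebra_def R graded_total_even kelems_def ksupp_def by (simp only: ring_record_simps partial_object.simps)
qed

lemma koszul_ops:
  "mult (koszul_cycles R fs) = kmult" "one (koszul_cycles R fs) = ext_basis {}"
  "zero (koszul_cycles R fs) = 0" "add (koszul_cycles R fs) = (+)"
  by (auto simp: koszul_cycles_def koszul_algebra_def fun_eq_iff kmult_def ext_basis_def fun_apply)

lemma carrier_cycles: "carrier (koszul_cycles R fs) = {z \<in> KC. koszul_diff fs z = 0}"
  unfolding koszul_cycles_def by (simp add: carrier_koszul zero_fun_def)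

lemma basis_even_exp: "l < length fs \<Longrightarrow> m \<in> Poly_Mapping.keys (fs ! l) \<Longrightarrow> even_exp n m"
  using basis poly_vs.span_base[of "fs ! l" "set fs"]
  by (auto simp: is_basis_of_def homog_poly_def even_exp_def)

lemma KC_diff: "z \<in> KC \<Longrightarrow> koszul_diff fs z \<in> KC"
  unfolding kelems_def
  by (erule ksupp_koszul_diff) (auto simp: even_exp_def keys_add_nat dest: basis_even_exp[unfolded even_exp_def])

lemma KC_infinite: "z \<in> KC \<Longrightarrow> infinite K \<Longrightarrow> z K = 0"
  by (rule ext_supported_infinite[OF kelems_supported])

text \<open>The differential lowers \<open>card K\<close> by one. At infinite sets
  \<open>card\<close> is 0 and the sign would fail, hence the restriction to
  \<open>KC\<close>.\<close>

lemma koszul_diff_invol: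
  assumes "z \<in> KC"
  shows "koszul_diff fs (invol z) = - invol (koszul_diff fs z)"
proof -
  have "contract k (invol z) = - invol (contract k z)" for k
  proof
    fix K
    show "contract k (invol z) K = (- invol (contract k z)) K"
      using KC_infinite[OF assms, of "insert k K"]
      by (cases "finite K") (auto simp: contract_def invol_def fun_apply)
  qed
  moreover have "invol (\<Sum>i\<in>A. g i) = (\<Sum>i\<in>A. invol (g i))" for A and g :: "nat \<Rightarrow> nat set \<Rightarrow> 'k mpoly"
    by (rule additive_sum[of invol]) (auto simp: invol_def fun_apply distrib_left)
  ultimately show ?thesis
    by (simp add: koszul_diff_sum invol_scal sum_negf)
qed

lemma cycles_ring: "ring (koszul_cycles R fs)"
proof (rule ringI)
  show "abelian_group (koszul_cycles R fs)"
  proof (rule abelian_groupI)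
    fix x assume "x \<in> carrier (koszul_cycles R fs)"
    then show "\<exists>y\<in>carrier (koszul_cycles R fs). y \<oplus>\<^bsub>koszul_cycles R fs\<^esub> x = \<zero>\<^bsub>koszul_cycles R fs\<^esub>"
      unfolding carrier_cycles koszul_ops
      using koszul_diff_minus[of fs 0 x] by (intro bexI[of _ "- x"]) (auto intro: kelems_simps)
  qed (auto simp: carrier_cycles koszul_ops add_ac intro: kelems_simps)
  show "Group.monoid (koszul_cycles R fs)"
  proof (rule Group.monoidI)
    show "x \<otimes>\<^bsub>koszul_cycles R fs\<^esub> y \<otimes>\<^bsub>koszul_cycles R fs\<^esub> z =
      x \<otimes>\<^bsub>koszul_cycles R fs\<^esub> (y \<otimes>\<^bsub>koszul_cycles R fs\<^esub> z)"
      if "x \<in> carrier (koszul_cycles R fs)" for x y z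
      using that unfolding carrier_cycles koszul_ops by (intro kmult_assoc kelems_supported) auto
  qed (auto simp: carrier_cycles koszul_ops koszul_diff_kmult intro: kelems_kmult kelems_one
      kmult_one_left kmult_one_right KC_infinite)
qed (simp_all add: koszul_ops kmult_add_left kmult_add_right)

lemma boundaries_ideal: "ideal (koszul_boundaries R fs) (koszul_cycles R fs)"
proof -
  interpret ring "koszul_cycles R fs" by (rule cycles_ring)
  have B: "koszul_boundaries R fs = koszul_diff fs ` KC"
    by (simp add: koszul_boundaries_def carrier_koszul)
  show ?thesis
  proof (rule idealI)
    show "subgroup (koszul_boundaries R fs) (add_monoid (koszul_cycles R fs))"
    proof (rule add.subgroupI)
      show "koszul_boundaries R fs \<subseteq> carrier (koszul_cycles R fs)"
        by (auto simp: B carrier_cycles KC_diff koszul_diff_sq)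
      show "koszul_boundaries R fs \<noteq> {}" using kelems_simps(4) by (auto simp: B)
      fix x assume "x \<in> koszul_boundaries R fs"
      then obtain b where b: "b \<in> KC" "x = koszul_diff fs b" by (auto simp: B)
      have m: "- x = koszul_diff fs (- b)" using koszul_diff_minus[of fs 0 b] b by simp
      have "x \<in> carrier (koszul_cycles R fs)" using b by (auto simp: carrier_cycles KC_diff koszul_diff_sq)
      moreover have "- x \<in> carrier (koszul_cycles R fs)"
        using b kelems_simps(3)[OF b(1)] unfolding m by (auto simp: carrier_cycles KC_diff koszul_diff_sq)
      ultimately have "\<ominus>\<^bsub>koszul_cycles R fs\<^esub> x = - x"
        by (intro minus_equality) (auto simp: koszul_ops)
      then have "\<ominus>\<^bsub>koszul_cycles R fs\<^esub> x \<in> koszul_boundaries R fs"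
        using m kelems_simps(3)[OF b(1)] by (simp add: B)
      then show "\<ominus>\<^bsub>koszul_cycles R fs\<^esub> x \<in> koszul_boundaries R fs" .
      fix y assume "y \<in> koszul_boundaries R fs"
      then obtain c where "c \<in> KC" "y = koszul_diff fs c" by (auto simp: B)
      then show "x \<oplus>\<^bsub>koszul_cycles R fs\<^esub> y \<in> koszul_boundaries R fs"
        using b by (auto simp: B koszul_ops simp flip: koszul_diff_add intro: kelems_simps)
    qed
    fix a x assume "a \<in> koszul_boundaries R fs" "x \<in> carrier (koszul_cycles R fs)"
    then obtain b where b: "b \<in> KC" "a = koszul_diff fs b" and x: "x \<in> KC" "koszul_diff fs x = 0"
      by (auto simp: B carrier_cycles)
    have ix: "invol x \<in> KC" using x(1) unfolding kelems_def by (rule ksupp_invol)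
    have "invol 0 = (0 :: nat set \<Rightarrow> 'k mpoly)" by (auto simp: invol_def fun_apply)
    \<comment> \<open>The Leibniz rule applies the involution to the left factor; starting from
      \<open>invol x\<close> makes \<open>x\<close> reappear.\<close>
    then have "koszul_diff fs (kmult (invol x) b) = kmult x a"
      using x by (simp add: koszul_diff_kmult koszul_diff_invol b)
    then show "x \<otimes>\<^bsub>koszul_cycles R fs\<^esub> a \<in> koszul_boundaries R fs"
      unfolding B koszul_ops by (metis image_eqI ix b(1) kelems_kmult)
    have "koszul_diff fs (kmult b x) = kmult a x"
      using x by (simp add: koszul_diff_kmult b)
    then show "a \<otimes>\<^bsub>koszul_cycles R fs\<^esub> x \<in> koszul_boundaries R fs"
      unfolding B koszul_ops by (metis image_eqI x(1) b(1) kelems_kmult)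
  qed (rule cycles_ring)
qed

text \<open>The class of a cycle is that of its part in \<open>lingen\<close>, and the rules of
  \<open>lingen\<close> match those of \<open>generate_ring\<close> under the quotient map.\<close>

lemma generated_by_linear_strand:
  "generated_subalgebra R fs (linear_strand R fs) = carrier (koszul_homology R fs)"
proof -
  let ?Z = "koszul_cycles R fs" and ?B = "koszul_boundaries R fs" and ?H = "koszul_homology R fs"
  interpret I: ideal ?B ?Z by (rule boundaries_ideal)
  interpret H: ring ?H unfolding koszul_homology_def by (rule I.quotient_is_ring)
  have hom: "homology_class R fs \<in> ring_hom ?Z ?H"
    using I.rcos_ring_hom unfolding koszul_homology_def homology_class_def by simp
  have carrier_H: "carrier ?H = homology_class R fs ` carrier ?Z"
    unfolding koszul_homology_def homology_class_def FactRing_def A_RCOSETS_def' by auto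
  have strand: "linear_strand R fs \<subseteq> carrier ?H"
  proof -
    have "(\<Union>i. homology_bidegree R fs i (i + 1)) \<subseteq> carrier (add_monoid ?H)"
      by (auto simp: homology_bidegree_def carrier_H)
    from group.generate_incl[OF H.a_group this] show ?thesis by (simp add: linear_strand_def)
  qed
  have scalar: "homology_scalar R fs c = homology_class R fs (scal (const_poly c) (ext_basis {}))" for c
    unfolding homology_scalar_def
    by (rule arg_cong[of _ _ "homology_class R fs"]) (auto simp: scal_def ext_basis_def)
  have lingen_Z: "q \<in> carrier ?Z" if "q \<in> lingen n fs" for q
    using lingen_kelems[OF that] lingen_cycle[OF that] by (simp add: carrier_cycles)
  have scalars: "range (homology_scalar R fs) \<subseteq> carrier ?H"
    unfolding scalar carrier_H using lingen_Z[OF lingen.scalar] by auto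
  have sub: "range (homology_scalar R fs) \<union> linear_strand R fs \<subseteq> carrier ?H"
    using strand scalars by simp
  have gen: "homology_class R fs q \<in> generated_subalgebra R fs (linear_strand R fs)"
    if "q \<in> lingen n fs" for q
    using that
  proof (induction rule: lingen.induct)
    case (scalar c)
    show ?case unfolding generated_subalgebra_def
      by (rule generate_ring.incl) (auto simp: \<open>\<And>c. homology_scalar R fs c = _\<close>[symmetric])
  next
    case (linear z)
    then obtain i where z: "z \<in> ksupp (\<lambda>K m. K \<subseteq> {..<length fs} \<and> card K = i \<and>
        Poly_Mapping.keys m \<subseteq> {..<n} \<and> monom_degree m = 2)"
      by (auto simp: linear_cycles_def)
    have "z \<in> koszul_bidegree R fs i (i + 1)"
      unfolding koszul_bidegree_def carrier_koszul
    proof (intro CollectI conjI allI impI)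
      show "z \<in> KC" using lingen_kelems[OF lingen.linear[OF linear]] .
      fix K assume "z K \<noteq> 0"
      then have "Poly_Mapping.keys (z K) \<noteq> {}" by simp
      then have c: "card K = i" using ksuppD[OF z] by blast
      then show "card K = i" .
      have "z K \<in> R 1" using ksuppD[OF z] by (auto simp: R veronese_def homog_poly_def)
      then show "\<exists>d. i + 1 = d + card K \<and> z K \<in> R d" using c by (intro exI[of _ 1]) simp
    qed
    then have "homology_class R fs z \<in> linear_strand R fs"
      unfolding linear_strand_def homology_bidegree_def
      using lingen_Z[OF lingen.linear[OF linear]] by (intro generate.incl) blast
    then show ?case unfolding generated_subalgebra_def by (intro generate_ring.incl) simp
  next
    case (add z w)
    have "homology_class R fs (z + w) = homology_class R fs z \<oplus>\<^bsub>?H\<^esub> homology_class R fs w"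
      using ring_hom_add[OF hom lingen_Z[OF add(1)] lingen_Z[OF add(2)]] by (simp add: koszul_ops)
    then show ?case using add unfolding generated_subalgebra_def by (simp add: generate_ring.eng_add)
  next
    case (mult z w)
    have "homology_class R fs (kmult z w) = homology_class R fs z \<otimes>\<^bsub>?H\<^esub> homology_class R fs w"
      using ring_hom_mult[OF hom lingen_Z[OF mult(1)] lingen_Z[OF mult(2)]] by (simp add: koszul_ops)
    then show ?case using mult unfolding generated_subalgebra_def by (simp add: generate_ring.eng_mult)
  qed
  show ?thesis
  proof
    show "generated_subalgebra R fs (linear_strand R fs) \<subseteq> carrier ?H"
      unfolding generated_subalgebra_def by (rule H.generate_ring_incl[OF sub])
    show "carrier ?H \<subseteq> generated_subalgebra R fs (linear_strand R fs)"
    proof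
      fix x assume "x \<in> carrier ?H"
      then obtain z where z: "z \<in> KC" "koszul_diff fs z = 0" "x = homology_class R fs z"
        unfolding carrier_H carrier_cycles by auto
      obtain q b where q: "q \<in> lingen n fs" and b: "b \<in> KC" and zqb: "z = q + koszul_diff fs b"
        using cycle_decomposition[OF basis z(1,2)] by blast
      have dB: "koszul_diff fs b \<in> ?B" using b by (simp add: koszul_boundaries_def carrier_koszul)
      then have dZ: "koszul_diff fs b \<in> carrier ?Z" by (rule I.Icarr)
      have "homology_class R fs (koszul_diff fs b) = \<zero>\<^bsub>?H\<^esub>"
        unfolding homology_class_def koszul_homology_def FactRing_def using I.a_rcos_const[OF dB] by simp
      then have "x = homology_class R fs q"
        using ring_hom_add[OF hom lingen_Z[OF q] dZ] ring_hom_closed[OF hom lingen_Z[OF q]]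
        by (simp add: z(3) zqb koszul_ops)
      then show "x \<in> generated_subalgebra R fs (linear_strand R fs)" using gen[OF q] by simp
    qed
  qed
qed

end

theorem corollary2p4:
  fixes n :: nat
    and R :: "nat \<Rightarrow> 'k::field_char_0 mpoly set"
    and fs :: "'k mpoly list"
  assumes "n > 0"
    and "R = veronese 2 (homog_poly n)"
    and "is_basis_of fs (R 1)"
  shows "generated_subalgebra R fs (linear_strand R fs) = carrier (koszul_homology R fs)"
  using assms by (intro generated_by_linear_strand) (auto simp: veronese_def)

end
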